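(* Let $\Phi$ be an admissible flux interpolation with constant $L_\Phi$, let $\mu\in\mathcal M^+(\mathbb R^d)$, and let $\rho_0\in\mathcal M_{TV}^M(\mathbb R^d)$. Let $V:[0,T]\times\mathcal M_{TV}^M(\mathbb R^d)\times\mathbb R^{2d}_{/}\to\mathbb R$ be a velocity field (i.e. $V_t[\rho]\in\mathcal V^{\mathrm{as}}(\mathbb R^{2d}_{/})$ for all $t,\rho$) such that, for some constants $C_V>0$ and $L_V\ge 0$, $$\sup_{t\in[0,T]}\ \sup_{\rho\in\mathcal M_{TV}^M(\mathbb R^d)}\ \sup_{x\in\mathbb R^d}\int_{\mathbb R^d\setminus\{x\}}|V_t[\rho](x,y)|\,\mathrm d\mu(y)\le C_V,$$ and, for all $t\in[0,T]$ and all $\rho,\sigma\in\mathcal M_{TV}^M(\mathbb R^d)$, $$\sup_{x\in\mathbb R^d}\int_{\mathbb R^d\setminus\{x\}}|V_t[\rho](x,y)-V_t[\sigma](x,y)|\,\mathrm d\mu(y)\le L_V\|\rho-\sigma\|_{TV}.$$ Let $\omega:[0,T]\times\mathcal M_{TV}^M(\mathbb R^d)\times\mathbb R^{2d}_{/}\to\mathbb R$ satisfy: (1) for all $t$ and $\sigma$ the map $(x,y)\mapsto\omega_t[\sigma](x,y)$ is continuous on $\mathbb R^{2d}_{/}$, and for all $\sigma$ and $(x,y)$ the map $t\mapsto\omega_t[\sigma](x,y)$ belongs to $L^1([0,T])$; (2) there is a constant $L_\omega\ge0$ such that $\sup_{t\in[0,T]}\sup_{(x,y)\in\mathbb R^{2d}_{/}}|\omega_t[\sigma](x,y)-\omega_t[\rho](x,y)|\le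 L_\omega\|\sigma-\rho\|_{TV}$ for all $\rho,\sigma\in\mathcal M_{TV}^M(\mathbb R^d)$; (3) there is a constant $C_\omega>0$ such that $\sup_{t\in[0,T]}\sup_{\rho\in\mathcal M_{TV}^M(\mathbb R^d)}\sup_{(x,y)\in\mathbb R^{2d}_{/}}|\omega_t[\rho](x,y)|\le C_\omega$; (4) for all $\sigma$ and $(x,y)$ the map $t\mapsto\omega_t[\sigma](x,y)$ belongs to the Sobolev space $W^{1,1}([0,T])$; (5) there is a constant $\widetilde C_\omega\in(0,\infty)$ such that $\operatorname{ess\,sup}_{t\in[0,T]}\sup_{\sigma\in\mathcal M_{TV}^M(\mathbb R^d)}\sup_{(x,y)\in\mathbb R^{2d}_{/}}|\partial_t\omega_t[\sigma](x,y)|\le\widetilde C_\omega$. Let $(\varepsilon_n)_{n\in\mathbb N}\subset(0,\infty)$ with $\varepsilon_n\to0^+$ as $n\to\infty$, and consider a sequence $\{(\rho^n,\eta^n)\}_{n\in\mathbb N}$ of solutions on $[0,T]$ of $$\partial_t\rho^n_t=-\overline\nabla\cdot F^\Phi[\mu,\eta^n_t;\rho^n_t,V_t[\rho^n_t]],\qquad \varepsilon_n\,\partial_t\eta^n_t=\omega_t[\rho^n_t]-\eta^n_t,$$ with initial data $\eta^n_0\in C_b(\mathbb R^{2d}_{/})$ and $\rho^n_0\in\mathcal M_{TV}^M(\mathbb R^d)$ satisfying $\|\eta^n_0-\omega_0[\rho^n_0]\|_\infty\to0$ as $n\to\infty$. Then $$d_\infty\big((\rho^n,\eta^n),(\rho,\omega)\big)\to0\quad\text{as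 }n\to\infty,$$ where $\omega$ in the second slot denotes the curve $t\mapsto\omega_t[\rho_t]$ and where, for a.e. $t\in[0,T]$, $\rho$ solves $$\rho_t+\int_0^t\overline\nabla\cdot F^\Phi[\mu,\omega_s[\rho_s];\rho_s,V_s[\rho_s]]\,\mathrm ds=\rho_0,$$ understood in duality with $C_0(\mathbb R^d)$.
   Context: $d\in\mathbb N$, $T\in(0,\infty)$ and $M>0$ are fixed. $\mathbb R^{2d}_{/}:=\{(x,y)\in\mathbb R^d\times\mathbb R^d:x\neq y\}$. $\mathcal M(A)$ and $\mathcal M^+(A)$ denote the signed, respectively nonnegative, Radon measures on $A$. $\mathcal M_{TV}(\mathbb R^d)$ is the space of signed Radon measures on $\mathbb R^d$ with finite total variation, with norm $\|\sigma\|_{TV}=|\sigma|(\mathbb R^d)$, and $\mathcal M_{TV}^M(\mathbb R^d)=\{\rho\in\mathcal M_{TV}(\mathbb R^d):|\rho|(\mathbb R^d)\le M\}$. $C_0(\mathbb R^d)$ is the space of continuous functions vanishing at infinity; $C_b(\mathbb R^{2d}_{/})$ is the space of bounded continuous functions with the sup-norm $\|\cdot\|_\infty$. Subscript $t$ denotes time dependence; $\langle\varphi,\sigma\rangle=\int\varphi\,\mathrm d\sigma$. $\mathcal V^{\mathrm{as}}(\mathbb R^{2d}_{/})=\{v:\mathbb R^{2d}_{/}\to\mathbb R : v(x,y)=-v(y,x)\}$. Nonlocal gradient: $\overline\nabla\varphi(x,y)=\varphi(y)-\varphi(x)$. Nonlocal divergence of $\boldsymbol j\in\mathcal M(\mathbb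 R^{2d}_{/})$: $\int_{\mathbb R^d}\varphi\,\mathrm d\overline\nabla\cdot\boldsymbol j=-\frac12\iint_{\mathbb R^{2d}_{/}}\overline\nabla\varphi\,\mathrm d\boldsymbol j$ for $\varphi\in C_0(\mathbb R^d)$. Admissible flux interpolation: a measurable $\Phi:\mathbb R^3\to\mathbb R$ such that (i) $\Phi(0,0;v)=\Phi(a,b;0)=0$ for all $a,b,v\in\mathbb R$; (ii) for some $L_\Phi>0$ and all $a,b,c,d,v,w\in\mathbb R$: $|\Phi(a,b;w)-\Phi(a,b;v)|\le L_\Phi(|a|+|b|)|w-v|$ and $|\Phi(a,b;v)-\Phi(c,d;v)|\le L_\Phi(|a-c|+|b-d|)|v|$; (iii) $\Phi(\alpha a,\alpha b;w)=\alpha\Phi(a,b;w)$ for all $\alpha>0$, $(a,b,w)\in\mathbb R^3$. Admissible flux: for $\rho\in\mathcal M_{TV}(\mathbb R^d)$, $w\in\mathcal V^{\mathrm{as}}(\mathbb R^{2d}_{/})$, measurable $\eta:\mathbb R^{2d}_{/}\to\mathbb R$ and $\lambda\in\mathcal M^+(\mathbb R^{2d})$ with $\rho\otimes\mu,\mu\otimes\rho\ll\lambda$, the measure $F^\Phi[\mu,\eta;\rho,w]$ on $\mathbb R^{2d}_{/}$ is $$\mathrm dF^\Phi[\mu,\eta;\rho,w]=\Phi\Big(\tfrac{\mathrm d(\rho\otimes\mu)}{\mathrm d\lambda},\tfrac{\mathrm d(\mu\otimes\rho)}{\mathrm d\lambda};w\Big)\,\eta\,\mathrm d\lambda$$ (independent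 of the choice of $\lambda$ by one-homogeneity; e.g. $\lambda=|\rho|\otimes\mu+\mu\otimes|\rho|$). For a normed space $S$ and $B\subseteq S$, $AC([0,T];B)$ is the set of curves $\gamma:[0,T]\to B$ for which there is $m\in L^1([0,T])$ with $\|\gamma_t-\gamma_s\|_S\le\int_s^tm(r)\,\mathrm dr$ for $0\le s<t\le T$. Solution: given $\varepsilon>0$, a pair $(\rho,\eta):[0,T]\to\mathcal M_{TV}^M(\mathbb R^d)\times C_b(\mathbb R^{2d}_{/})$ is a solution of $\partial_t\rho_t=-\overline\nabla\cdot F^\Phi[\mu,\eta_t;\rho_t,V_t[\rho_t]]$, $\varepsilon\partial_t\eta_t=\omega_t[\rho_t]-\eta_t$ if, for every $\varphi\in C_0(\mathbb R^d)$: (i) $\rho\in AC([0,T];\mathcal M_{TV}^M(\mathbb R^d))$ (with respect to $\|\cdot\|_{TV}$) and $\eta\in AC([0,T];C_b(\mathbb R^{2d}_{/}))$; (ii) the maps $t\mapsto\langle\varphi,\overline\nabla\cdot F^\Phi[\mu,\eta_t;\rho_t,V_t[\rho_t]]\rangle$ and $t\mapsto\frac1\varepsilon(\omega_t[\rho_t]-\eta_t)$ belong to $L^1([0,T])$; (iii) for a.e. $t\in[0,T]$ and every $(x,y)\in\mathbb R^{2d}_{/}$, $$\int\varphi\,\mathrm d\rho_t=\int\varphi\,\mathrm d\rho_0+\frac12\int_0^t\iint_{\mathbb R^{2d}_{/}}\overline\nabla\varphi\,\mathrm dF^\Phi[\mu,\eta_s;\rho_s,V_s[\rho_s]]\,\mathrm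 ds,$$ $$\eta_t(x,y)=\eta_0(x,y)+\frac1\varepsilon\int_0^t(\omega_s[\rho_s](x,y)-\eta_s(x,y))\,\mathrm ds.$$ The limiting equation for $\rho$ is understood as the first integral identity with $\eta_s$ replaced by $\omega_s[\rho_s]$. Metric: $d_\infty((\rho^1,\eta^1),(\rho^2,\eta^2))=\sup_{t\in[0,T]}\|\rho^1_t-\rho^2_t\|_{TV}+\sup_{t\in[0,T]}\|\eta^1_t-\eta^2_t\|_\infty$.
   Formalization: Added: ‖ρ^n_0−ρ_0‖_TV→0; without it the claim fails (V=0, ω=0, ρ^n_0 alternating), and the conclusion forces it. Each V_t[ρ] is taken Borel measurable, and t↦ω_t[σ](x,y) in W^{1,1} is its continuous representative (other representatives can break the claim). *)

theory Defs
  imports "HOL-Analysis.Analysis"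
begin

section \<open>Signed measures\<close>

text \<open>A (finite) signed measure is a real-valued set function that is countably additive on the
  Borel sets; it is set to 0 on the other sets, so that equality of set functions is equality of
  measures. On Euclidean spaces such set functions are automatically regular, i.e. Radon.\<close>

type_synonym 'a smeasure = "'a set \<Rightarrow> real"

definition signed_measure :: "'a::topological_space smeasure \<Rightarrow> bool" where
  "signed_measure \<sigma> \<longleftrightarrow>
     \<sigma> {} = 0 \<and>
     (\<forall>A :: nat \<Rightarrow> 'a set. range A \<subseteq> sets borel \<longrightarrow> disjoint_family A \<longrightarrow>
        (\<lambda>i. \<sigma> (A i)) sums \<sigma> (\<Union>i. A i)) \<and>
     (\<forall>A. A \<notin> sets borel \<longrightarrow> \<sigma> A = 0)"

text \<open>Jordan decomposition. Negative values are cut off by \<^const>\<open>ennreal\<close>, which does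
  not change the supremum because of \<open>B = {}\<close>.\<close>

definition jordan_pos :: "'a::topological_space smeasure \<Rightarrow> 'a measure" where
  "jordan_pos \<sigma> =
     measure_of UNIV (sets borel) (\<lambda>A. SUP B\<in>{B \<in> sets borel. B \<subseteq> A}. ennreal (\<sigma> B))"

definition jordan_neg :: "'a::topological_space smeasure \<Rightarrow> 'a measure" where
  "jordan_neg \<sigma> = jordan_pos (\<lambda>A. - \<sigma> A)"

definition measure_add :: "'a measure \<Rightarrow> 'a measure \<Rightarrow> 'a measure" where
  "measure_add P Q = measure_of (space P) (sets P) (\<lambda>A. emeasure P A + emeasure Q A)"

definition variation :: "'a::topological_space smeasure \<Rightarrow> 'a measure" where
  "variation \<sigma> = measure_add (jordan_pos \<sigma>) (jordan_neg \<sigma>)"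

definition M_TV :: "'a::topological_space smeasure set" where
  "M_TV = {\<sigma>. signed_measure \<sigma> \<and> emeasure (variation \<sigma>) UNIV < \<infinity>}"

definition tv_norm :: "'a::topological_space smeasure \<Rightarrow> real" where
  "tv_norm \<sigma> = measure (variation \<sigma>) UNIV"

definition M_TV_ball :: "real \<Rightarrow> 'a::topological_space smeasure set" where
  "M_TV_ball M = {\<sigma> \<in> M_TV. tv_norm \<sigma> \<le> M}"

definition sintegral :: "'a::topological_space smeasure \<Rightarrow> ('a \<Rightarrow> real) \<Rightarrow> real" where
  "sintegral \<sigma> f = (LINT x|jordan_pos \<sigma>. f x) - (LINT x|jordan_neg \<sigma>. f x)"

text \<open>Nonnegative Radon measures on a Euclidean space: regularity is automatic there.\<close>

definition radon_measure :: "'a::euclidean_space measure \<Rightarrow> bool" where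
  "radon_measure \<mu> \<longleftrightarrow> sets \<mu> = sets borel \<and> (\<forall>K. compact K \<longrightarrow> emeasure \<mu> K < \<infinity>)"


section \<open>Functions and nonlocal operators\<close>

definition offdiag :: "('a \<times> 'a) set" where
  "offdiag = {(x, y). x \<noteq> y}"

definition C_0 :: "('a::euclidean_space \<Rightarrow> real) set" where
  "C_0 = {\<phi>. continuous_on UNIV \<phi> \<and> (\<phi> \<longlongrightarrow> 0) at_infinity}"

text \<open>Functions on \<^const>\<open>offdiag\<close> are represented by functions on the full product; their values
  on the diagonal never matter.\<close>

definition C_b :: "('a::euclidean_space \<times> 'a \<Rightarrow> real) set" where
  "C_b = {f. continuous_on offdiag f \<and> bounded (f ` offdiag)}"

definition sup_norm :: "('a \<times> 'a \<Rightarrow> real) \<Rightarrow> real" where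
  "sup_norm f = (SUP z\<in>offdiag. \<bar>f z\<bar>)"

definition V_as :: "('a \<times> 'a \<Rightarrow> real) set" where
  "V_as = {v. \<forall>x y. x \<noteq> y \<longrightarrow> v (x, y) = - v (y, x)}"

definition nl_grad :: "('a \<Rightarrow> real) \<Rightarrow> 'a \<times> 'a \<Rightarrow> real" where
  "nl_grad \<phi> = (\<lambda>(x, y). \<phi> y - \<phi> x)"

text \<open>The nonlocal divergence, as a functional on \<^const>\<open>C_0\<close>. A measure on \<^const>\<open>offdiag\<close> is
  represented by its extension to the product by 0 on the diagonal.\<close>

definition nl_div :: "('a::euclidean_space \<times> 'a) smeasure \<Rightarrow> ('a \<Rightarrow> real) \<Rightarrow> real" where
  "nl_div j \<phi> = - (1/2) * sintegral j (nl_grad \<phi>)"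


section \<open>Fluxes\<close>

definition flux_interpolation :: "(real \<Rightarrow> real \<Rightarrow> real \<Rightarrow> real) \<Rightarrow> real \<Rightarrow> bool" where
  "flux_interpolation \<Phi> L \<longleftrightarrow>
     (\<lambda>(a, b, v). \<Phi> a b v) \<in> borel_measurable borel \<and>
     (\<forall>v. \<Phi> 0 0 v = 0) \<and> (\<forall>a b. \<Phi> a b 0 = 0) \<and>
     L > 0 \<and>
     (\<forall>a b v w. \<bar>\<Phi> a b w - \<Phi> a b v\<bar> \<le> L * (\<bar>a\<bar> + \<bar>b\<bar>) * \<bar>w - v\<bar>) \<and>
     (\<forall>a b c d v. \<bar>\<Phi> a b v - \<Phi> c d v\<bar> \<le> L * (\<bar>a - c\<bar> + \<bar>b - d\<bar>) * \<bar>v\<bar>) \<and>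
     (\<forall>\<alpha>>0. \<forall>a b w. \<Phi> (\<alpha> * a) (\<alpha> * b) w = \<alpha> * \<Phi> a b w)"

text \<open>Densities of the signed products of \<open>\<rho>\<close> and \<open>\<mu>\<close>, in both orders. As \<open>\<mu>\<close> may be infinite,
  the signed product need not be a real-valued set function, so its density is the difference of
  the densities of the products with the Jordan parts of \<open>\<rho>\<close>.\<close>

definition dens_left ::
  "('a::euclidean_space \<times> 'a) measure \<Rightarrow> 'a smeasure \<Rightarrow> 'a measure \<Rightarrow> 'a \<times> 'a \<Rightarrow> real" where
  "dens_left lam \<rho> \<mu> z =
     enn2real (RN_deriv lam (jordan_pos \<rho> \<Otimes>\<^sub>M \<mu>) z) - enn2real (RN_deriv lam (jordan_neg \<rho> \<Otimes>\<^sub>M \<mu>) z)"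

definition dens_right ::
  "('a::euclidean_space \<times> 'a) measure \<Rightarrow> 'a measure \<Rightarrow> 'a smeasure \<Rightarrow> 'a \<times> 'a \<Rightarrow> real" where
  "dens_right lam \<mu> \<rho> z =
     enn2real (RN_deriv lam (\<mu> \<Otimes>\<^sub>M jordan_pos \<rho>) z) - enn2real (RN_deriv lam (\<mu> \<Otimes>\<^sub>M jordan_neg \<rho>) z)"

definition flux_wrt ::
  "('a::euclidean_space \<times> 'a) measure \<Rightarrow> (real \<Rightarrow> real \<Rightarrow> real \<Rightarrow> real) \<Rightarrow> 'a measure \<Rightarrow>
   ('a \<times> 'a \<Rightarrow> real) \<Rightarrow> 'a smeasure \<Rightarrow> ('a \<times> 'a \<Rightarrow> real) \<Rightarrow> ('a \<times> 'a) smeasure" where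
  "flux_wrt lam \<Phi> \<mu> \<eta> \<rho> w B =
     (if B \<in> sets borel
      then (LINT z:(B \<inter> offdiag)|lam. \<Phi> (dens_left lam \<rho> \<mu> z) (dens_right lam \<mu> \<rho> z) (w z) * \<eta> z)
      else 0)"

text \<open>The flux does not depend on the dominating measure, by one-homogeneity of \<open>\<Phi>\<close>; we use
  \<open>|\<rho>| \<otimes> \<mu> + \<mu> \<otimes> |\<rho>|\<close>.\<close>

definition flux ::
  "(real \<Rightarrow> real \<Rightarrow> real \<Rightarrow> real) \<Rightarrow> 'a::euclidean_space measure \<Rightarrow>
   ('a \<times> 'a \<Rightarrow> real) \<Rightarrow> 'a smeasure \<Rightarrow> ('a \<times> 'a \<Rightarrow> real) \<Rightarrow> ('a \<times> 'a) smeasure" where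
  "flux \<Phi> \<mu> \<eta> \<rho> w =
     flux_wrt (measure_add (variation \<rho> \<Otimes>\<^sub>M \<mu>) (\<mu> \<Otimes>\<^sub>M variation \<rho>)) \<Phi> \<mu> \<eta> \<rho> w"


section \<open>Curves in time\<close>

text \<open>Here \<open>nrm\<close> is the norm of the ambient space.\<close>

definition AC_curve :: "('b::minus \<Rightarrow> real) \<Rightarrow> 'b set \<Rightarrow> real \<Rightarrow> (real \<Rightarrow> 'b) \<Rightarrow> bool" where
  "AC_curve nrm B T \<gamma> \<longleftrightarrow>
     (\<forall>t\<in>{0..T}. \<gamma> t \<in> B) \<and>
     (\<exists>m. m absolutely_integrable_on {0..T} \<and>
        (\<forall>s t. 0 \<le> s \<and> s < t \<and> t \<le> T \<longrightarrow> nrm (\<gamma> t - \<gamma> s) \<le> (LINT r:{s..t}|lebesgue. m r)))"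

text \<open>\<open>g\<close> is a weak derivative of \<open>f\<close> on \<open>(0, T)\<close>, tested against continuously differentiable
  functions with compact support in \<open>(0, T)\<close>.\<close>

definition weak_deriv :: "real \<Rightarrow> (real \<Rightarrow> real) \<Rightarrow> (real \<Rightarrow> real) \<Rightarrow> bool" where
  "weak_deriv T f g \<longleftrightarrow>
     f absolutely_integrable_on {0..T} \<and> g absolutely_integrable_on {0..T} \<and>
     (\<forall>\<psi> \<psi>'. (\<forall>t. (\<psi> has_real_derivative \<psi>' t) (at t)) \<and> continuous_on UNIV \<psi>' \<and>
        (\<exists>a b. 0 < a \<and> b < T \<and> (\<forall>t. t \<notin> {a..b} \<longrightarrow> \<psi> t = 0)) \<longrightarrow>
        (LINT t:{0..T}|lebesgue. f t * \<psi>' t) = - (LINT t:{0..T}|lebesgue. g t * \<psi> t))"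

text \<open>Sobolev functions of one variable are identified with their continuous representatives:
  they are evaluated at every time below, not just at almost every time.\<close>

definition W11 :: "real \<Rightarrow> (real \<Rightarrow> real) set" where
  "W11 T = {f. continuous_on {0..T} f \<and> (\<exists>g. weak_deriv T f g)}"


section \<open>Solutions\<close>

definition continuity_eq ::
  "real \<Rightarrow> (real \<Rightarrow> real \<Rightarrow> real \<Rightarrow> real) \<Rightarrow> 'a::euclidean_space measure \<Rightarrow>
   (real \<Rightarrow> 'a smeasure \<Rightarrow> 'a \<times> 'a \<Rightarrow> real) \<Rightarrow>
   (real \<Rightarrow> 'a \<times> 'a \<Rightarrow> real) \<Rightarrow> (real \<Rightarrow> 'a smeasure) \<Rightarrow> 'a smeasure \<Rightarrow> bool" where
  "continuity_eq T \<Phi> \<mu> V \<eta> \<rho> \<rho>\<^sub>0 \<longleftrightarrow>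
     (\<forall>\<phi>\<in>C_0.
        (\<lambda>t. nl_div (flux \<Phi> \<mu> (\<eta> t) (\<rho> t) (V t (\<rho> t))) \<phi>) absolutely_integrable_on {0..T} \<and>
        (AE t in lebesgue. t \<in> {0..T} \<longrightarrow>
           sintegral (\<rho> t) \<phi> = sintegral \<rho>\<^sub>0 \<phi> +
             (1/2) * (LINT s:{0..t}|lebesgue.
                sintegral (flux \<Phi> \<mu> (\<eta> s) (\<rho> s) (V s (\<rho> s))) (nl_grad \<phi>))))"

definition is_solution ::
  "real \<Rightarrow> real \<Rightarrow> (real \<Rightarrow> real \<Rightarrow> real \<Rightarrow> real) \<Rightarrow> 'a::euclidean_space measure \<Rightarrow>
   (real \<Rightarrow> 'a smeasure \<Rightarrow> 'a \<times> 'a \<Rightarrow> real) \<Rightarrow> (real \<Rightarrow> 'a smeasure \<Rightarrow> 'a \<times> 'a \<Rightarrow> real) \<Rightarrow> real \<Rightarrow>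
   (real \<Rightarrow> 'a smeasure) \<Rightarrow> (real \<Rightarrow> 'a \<times> 'a \<Rightarrow> real) \<Rightarrow> bool" where
  "is_solution T M \<Phi> \<mu> V \<omega> \<epsilon> \<rho> \<eta> \<longleftrightarrow>
     AC_curve tv_norm (M_TV_ball M) T \<rho> \<and>
     AC_curve sup_norm C_b T \<eta> \<and>
     continuity_eq T \<Phi> \<mu> V \<eta> \<rho> (\<rho> 0) \<and>
     (\<forall>z\<in>offdiag. (\<lambda>t. (1/\<epsilon>) * (\<omega> t (\<rho> t) z - \<eta> t z)) absolutely_integrable_on {0..T}) \<and>
     (AE t in lebesgue. t \<in> {0..T} \<longrightarrow>
        (\<forall>z\<in>offdiag. \<eta> t z = \<eta> 0 z + (1/\<epsilon>) * (LINT s:{0..t}|lebesgue. \<omega> s (\<rho> s) z - \<eta> s z)))"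

definition d_inf ::
  "real \<Rightarrow> (real \<Rightarrow> 'a::euclidean_space smeasure) \<times> (real \<Rightarrow> 'a \<times> 'a \<Rightarrow> real) \<Rightarrow>
   (real \<Rightarrow> 'a smeasure) \<times> (real \<Rightarrow> 'a \<times> 'a \<Rightarrow> real) \<Rightarrow> ennreal" where
  "d_inf T = (\<lambda>(\<rho>1, \<eta>1) (\<rho>2, \<eta>2).
     (SUP t\<in>{0..T}. ennreal (tv_norm (\<rho>1 t - \<rho>2 t))) +
     (SUP t\<in>{0..T}. ennreal (sup_norm (\<eta>1 t - \<eta>2 t))))"

end

theory Submission
  imports Defs
begin

text \<open>The defect \<open>\<eta>\<^sup>n - \<omega>[\<rho>\<^sup>n]\<close> is controlled pointwise: \<open>\<eta>\<^sup>n\<close> relaxes at rate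
  \<open>1 / \<epsilon>\<^sub>n\<close> towards \<open>t \<mapsto> \<omega>\<^sub>t[\<rho>\<^sup>n\<^sub>t]\<close>, which is Lipschitz in time uniformly in \<open>n\<close>, so the defect
  is bounded by its initial value plus a multiple of \<open>\<epsilon>\<^sub>n\<close>. Hence the curves \<open>\<rho>\<^sup>n\<close> solve the same
  equation up to an error tending to 0, and as the flux is Lipschitz in total variation, Gronwall's
  inequality makes them uniformly Cauchy; completeness yields the limit, and dominated convergence
  passes to the limit in the equation.

  The flux estimates use a finite measure \<open>\<nu>\<close> such that \<open>\<rho> = r \<nu>\<close> and \<open>\<sigma> = s \<nu>\<close>. If \<open>\<nu> \<otimes> \<mu>\<close> and
  \<open>\<mu> \<otimes> \<nu>\<close> have densities \<open>p\<close> and \<open>q\<close> with respect to \<open>\<lambda>\<close>, then one-homogeneity of \<open>\<Phi>\<close> gives the flux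
  of \<open>\<rho>\<close> the \<open>\<lambda>\<close>-density \<open>\<Phi> (p r(x)) (q r(y)) w \<cdot> \<eta>\<close>. The passage from the weak formulation to
  the total variation norm is by duality with \<open>C\<^sub>0\<close>.\<close>

section \<open>Signed measures and their densities\<close>

text \<open>Comparing the approximations with each other, rather than with a given limit, yields a
  limit solution together with the convergence. One obstacle is a threatening circle: the Lipschitz
  constant in time of \<open>\<rho>n n\<close> involves a bound on \<open>\<eta>n n\<close>, whose
  equation carries the factor \<open>1/\<epsilon>\<close>. It is avoided because relaxation towards
  a bounded target stays bounded at any rate, which bounds \<open>\<eta>n n\<close> before anything
  is known about \<open>\<rho>n n\<close>. Absolute continuity could not supply the Lipschitz
  constant, as its modulus may depend on \<open>n\<close>. Another obstacle is that the flux of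
  \<rho> is defined through a dominating measure that depends on \<rho>, so two fluxes have no
  common density by definition; hence the auxiliary \<nu>. Both orders of integration occur in the
  flux estimate, while \<open>V\<close> is controlled in its second variable only; antisymmetry
  supplies the other. Finally, the equations hold at almost every time and \<open>V\<close> carries
  no measurability in time. Continuity of both sides gives the identities at every time, and the
  limiting flux inherits its integrability in time from the approximations.\<close>

lemma sets_measure_add [simp]: "sets (measure_add P Q) = sets P"
  and space_measure_add [simp]: "space (measure_add P Q) = space P"
  using sets.sigma_sets_eq[of P] by (simp_all add: measure_add_def sets.space_closed)

lemma emeasure_measure_add:
  assumes "sets P = sets Q" "A \<in> sets P"
  shows "emeasure (measure_add P Q) A = emeasure P A + emeasure Q A"
proof (rule emeasure_measure_of[OF measure_add_def])
  show "countably_additive (sets (measure_add P Q)) (\<lambda>A. emeasure P A + emeasure Q A)"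
    using assms(1) by (auto simp: countably_additive_def suminf_add[symmetric] suminf_emeasure)
qed (use assms in \<open>auto simp: positive_def sets.space_closed dest: sets.sets_into_space\<close>)

lemma measure_addI:
  assumes "sets P = sets N" "sets Q = sets N"
    and "\<And>A. A \<in> sets N \<Longrightarrow> emeasure N A = emeasure P A + emeasure Q A"
  shows "measure_add P Q = N"
  by (rule measure_eqI) (use assms in \<open>simp_all add: emeasure_measure_add\<close>)

lemma measure_add_density:
  assumes [measurable]: "f \<in> borel_measurable M" "g \<in> borel_measurable M"
  shows "measure_add (density M f) (density M g) = density M (\<lambda>x. f x + g x)"
  by (rule measure_addI)
     (simp_all add: emeasure_density distrib_right nn_integral_add)

lemma finite_measure_measure_add:
  assumes "finite_measure P" "finite_measure Q" "sets P = sets Q"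
  shows "finite_measure (measure_add P Q)"
proof
  have "space P = space Q" using assms(3) by (rule sets_eq_imp_space_eq)
  then show "emeasure (measure_add P Q) (space (measure_add P Q)) \<noteq> \<infinity>"
    using assms by (simp add: emeasure_measure_add finite_measure.emeasure_finite)
qed

section \<open>Jordan parts and total variation\<close>

lemma sets_jordan_pos [simp]: "sets (jordan_pos \<sigma>) = sets borel"
  and space_jordan_pos [simp]: "space (jordan_pos \<sigma>) = UNIV"
  using sets.sigma_sets_eq[of "borel :: 'a measure"] by (simp_all add: jordan_pos_def)

lemma sets_jordan_neg [simp]: "sets (jordan_neg \<sigma>) = sets borel"
  and space_jordan_neg [simp]: "space (jordan_neg \<sigma>) = UNIV"
  by (simp_all add: jordan_neg_def)

lemma sets_variation [simp]: "sets (variation \<sigma>) = sets borel"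
  and space_variation [simp]: "space (variation \<sigma>) = UNIV"
  by (simp_all add: variation_def)

lemma signed_measure_Un:
  assumes "signed_measure \<sigma>" "A \<in> sets borel" "B \<in> sets borel" "A \<inter> B = {}"
  shows "\<sigma> (A \<union> B) = \<sigma> A + \<sigma> B"
proof -
  have "(\<lambda>i. \<sigma> (binaryset A B i)) sums \<sigma> (\<Union>i. binaryset A B i)"
  proof -
    have "disjoint_family (binaryset A B)" "range (binaryset A B) \<subseteq> sets borel"
      using assms by (auto simp: disjoint_family_on_def binaryset_def)
    then show ?thesis
      using assms(1) unfolding signed_measure_def by blast
  qed
  moreover have "(\<lambda>i. \<sigma> (binaryset A B i)) sums (\<sigma> A + \<sigma> B)"
    using assms(1) by (intro binaryset_sums) (simp add: signed_measure_def)
  ultimately show ?thesis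
    by (simp add: UN_binaryset_eq sums_unique2)
qed

lemma signed_measure_uminus: "signed_measure \<sigma> \<Longrightarrow> signed_measure (\<lambda>A. - \<sigma> A)"
  unfolding signed_measure_def by (auto intro: sums_minus)

text \<open>\<open>measure_of\<close> returns the intended values only for a countably additive set
  function. Competitors in disjoint sets can be united, so the supremum is superadditive and
  dominates all partial sums; conversely, a competitor inside the union splits along the sets
  \<open>A i\<close>.\<close>

lemma emeasure_jordan_pos:
  fixes \<sigma> :: "'a::topological_space smeasure"
  assumes \<sigma>: "signed_measure \<sigma>" and "A \<in> sets borel"
  shows "emeasure (jordan_pos \<sigma>) A = (SUP B\<in>{B \<in> sets borel. B \<subseteq> A}. ennreal (\<sigma> B))"
proof -
  define F where "F A = (SUP B\<in>{B \<in> sets borel. B \<subseteq> A}. ennreal (\<sigma> B))" for A :: "'a set"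
  have \<sigma>0: "\<sigma> {} = 0" using \<sigma> by (simp add: signed_measure_def)
  have F_upper: "ennreal (\<sigma> B) \<le> F A" if "B \<in> sets borel" "B \<subseteq> A" for A B
    unfolding F_def using that by (intro SUP_upper) auto
  have mono: "F A \<le> F B" if "A \<subseteq> B" for A B
    unfolding F_def using that by (intro SUP_subset_mono) auto
  have super: "F A + F B \<le> F (A \<union> B)" if AB: "A \<inter> B = {}" for A B
  proof -
    have "ennreal (\<sigma> A') + ennreal (\<sigma> B') \<le> F (A \<union> B)"
      if "A' \<in> sets borel" "A' \<subseteq> A" "B' \<in> sets borel" "B' \<subseteq> B" for A' B'
    \<comment> \<open>\<open>ennreal\<close> is additive only on nonnegative reals. If one value is
      nonpositive, it is cut to 0 and the other set alone is a competitor inside the union.\<close>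
    proof (cases "\<sigma> A' \<le> 0 \<or> \<sigma> B' \<le> 0")
      case True
      then show ?thesis
        using that F_upper[of A' "A \<union> B"] F_upper[of B' "A \<union> B"]
        by (auto simp: ennreal_neg le_supI1 le_supI2)
    next
      case False
      then have "ennreal (\<sigma> A') + ennreal (\<sigma> B') = ennreal (\<sigma> (A' \<union> B'))"
        using that AB signed_measure_Un[OF \<sigma>, of A' B']
        by (subst ennreal_plus[symmetric]) (simp_all add: Int_mono[of A' A B' B, unfolded AB] subset_empty[symmetric] del: subset_empty)
      then show ?thesis
        using that F_upper[of "A' \<union> B'" "A \<union> B"] by auto
    qed
    note * = this
    have "F A + F B = (SUP A'\<in>{B \<in> sets borel. B \<subseteq> A}. ennreal (\<sigma> A') + F B)"
      unfolding F_def[of A] by (rule ennreal_SUP_add_left[symmetric]) auto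
    also have "\<dots> \<le> F (A \<union> B)"
    proof (rule SUP_least)
      fix A' assume A': "A' \<in> {B \<in> sets borel. B \<subseteq> A}"
      have "ennreal (\<sigma> A') + F B = (SUP B'\<in>{C \<in> sets borel. C \<subseteq> B}. ennreal (\<sigma> A') + ennreal (\<sigma> B'))"
        unfolding F_def by (rule ennreal_SUP_add_right) auto
      also have "\<dots> \<le> F (A \<union> B)"
        using A' * by (intro SUP_least) auto
      finally show "ennreal (\<sigma> A') + F B \<le> F (A \<union> B)" .
    qed
    finally show ?thesis .
  qed
  have "countably_additive (sets borel) F"
    unfolding countably_additive_def
  proof (intro allI impI)
    fix A :: "nat \<Rightarrow> 'a set"
    assume A: "range A \<subseteq> sets borel" "disjoint_family A"
    have fin: "(\<Sum>i<n. F (A i)) \<le> F (\<Union>i<n. A i)" for n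
    proof (induction n)
      case (Suc n)
      have "A n \<inter> (\<Union>i<n. A i) = {}"
      proof -
        have "A n \<inter> A i = {}" if "i < n" for i
          using A(2) that unfolding disjoint_family_on_def by (metis UNIV_I less_irrefl)
        then show ?thesis by blast
      qed
      then have "F (A n) + F (\<Union>i<n. A i) \<le> F (A n \<union> (\<Union>i<n. A i))"
        by (rule super)
      moreover have "A n \<union> (\<Union>i<n. A i) = (\<Union>i<Suc n. A i)"
        by (simp add: lessThan_Suc)
      moreover have "(\<Sum>i<Suc n. F (A i)) \<le> F (A n) + F (\<Union>i<n. A i)"
        using add_left_mono[OF Suc] by (simp add: add.commute)
      ultimately show ?case by (metis order_trans)
    qed simp
    have "(\<Sum>i. F (A i)) \<le> F (\<Union>i. A i)"
      unfolding suminf_eq_SUP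
      by (intro SUP_least order_trans[OF fin] mono) auto
    moreover have "F (\<Union>i. A i) \<le> (\<Sum>i. F (A i))"
      unfolding F_def[of "\<Union>i. A i"]
    proof (rule SUP_least)
      fix B assume B: "B \<in> {B \<in> sets borel. B \<subseteq> (\<Union>i. A i)}"
      have "(\<lambda>i. \<sigma> (B \<inter> A i)) sums \<sigma> (\<Union>i. B \<inter> A i)"
      proof -
        have "range (\<lambda>i. B \<inter> A i) \<subseteq> sets borel" using A B by (auto intro!: sets.Int)
        moreover have "disjoint_family (\<lambda>i. B \<inter> A i)"
          using A(2) unfolding disjoint_family_on_def by blast
        ultimately show ?thesis using \<sigma> unfolding signed_measure_def by blast
      qed
      moreover have "(\<Union>i. B \<inter> A i) = B" using B by auto
      ultimately have "(\<lambda>n. ennreal (\<Sum>i<n. \<sigma> (B \<inter> A i))) \<longlonglongrightarrow> ennreal (\<sigma> B)"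
        unfolding sums_def by (simp add: tendsto_ennrealI)
      then show "ennreal (\<sigma> B) \<le> (\<Sum>i. F (A i))"
      proof (rule LIMSEQ_le_const2, intro exI allI impI)
        fix n
        \<comment> \<open>Negative terms are raised to 0 before \<open>ennreal\<close> is moved
          inside the sum.\<close>
        have "ennreal (\<Sum>i<n. \<sigma> (B \<inter> A i)) \<le> ennreal (\<Sum>i<n. max 0 (\<sigma> (B \<inter> A i)))"
          by (intro ennreal_leI sum_mono) auto
        also have "\<dots> = (\<Sum>i<n. ennreal (max 0 (\<sigma> (B \<inter> A i))))"
          by simp
        also have "\<dots> = (\<Sum>i<n. ennreal (\<sigma> (B \<inter> A i)))"
          by (intro sum.cong refl) (simp add: max_def ennreal_neg)
        also have "\<dots> \<le> (\<Sum>i<n. F (A i))"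
          using A B by (intro sum_mono F_upper) (auto simp: image_subset_iff)
        also have "\<dots> \<le> (\<Sum>i. F (A i))"
          by (rule sum_le_suminf) auto
        finally show "ennreal (\<Sum>i<n. \<sigma> (B \<inter> A i)) \<le> (\<Sum>i. F (A i))" .
      qed
    qed
    ultimately show "(\<Sum>i. F (A i)) = F (\<Union>i. A i)" by (rule antisym)
  qed
  moreover have "positive (sets borel) F"
    by (simp add: positive_def F_def \<sigma>0)
  ultimately have "emeasure (jordan_pos \<sigma>) A = F A"
  proof -
    assume F: "countably_additive (sets borel) F" "positive (sets borel) F"
    have "jordan_pos \<sigma> = measure_of UNIV (sets borel) F"
      by (simp add: jordan_pos_def F_def[abs_def])
    then show ?thesis
      by (rule emeasure_measure_of) (use F assms(2) in simp_all)
  qed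
  then show ?thesis by (simp add: F_def)
qed

lemma emeasure_variation:
  assumes "A \<in> sets borel"
  shows "emeasure (variation \<sigma>) A = emeasure (jordan_pos \<sigma>) A + emeasure (jordan_neg \<sigma>) A"
  unfolding variation_def using assms by (subst emeasure_measure_add) auto

lemma M_TV_finite:
  assumes "\<sigma> \<in> M_TV"
  shows "finite_measure (jordan_pos \<sigma>)" "finite_measure (jordan_neg \<sigma>)" "finite_measure (variation \<sigma>)"
  using assms by (auto intro!: finite_measureI simp: M_TV_def emeasure_variation)

lemma M_TV_uminus:
  assumes "\<sigma> \<in> M_TV" shows "(\<lambda>A. - \<sigma> A) \<in> M_TV"
  using assms by (simp add: M_TV_def signed_measure_uminus emeasure_variation jordan_neg_def add.commute)

lemma tv_norm_eq:
  assumes "\<sigma> \<in> M_TV"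
  shows "tv_norm \<sigma> = measure (jordan_pos \<sigma>) UNIV + measure (jordan_neg \<sigma>) UNIV"
  using M_TV_finite[OF assms]
  by (simp add: tv_norm_def measure_def emeasure_variation enn2real_plus less_top[symmetric] finite_measure.emeasure_finite)

text \<open>A competitor \<open>B\<close> inside \<open>A\<close> leaves the remainder
  \<open>A - B\<close>, whose negated value is at most the negative part of \<open>A\<close>; the
  supremum over \<open>B\<close> gives one inequality. The other is the same inequality for the
  negated measure, so no Hahn set is constructed.\<close>

lemma jordan_decomposition:
  assumes \<sigma>: "\<sigma> \<in> M_TV" and A: "A \<in> sets borel"
  shows "\<sigma> A = measure (jordan_pos \<sigma>) A - measure (jordan_neg \<sigma>) A"
proof -
  have ineq: "measure (jordan_pos \<tau>) A \<le> \<tau> A + measure (jordan_neg \<tau>) A" if \<tau>: "\<tau> \<in> M_TV" for \<tau> :: "'a smeasure"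
  proof -
    interpret P: finite_measure "jordan_pos \<tau>" using \<tau> by (rule M_TV_finite)
    interpret N: finite_measure "jordan_neg \<tau>" using \<tau> by (rule M_TV_finite)
    have s: "signed_measure \<tau>" using \<tau> by (simp add: M_TV_def)
    have N: "- \<tau> B \<le> measure (jordan_neg \<tau>) A" if "B \<in> sets borel" "B \<subseteq> A" for B
    proof -
      have "ennreal (- \<tau> B) \<le> emeasure (jordan_neg \<tau>) A"
        unfolding jordan_neg_def
        using that A by (subst emeasure_jordan_pos[OF signed_measure_uminus[OF s]]) (auto intro!: SUP_upper)
      then show ?thesis by (simp add: N.emeasure_eq_measure)
    qed
    have "\<tau> B \<le> \<tau> A + measure (jordan_neg \<tau>) A" if "B \<in> sets borel" "B \<subseteq> A" for B
      using N[of "A - B"] signed_measure_Un[OF s, of B "A - B"] A that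
      by (auto simp: Un_absorb1)
    then have "emeasure (jordan_pos \<tau>) A \<le> ennreal (\<tau> A + measure (jordan_neg \<tau>) A)"
      using A by (subst emeasure_jordan_pos[OF s]) (auto intro!: SUP_least ennreal_leI)
    then show ?thesis
      using N[of A] A by (simp add: P.emeasure_eq_measure)
  qed
  show ?thesis
    using ineq[OF \<sigma>] ineq[OF M_TV_uminus[OF \<sigma>]] by (simp add: jordan_neg_def)
qed

lemma M_TV_abs_le_tv_norm:
  assumes "\<sigma> \<in> M_TV"
  shows "\<bar>\<sigma> A\<bar> \<le> tv_norm \<sigma>"
proof (cases "A \<in> sets borel")
  case True
  interpret P: finite_measure "jordan_pos \<sigma>" using assms by (rule M_TV_finite)
  interpret N: finite_measure "jordan_neg \<sigma>" using assms by (rule M_TV_finite)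
  show ?thesis
    using P.bounded_measure[of A] N.bounded_measure[of A]
    by (simp add: jordan_decomposition[OF assms True] tv_norm_eq[OF assms])
      (smt (verit) measure_nonneg)
next
  case False
  then show ?thesis using assms by (simp add: M_TV_def signed_measure_def tv_norm_def)
qed

text \<open>Each Jordan part is a supremum of values bounded by \<open>c\<close>, which explains the
  factor 2. The lemma turns bounds that are uniform over Borel sets into bounds in norm, and it is
  the origin of the factor in \<open>2 * B n\<close> in the convergence proof.\<close>

lemma M_TV_I:
  assumes "signed_measure \<sigma>" "\<And>A. A \<in> sets borel \<Longrightarrow> \<bar>\<sigma> A\<bar> \<le> c"
  shows "\<sigma> \<in> M_TV" "tv_norm \<sigma> \<le> 2 * c"
proof -
  have c: "c \<ge> 0" using assms(2)[of "{}"] by simp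
  have pn: "emeasure (jordan_pos \<sigma>) UNIV \<le> ennreal c" "emeasure (jordan_neg \<sigma>) UNIV \<le> ennreal c"
    unfolding jordan_neg_def using assms
    by (auto simp: emeasure_jordan_pos signed_measure_uminus abs_le_iff intro!: SUP_least ennreal_leI)
  then have v: "emeasure (variation \<sigma>) UNIV \<le> ennreal c + ennreal c"
    by (simp add: emeasure_variation add_mono)
  then have v: "emeasure (variation \<sigma>) UNIV \<le> ennreal (2 * c)"
    using c by (simp flip: ennreal_plus)
  then show "\<sigma> \<in> M_TV"
    using assms(1) by (simp add: M_TV_def le_less_trans)
  show "tv_norm \<sigma> \<le> 2 * c"
    using v c enn2real_mono[OF v] by (simp add: tv_norm_def measure_def)
qed

section \<open>Signed measures given by densities\<close>

lemma integrable_imp_set_integrable: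
  fixes f :: "'a \<Rightarrow> real"
  shows "integrable M f \<Longrightarrow> A \<in> sets M \<Longrightarrow> set_integrable M A f"
  unfolding set_integrable_def by (rule integrable_mult_indicator)

lemma integrable_mult_bounded:
  fixes f r :: "'a \<Rightarrow> real"
  assumes "integrable M r" "f \<in> borel_measurable M" "\<And>x. \<bar>f x\<bar> \<le> B"
  shows "integrable M (\<lambda>x. r x * f x)"
proof (rule Bochner_Integration.integrable_bound)
  show "integrable M (\<lambda>x. B * r x)" using assms by simp
  have "B \<ge> 0" using assms(3) abs_ge_zero order_trans by blast
  then have "norm (r x * f x) \<le> norm (B * r x)" for x
    using mult_left_mono[OF assms(3)[of x], of "\<bar>r x\<bar>"] by (simp add: abs_mult mult.commute)
  then show "AE x in M. norm (r x * f x) \<le> norm (B * r x)" by simp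
qed (use assms in auto)

text \<open>Translates statements about set functions into statements about integrable functions,
  where differences and norms are computed pointwise. The value 0 off the Borel sets matches
  \<open>signed_measure\<close>. The base measure may be infinite, because the predicate is also
  applied to fluxes over a sigma-finite measure on the product.\<close>

definition has_density :: "'a::topological_space smeasure \<Rightarrow> 'a measure \<Rightarrow> ('a \<Rightarrow> real) \<Rightarrow> bool" where
  "has_density \<sigma> \<nu> r \<longleftrightarrow> sets \<nu> = sets borel \<and> integrable \<nu> r \<and>
     (\<forall>A. \<sigma> A = (if A \<in> sets borel then LINT x:A|\<nu>. r x else 0))"

lemma has_density_sets: "has_density \<sigma> \<nu> r \<Longrightarrow> sets \<nu> = sets borel"
  and has_density_integrable: "has_density \<sigma> \<nu> r \<Longrightarrow> integrable \<nu> r"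
  by (auto simp: has_density_def)

lemma has_density_uminus:
  "has_density \<sigma> \<nu> r \<Longrightarrow> has_density (\<lambda>A. - \<sigma> A) \<nu> (\<lambda>x. - r x)"
  by (auto simp: has_density_def set_lebesgue_integral_def)

lemma has_density_diff:
  assumes "has_density \<rho> \<nu> r" "has_density \<sigma> \<nu> s"
  shows "has_density (\<rho> - \<sigma>) \<nu> (\<lambda>x. r x - s x)"
proof -
  have "set_integrable \<nu> A r" "set_integrable \<nu> A s" if "A \<in> sets borel" for A
    using assms that by (auto simp: has_density_def intro!: integrable_imp_set_integrable)
  then show ?thesis
    using assms by (auto simp: has_density_def)
qed

lemma has_density_signed_measure:
  assumes "has_density \<sigma> \<nu> r"
  shows "signed_measure \<sigma>"
proof -
  have sets: "sets \<nu> = sets borel" and r: "integrable \<nu> r"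
    and \<sigma>: "\<And>A. \<sigma> A = (if A \<in> sets borel then LINT x:A|\<nu>. r x else 0)"
    using assms by (auto simp: has_density_def)
  have "(\<lambda>i. \<sigma> (A i)) sums \<sigma> (\<Union>i. A i)"
    if A: "range A \<subseteq> sets borel" "disjoint_family A" for A :: "nat \<Rightarrow> 'a set"
  proof -
    have U: "(\<Union>i. A i) \<in> sets borel" using A(1) by auto
    have i: "set_integrable \<nu> B r" if "B \<in> sets borel" for B
      using r that sets by (intro integrable_imp_set_integrable) auto
    have "(\<lambda>n. LINT x:(\<Union>i<n. A i)|\<nu>. r x) \<longlonglongrightarrow> (LINT x:(\<Union>i. \<Union>j<i. A j)|\<nu>. r x)"
    proof (rule set_integral_cont_up)
      have "(\<Union>i. \<Union>j<i. A j) = (\<Union>i. A i)" by auto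
      then show "set_integrable \<nu> (\<Union>i. \<Union>j<i. A j) r" using i U by simp
      show "(\<Union>j<i. A j) \<in> sets \<nu>" for i using A(1) sets by auto
      show "incseq (\<lambda>i. \<Union>j<i. A j)" by (intro monoI UN_mono) auto
    qed
    moreover have "(\<Union>i. \<Union>j<i. A j) = (\<Union>i. A i)" by auto
    moreover have "(LINT x:(\<Union>i<n. A i)|\<nu>. r x) = (\<Sum>i<n. \<sigma> (A i))" for n
    proof (subst set_integral_finite_Union)
      show "disjoint_family_on A {..<n}" using A(2) by (auto simp: disjoint_family_on_def)
    qed (use A(1) sets i \<sigma> in \<open>auto intro!: sum.cong\<close>)
    ultimately show ?thesis
      using U by (simp add: sums_def \<sigma>)
  qed
  then show ?thesis
    by (simp add: signed_measure_def) (simp add: \<sigma> set_lebesgue_integral_def)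
qed

text \<open>The supremum is attained on \<open>A \<inter> {x. 0 < r x}\<close>. The coercion
  \<open>ennreal (r x)\<close> itself takes the positive part.\<close>

lemma jordan_pos_has_density:
  assumes "has_density \<sigma> \<nu> r"
  shows "jordan_pos \<sigma> = density \<nu> (\<lambda>x. ennreal (r x))"
proof (rule measure_eqI)
  have sets[measurable_cong]: "sets \<nu> = sets borel" and r: "integrable \<nu> r"
    and \<sigma>: "\<And>A. \<sigma> A = (if A \<in> sets borel then LINT x:A|\<nu>. r x else 0)"
    using assms by (auto simp: has_density_def)
  show "sets (jordan_pos \<sigma>) = sets (density \<nu> (\<lambda>x. ennreal (r x)))"
    by (simp add: sets)
  have [measurable]: "r \<in> borel_measurable borel"
    using borel_measurable_integrable[OF r] by (simp cong: measurable_cong_sets)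
  fix A assume "A \<in> sets (jordan_pos \<sigma>)"
  then have A[measurable]: "A \<in> sets borel" by simp
  have pos: "(\<integral>\<^sup>+x. ennreal (r x) * indicator B x \<partial>\<nu>) = ennreal (LINT x:B|\<nu>. max 0 (r x))"
    if [measurable]: "B \<in> sets borel" for B
  proof -
    have "integrable \<nu> (\<lambda>x. indicator B x *\<^sub>R max 0 (r x))"
      using r by (intro integrable_mult_indicator) (auto simp: sets)
    then have "(\<integral>\<^sup>+x. ennreal (indicator B x *\<^sub>R max 0 (r x)) \<partial>\<nu>) = ennreal (LINT x:B|\<nu>. max 0 (r x))"
      unfolding set_lebesgue_integral_def by (intro nn_integral_eq_integral) auto
    moreover have "ennreal (indicator B x *\<^sub>R max 0 (r x)) = ennreal (r x) * indicator B x" for x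
      by (auto simp: indicator_def max_def ennreal_neg)
    ultimately show ?thesis by simp
  qed
  have i: "set_integrable \<nu> B r" "set_integrable \<nu> B (\<lambda>x. max 0 (r x))" if "B \<in> sets borel" for B
    using r that sets by (auto intro!: integrable_imp_set_integrable)
  have "(SUP B\<in>{B \<in> sets borel. B \<subseteq> A}. ennreal (\<sigma> B)) = (\<integral>\<^sup>+x. ennreal (r x) * indicator A x \<partial>\<nu>)"
  proof (rule antisym)
    show "(SUP B\<in>{B \<in> sets borel. B \<subseteq> A}. ennreal (\<sigma> B)) \<le> (\<integral>\<^sup>+x. ennreal (r x) * indicator A x \<partial>\<nu>)"
    proof (rule SUP_least)
      fix B assume B: "B \<in> {B \<in> sets borel. B \<subseteq> A}"
      then have "\<sigma> B \<le> (LINT x:B|\<nu>. max 0 (r x))"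
        using i[of B] by (auto simp: \<sigma> intro!: set_integral_mono)
      then have "ennreal (\<sigma> B) \<le> (\<integral>\<^sup>+x. ennreal (r x) * indicator B x \<partial>\<nu>)"
        using B by (subst pos) (auto intro!: ennreal_leI)
      also have "\<dots> \<le> (\<integral>\<^sup>+x. ennreal (r x) * indicator A x \<partial>\<nu>)"
        using B by (intro nn_integral_mono) (auto simp: indicator_def)
      finally show "ennreal (\<sigma> B) \<le> (\<integral>\<^sup>+x. ennreal (r x) * indicator A x \<partial>\<nu>)" .
    qed
    have "(\<integral>\<^sup>+x. ennreal (r x) * indicator A x \<partial>\<nu>) = ennreal (\<sigma> (A \<inter> {x. 0 < r x}))"
      by (subst pos) (auto simp: \<sigma> set_lebesgue_integral_def max_def indicator_def intro!: Bochner_Integration.integral_cong)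
    also have "\<dots> \<le> (SUP B\<in>{B \<in> sets borel. B \<subseteq> A}. ennreal (\<sigma> B))"
      by (intro SUP_upper) auto
    finally show "(\<integral>\<^sup>+x. ennreal (r x) * indicator A x \<partial>\<nu>) \<le> (SUP B\<in>{B \<in> sets borel. B \<subseteq> A}. ennreal (\<sigma> B))" .
  qed
  then show "emeasure (jordan_pos \<sigma>) A = emeasure (density \<nu> (\<lambda>x. ennreal (r x))) A"
    by (simp add: emeasure_jordan_pos has_density_signed_measure[OF assms] emeasure_density)
qed

lemma jordan_neg_has_density:
  "has_density \<sigma> \<nu> r \<Longrightarrow> jordan_neg \<sigma> = density \<nu> (\<lambda>x. ennreal (- r x))"
  unfolding jordan_neg_def by (rule jordan_pos_has_density) (rule has_density_uminus)

lemma variation_has_density: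
  assumes "has_density \<sigma> \<nu> r"
  shows "variation \<sigma> = density \<nu> (\<lambda>x. ennreal \<bar>r x\<bar>)"
proof -
  have [measurable]: "r \<in> borel_measurable \<nu>"
    using has_density_integrable[OF assms] by auto
  have "ennreal (r x) + ennreal (- r x) = ennreal \<bar>r x\<bar>" for x
    by (cases "r x \<ge> 0") (auto simp: ennreal_neg)
  then show ?thesis
    by (simp add: variation_def jordan_pos_has_density[OF assms] jordan_neg_has_density[OF assms]
        measure_add_density)
qed

lemma emeasure_variation_has_density:
  assumes "has_density \<sigma> \<nu> r"
  shows "emeasure (variation \<sigma>) UNIV = ennreal (LINT x|\<nu>. \<bar>r x\<bar>)"
proof -
  have "r \<in> borel_measurable \<nu>" using has_density_integrable[OF assms] by auto
  moreover have "UNIV \<in> sets \<nu>" using has_density_sets[OF assms] by simp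
  ultimately show ?thesis
    using has_density_integrable[OF assms]
    by (simp add: variation_has_density[OF assms] emeasure_density nn_integral_eq_integral)
qed

lemma has_density_M_TV:
  assumes "has_density \<sigma> \<nu> r"
  shows "\<sigma> \<in> M_TV"
  using has_density_signed_measure[OF assms] emeasure_variation_has_density[OF assms]
  by (simp add: M_TV_def)

lemma tv_norm_has_density:
  assumes "has_density \<sigma> \<nu> r"
  shows "tv_norm \<sigma> = (LINT x|\<nu>. \<bar>r x\<bar>)"
  by (simp add: tv_norm_def measure_def emeasure_variation_has_density[OF assms])

lemma sintegral_has_density:
  assumes \<sigma>: "has_density \<sigma> \<nu> r" and f[measurable]: "f \<in> borel_measurable borel"
    and int: "integrable \<nu> (\<lambda>x. r x * f x)"
  shows "sintegral \<sigma> f = (LINT x|\<nu>. r x * f x)"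
proof -
  note [measurable_cong] = has_density_sets[OF \<sigma>]
  have r[measurable]: "r \<in> borel_measurable \<nu>"
    using has_density_integrable[OF \<sigma>] by auto
  \<comment> \<open>\<open>integral_density\<close> asks for a nonnegative real density, so the
    cut-off hidden in \<open>ennreal\<close> is made explicit.\<close>
  have *: "density \<nu> (\<lambda>x. ennreal (g x)) = density \<nu> (\<lambda>x. ennreal (max 0 (g x)))" for g
    by (intro arg_cong[where f = "density \<nu>"] ext) (auto simp: max_def ennreal_neg)
  have "sintegral \<sigma> f = (LINT x|\<nu>. max 0 (r x) * f x) - (LINT x|\<nu>. max 0 (- r x) * f x)"
    unfolding sintegral_def jordan_pos_has_density[OF \<sigma>] jordan_neg_has_density[OF \<sigma>]
      *[of r] *[of "\<lambda>x. - r x"]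
    by (subst (1 2) integral_density) auto
  also have "\<dots> = (LINT x|\<nu>. max 0 (r x) * f x - max 0 (- r x) * f x)"
    by (intro Bochner_Integration.integral_diff[symmetric] Bochner_Integration.integrable_bound[OF int])
       (auto simp: abs_mult intro!: mult_right_mono)
  also have "\<dots> = (LINT x|\<nu>. r x * f x)"
    by (intro Bochner_Integration.integral_cong) (auto simp: max_def)
  finally show ?thesis .
qed

text \<open>The sum of the two variations is finite and dominates all four Jordan parts, so
  Radon-Nikodym applies to each; the difference of the densities of the two Jordan parts is the
  density of the signed measure.\<close>

lemma M_TV_common_density:
  fixes \<rho> \<sigma> :: "'a::topological_space smeasure"
  assumes "\<rho> \<in> M_TV" "\<sigma> \<in> M_TV"
  obtains \<nu> r s where "finite_measure \<nu>" "has_density \<rho> \<nu> r" "has_density \<sigma> \<nu> s"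
proof -
  define \<nu> where "\<nu> = measure_add (variation \<rho>) (variation \<sigma>)"
  have sets[simp, measurable_cong]: "sets \<nu> = sets borel" and [simp]: "space \<nu> = UNIV"
    by (simp_all add: \<nu>_def)
  have fin: "finite_measure \<nu>"
    unfolding \<nu>_def by (intro finite_measure_measure_add M_TV_finite assms) auto
  interpret finite_measure \<nu> by (rule fin)
  have ex1: "\<exists>d. integrable \<nu> d \<and> (\<forall>A\<in>sets borel. measure P A = (LINT x:A|\<nu>. d x))"
    if P: "finite_measure P" and [simp, measurable_cong]: "sets P = sets borel"
      and le: "\<And>A. A \<in> sets borel \<Longrightarrow> emeasure P A \<le> emeasure \<nu> A" for P
  proof -
    interpret P: finite_measure P by (rule P)
    have ac: "absolutely_continuous \<nu> P"
      using le unfolding absolutely_continuous_def null_sets_def by (auto simp: le_zero_eq) (metis le_zero_eq)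
    obtain D where D: "D \<in> borel_measurable \<nu>" "AE x in \<nu>. RN_deriv \<nu> P x = ennreal (D x)"
      "AE x in P. 0 < D x" "\<And>x. 0 \<le> D x"
      using real_RN_deriv[OF P ac] by auto
    note [measurable] = D(1)
    have dens: "P = density \<nu> (\<lambda>x. ennreal (D x))"
    proof -
      have "density \<nu> (RN_deriv \<nu> P) = P" by (rule density_RN_deriv[OF ac]) simp
      moreover have "density \<nu> (RN_deriv \<nu> P) = density \<nu> (\<lambda>x. ennreal (D x))"
        using D by (intro density_cong) auto
      ultimately show ?thesis by simp
    qed
    have nn: "(\<integral>\<^sup>+x. ennreal (D x) * indicator A x \<partial>\<nu>) = emeasure P A" if "A \<in> sets borel" for A
      using that by (subst dens) (simp add: emeasure_density)
    have int: "integrable \<nu> D"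
    proof (rule integrableI_nonneg)
      show "(\<integral>\<^sup>+x. ennreal (D x) \<partial>\<nu>) < \<infinity>"
        using nn[of UNIV] P.emeasure_finite[of UNIV] by (simp add: less_top[symmetric])
    qed (use D in auto)
    have "measure P A = (LINT x:A|\<nu>. D x)" if A: "A \<in> sets borel" for A
    proof -
      have "(LINT x:A|\<nu>. D x) = enn2real (\<integral>\<^sup>+x. ennreal (indicator A x *\<^sub>R D x) \<partial>\<nu>)"
        unfolding set_lebesgue_integral_def using D A by (intro integral_eq_nn_integral) auto
      also have "(\<integral>\<^sup>+x. ennreal (indicator A x *\<^sub>R D x) \<partial>\<nu>) = (\<integral>\<^sup>+x. ennreal (D x) * indicator A x \<partial>\<nu>)"
        by (intro nn_integral_cong) (auto simp: indicator_def)
      finally show ?thesis using nn[OF A] by (simp add: measure_def)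
    qed
    with int show ?thesis by blast
  qed
  have ex2: "\<exists>r. has_density \<tau> \<nu> r"
    if \<tau>: "\<tau> \<in> M_TV" and le: "\<And>A. A \<in> sets borel \<Longrightarrow> emeasure (variation \<tau>) A \<le> emeasure \<nu> A" for \<tau>
  proof -
    have "emeasure (jordan_pos \<tau>) A \<le> emeasure \<nu> A" "emeasure (jordan_neg \<tau>) A \<le> emeasure \<nu> A"
      if "A \<in> sets borel" for A
      using le[OF that] that by (auto simp: emeasure_variation intro: order_trans[rotated])
    then obtain d e where de: "integrable \<nu> d" "\<forall>A\<in>sets borel. measure (jordan_pos \<tau>) A = (LINT x:A|\<nu>. d x)"
      "integrable \<nu> e" "\<forall>A\<in>sets borel. measure (jordan_neg \<tau>) A = (LINT x:A|\<nu>. e x)"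
      using ex1[of "jordan_pos \<tau>"] ex1[of "jordan_neg \<tau>"] M_TV_finite[OF \<tau>] by auto
    have "set_integrable \<nu> A d" "set_integrable \<nu> A e" if "A \<in> sets borel" for A
      using de that by (auto intro!: integrable_imp_set_integrable)
    then have "has_density \<tau> \<nu> (\<lambda>x. d x - e x)"
      using de \<tau> by (auto simp: has_density_def jordan_decomposition) (simp add: M_TV_def signed_measure_def)
    then show ?thesis by blast
  qed
  have "\<exists>r. has_density \<rho> \<nu> r" "\<exists>s. has_density \<sigma> \<nu> s"
    by (intro ex2 assms; simp add: \<nu>_def emeasure_measure_add)+
  then show ?thesis using that fin by blast
qed

section \<open>The total variation norm computed in a common space of integrable functions\<close>

lemma M_TV_diff: "\<rho> \<in> M_TV \<Longrightarrow> \<sigma> \<in> M_TV \<Longrightarrow> \<rho> - \<sigma> \<in> M_TV"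
  by (metis M_TV_common_density has_density_diff has_density_M_TV)

lemma tv_norm_nonneg [simp]: "0 \<le> tv_norm \<sigma>"
  by (simp add: tv_norm_def)

lemma tv_norm_minus_commute:
  assumes "\<rho> \<in> M_TV" "\<sigma> \<in> M_TV"
  shows "tv_norm (\<rho> - \<sigma>) = tv_norm (\<sigma> - \<rho>)"
proof -
  obtain \<nu> r s where "has_density \<rho> \<nu> r" "has_density \<sigma> \<nu> s"
    using M_TV_common_density[OF assms] by metis
  then show ?thesis
    by (simp add: tv_norm_has_density[OF has_density_diff] abs_minus_commute)
qed

lemma tv_norm_triangle:
  assumes "\<rho> \<in> M_TV" "\<sigma> \<in> M_TV"
  shows "tv_norm \<rho> \<le> tv_norm (\<rho> - \<sigma>) + tv_norm \<sigma>"
proof -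
  obtain \<nu> r s where *: "has_density \<rho> \<nu> r" "has_density \<sigma> \<nu> s"
    using M_TV_common_density[OF assms] by metis
  have [simp]: "integrable \<nu> r" "integrable \<nu> s" using * by (auto simp: has_density_def)
  have "(LINT x|\<nu>. \<bar>r x\<bar>) \<le> (LINT x|\<nu>. \<bar>r x - s x\<bar> + \<bar>s x\<bar>)"
    by (intro integral_mono) auto
  then show ?thesis
    using * by (simp add: tv_norm_has_density[OF has_density_diff[OF *]] tv_norm_has_density)
qed

lemma tv_norm_triangle2:
  assumes "\<rho> \<in> M_TV" "\<sigma> \<in> M_TV" "\<tau> \<in> M_TV"
  shows "tv_norm (\<rho> - \<tau>) \<le> tv_norm (\<rho> - \<sigma>) + tv_norm (\<sigma> - \<tau>)"
proof -
  have "\<rho> - \<tau> - (\<sigma> - \<tau>) = \<rho> - \<sigma>" by auto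
  then show ?thesis
    using tv_norm_triangle[of "\<rho> - \<tau>" "\<sigma> - \<tau>"] assms by (simp add: M_TV_diff)
qed

lemma sintegral_diff:
  assumes "\<rho> \<in> M_TV" "\<sigma> \<in> M_TV" and f[measurable]: "f \<in> borel_measurable borel"
    and B: "\<And>x. \<bar>f x\<bar> \<le> B"
  shows "sintegral (\<rho> - \<sigma>) f = sintegral \<rho> f - sintegral \<sigma> f"
proof -
  obtain \<nu> r s where *: "has_density \<rho> \<nu> r" "has_density \<sigma> \<nu> s"
    using M_TV_common_density[OF assms(1,2)] by metis
  note [measurable_cong] = has_density_sets[OF *(1)]
  have i: "integrable \<nu> (\<lambda>x. d x * f x)" if "integrable \<nu> d" for d
    using that by (rule integrable_mult_bounded) (use B in auto)
  show ?thesis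
    using *[THEN has_density_integrable]
    by (simp add: sintegral_has_density[OF *(1)] sintegral_has_density[OF *(2)]
        sintegral_has_density[OF has_density_diff[OF *]] i left_diff_distrib)
qed

lemma abs_sintegral_le:
  assumes "\<sigma> \<in> M_TV" and f[measurable]: "f \<in> borel_measurable borel"
    and B: "\<And>x. \<bar>f x\<bar> \<le> B"
  shows "\<bar>sintegral \<sigma> f\<bar> \<le> B * tv_norm \<sigma>"
proof -
  obtain \<nu> r where *: "has_density \<sigma> \<nu> r"
    using M_TV_common_density[OF assms(1,1)] by metis
  note [measurable_cong] = has_density_sets[OF *(1)]
  have i: "integrable \<nu> (\<lambda>x. r x * f x)" 
    using has_density_integrable[OF *] by (rule integrable_mult_bounded) (use B in auto)
  have "\<bar>LINT x|\<nu>. r x * f x\<bar> \<le> (LINT x|\<nu>. \<bar>r x * f x\<bar>)" by (rule integral_abs_bound)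
  also have "\<dots> \<le> (LINT x|\<nu>. B * \<bar>r x\<bar>)"
    using integrable_abs[OF i] has_density_integrable[OF *] B
    by (intro integral_mono) (auto simp: abs_mult mult.commute[of B] intro!: mult_left_mono)
  finally show ?thesis
    using * i by (simp add: sintegral_has_density tv_norm_has_density)
qed

section \<open>Duality with continuous functions, and completeness\<close>

lemma measure_variation_has_density:
  assumes \<sigma>: "has_density \<sigma> \<nu> r" and A: "A \<in> sets borel"
  shows "measure (variation \<sigma>) A = (LINT x|\<nu>. indicator A x * \<bar>r x\<bar>)"
proof -
  have [measurable]: "r \<in> borel_measurable \<nu>" "A \<in> sets \<nu>"
    using has_density_integrable[OF \<sigma>] has_density_sets[OF \<sigma>] A by auto
  have "emeasure (variation \<sigma>) A = (\<integral>\<^sup>+x. ennreal (indicator A x * \<bar>r x\<bar>) \<partial>\<nu>)"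
    by (auto simp: variation_has_density[OF \<sigma>] emeasure_density indicator_def intro!: nn_integral_cong)
  then show ?thesis
    by (simp add: measure_def integral_eq_nn_integral)
qed

text \<open>The optimal test function is the sign of \<open>r\<close>. Inner regularity finds
  compact \<open>K\<close> and \<open>K'\<close> inside the positive and the negative set with
  little variation lost, and Urysohn functions give a test function equal to that sign on
  both.\<close>

lemma tv_norm_le_duality:
  fixes \<sigma> :: "'a::euclidean_space smeasure"
  assumes \<sigma>: "\<sigma> \<in> M_TV"
    and le: "\<And>\<phi>. \<phi> \<in> C_0 \<Longrightarrow> (\<And>x. \<bar>\<phi> x\<bar> \<le> 1) \<Longrightarrow> sintegral \<sigma> \<phi> \<le> c"
  shows "tv_norm \<sigma> \<le> c"
proof (rule field_le_epsilon)
  fix e' :: real assume "0 < e'"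
  \<comment> \<open>Each of the two compact sets loses at most \<open>e\<close>, and each loss
    counts twice: the lost part is missing from the integral and may even contribute with the wrong
    sign.\<close>
  define e where "e = e' / 4"
  have e: "e > 0" using \<open>0 < e'\<close> by (simp add: e_def)
  obtain \<nu> r where r: "has_density \<sigma> \<nu> r"
    using M_TV_common_density[OF \<sigma> \<sigma>] by metis
  note [measurable_cong] = has_density_sets[OF r]
  have [measurable]: "r \<in> borel_measurable borel"
    using borel_measurable_integrable[OF has_density_integrable[OF r]]
    by (simp cong: measurable_cong_sets)
  interpret N: finite_measure "variation \<sigma>" by (rule M_TV_finite[OF \<sigma>])
  define P Q where "P = {x. r x > 0}" and "Q = {x. r x < 0}"
  have PQ: "P \<in> sets borel" "Q \<in> sets borel" by (auto simp: P_def Q_def)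
  have inner: "\<exists>K. compact K \<and> K \<subseteq> A \<and> measure (variation \<sigma>) A \<le> measure (variation \<sigma>) K + e"
    if A: "A \<in> sets borel" for A
  proof -
    have "\<exists>K\<in>{K. K \<subseteq> A \<and> compact K}. emeasure (variation \<sigma>) A < emeasure (variation \<sigma>) K + ennreal e"
      using e A by (intro SUP_approx_ennreal inner_regular) auto
    then obtain K where K: "K \<subseteq> A" "compact K" "emeasure (variation \<sigma>) A < emeasure (variation \<sigma>) K + ennreal e"
      by auto
    then have "measure (variation \<sigma>) A \<le> measure (variation \<sigma>) K + e"
      using e by (simp add: N.emeasure_eq_measure ennreal_less_iff flip: ennreal_plus)
    with K show ?thesis by blast
  qed
  obtain K where K: "compact K" "K \<subseteq> P" "measure (variation \<sigma>) P \<le> measure (variation \<sigma>) K + e"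
    using inner[OF PQ(1)] by blast
  obtain K' where K': "compact K'" "K' \<subseteq> Q" "measure (variation \<sigma>) Q \<le> measure (variation \<sigma>) K' + e"
    using inner[OF PQ(2)] by blast
  have disj: "K \<inter> K' = {}" using K(2) K'(2) unfolding P_def Q_def by fastforce
  have [measurable]: "K \<in> sets borel" "K' \<in> sets borel" using K K' by (auto intro: borel_compact)
  obtain g where g: "continuous_on UNIV g" "\<And>x. g x \<in> closed_segment (-1) (1::real)"
    "\<And>x. x \<in> K' \<Longrightarrow> g x = -1" "\<And>x. x \<in> K \<Longrightarrow> g x = 1"
    using Urysohn_local[of UNIV K' K "-1" "1::real"] disj K(1) K'(1)
    by (auto simp: compact_imp_closed Int_commute)
  \<comment> \<open>\<open>g\<close> need not decay at infinity; the factor \<open>h\<close> makes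
    the product vanish outside a ball without changing it on \<open>K\<close> and
    \<open>K'\<close>.\<close>
  obtain R where R: "K \<union> K' \<subseteq> ball 0 R"
    using bounded_subset_ballD[of "K \<union> K'" 0] K(1) K'(1) by (auto simp: compact_imp_bounded)
  obtain h where h: "continuous_on UNIV h" "\<And>x. h x \<in> closed_segment 1 (0::real)"
    "\<And>x. x \<in> K \<union> K' \<Longrightarrow> h x = 1" "\<And>x. x \<in> - ball 0 R \<Longrightarrow> h x = 0"
    using Urysohn_local[of UNIV "K \<union> K'" "- ball 0 R" 1 "0::real"] R K(1) K'(1)
    by (auto simp: compact_imp_closed closed_Un closed_Compl)
  define \<phi> where "\<phi> x = g x * h x" for x
  have cont: "continuous_on UNIV \<phi>"
    unfolding \<phi>_def by (intro continuous_intros g h)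
  have "\<bar>g x\<bar> \<le> 1" "\<bar>h x\<bar> \<le> 1" for x
    using g(2)[of x] h(2)[of x] by (auto simp: closed_segment_eq_real_ivl)
  then have \<phi>1: "\<bar>\<phi> x\<bar> \<le> 1" for x
    by (simp add: \<phi>_def abs_mult mult_le_one)
  have "eventually (\<lambda>x. \<phi> x = 0) at_infinity"
    unfolding eventually_at_infinity by (intro exI[of _ R]) (auto simp: \<phi>_def h(4))
  then have "(\<phi> \<longlongrightarrow> 0) at_infinity"
    by (rule tendsto_eventually)
  then have C0: "\<phi> \<in> C_0" by (simp add: C_0_def cont)
  have [measurable]: "\<phi> \<in> borel_measurable borel"
    by (rule borel_measurable_continuous_onI[OF cont])
  note ir = has_density_integrable[OF r]
  have ind: "integrable \<nu> (\<lambda>x. indicator A x * \<bar>r x\<bar>)" if "A \<in> sets borel" for A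
    using integrable_real_mult_indicator[of A \<nu> "\<lambda>x. \<bar>r x\<bar>"] ir that
    by (simp add: has_density_sets[OF r] mult.commute)
  have i\<phi>: "integrable \<nu> (\<lambda>x. r x * \<phi> x)"
    by (rule integrable_mult_bounded[OF ir _ \<phi>1]) auto
  have "tv_norm \<sigma> = (LINT x|\<nu>. indicator P x * \<bar>r x\<bar> + indicator Q x * \<bar>r x\<bar>)"
    unfolding tv_norm_has_density[OF r]
    by (intro Bochner_Integration.integral_cong) (auto simp: P_def Q_def indicator_def)
  also have "\<dots> = measure (variation \<sigma>) P + measure (variation \<sigma>) Q"
    using PQ ind by (simp add: measure_variation_has_density[OF r])
  finally have tv: "tv_norm \<sigma> \<le> measure (variation \<sigma>) K + measure (variation \<sigma>) K' + 2 * e"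
    using K(3) K'(3) by simp
  \<comment> \<open>The integrand on the right is \<open>\<bar>r x\<bar>\<close> on
    \<open>K \<union> K'\<close> and \<open>- \<bar>r x\<bar>\<close> elsewhere, which is the worst
    case for \<open>r x * \<phi> x\<close> given that \<phi> is bounded by 1.\<close>
  have "2 * (measure (variation \<sigma>) K + measure (variation \<sigma>) K') - tv_norm \<sigma> =
      (LINT x|\<nu>. 2 * (indicator K x * \<bar>r x\<bar> + indicator K' x * \<bar>r x\<bar>) - \<bar>r x\<bar>)"
    using ind[of K] ind[of K'] ir
    by (simp add: measure_variation_has_density[OF r] tv_norm_has_density[OF r])
  also have "\<dots> \<le> (LINT x|\<nu>. r x * \<phi> x)"
  proof (rule integral_mono[OF _ i\<phi>])
    show "integrable \<nu> (\<lambda>x. 2 * (indicator K x * \<bar>r x\<bar> + indicator K' x * \<bar>r x\<bar>) - \<bar>r x\<bar>)"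
      using ind[of K] ind[of K'] ir by simp
    fix x
    have "- \<bar>r x\<bar> \<le> r x * \<phi> x"
      using mult_left_mono[OF \<phi>1[of x], of "\<bar>r x\<bar>"] by (simp add: abs_mult[symmetric])
    then show "2 * (indicator K x * \<bar>r x\<bar> + indicator K' x * \<bar>r x\<bar>) - \<bar>r x\<bar> \<le> r x * \<phi> x"
      using K(2) K'(2) disj by (auto simp: indicator_def \<phi>_def g h P_def Q_def)
  qed
  also have "\<dots> = sintegral \<sigma> \<phi>"
    using i\<phi> by (intro sintegral_has_density[OF r, symmetric]) auto
  also have "\<dots> \<le> c" using C0 \<phi>1 by (rule le)
  finally show "tv_norm \<sigma> \<le> c + e'"
    using tv by (simp add: e_def)
qed

text \<open>Completeness in the form in which it is used: the limit is known only set by set. The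
  Cauchy bound makes this convergence uniform over all sets, and uniformity carries countable
  additivity to the limit.\<close>

lemma M_TV_limit:
  fixes \<sigma> :: "nat \<Rightarrow> 'a::topological_space smeasure"
  assumes \<sigma>: "\<And>n. \<sigma> n \<in> M_TV" and Cauchy: "\<And>n m. tv_norm (\<sigma> n - \<sigma> m) \<le> b n + b m"
    and b: "b \<longlonglongrightarrow> 0" and lim: "\<And>A. (\<lambda>n. \<sigma> n A) \<longlonglongrightarrow> \<tau> A"
  shows "\<tau> \<in> M_TV" "\<And>n. tv_norm (\<sigma> n - \<tau>) \<le> 2 * b n"
proof -
  have unif: "\<bar>\<sigma> n A - \<tau> A\<bar> \<le> b n" for n A
  proof (rule LIMSEQ_le)
    show "(\<lambda>m. \<bar>\<sigma> n A - \<sigma> m A\<bar>) \<longlonglongrightarrow> \<bar>\<sigma> n A - \<tau> A\<bar>" by (intro tendsto_intros lim)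
    show "(\<lambda>m. b n + b m) \<longlonglongrightarrow> b n" using tendsto_add[OF tendsto_const b, of "b n"] by simp
    have "\<bar>\<sigma> n A - \<sigma> m A\<bar> \<le> b n + b m" for m
      using order_trans[OF M_TV_abs_le_tv_norm[OF M_TV_diff[OF \<sigma> \<sigma>]] Cauchy, of n m A] by simp
    then show "\<exists>N. \<forall>m\<ge>N. \<bar>\<sigma> n A - \<sigma> m A\<bar> \<le> b n + b m" by blast
  qed
  have sm: "signed_measure (\<sigma> n)" for n using \<sigma>[of n] by (simp add: M_TV_def)
  have \<tau>0: "\<tau> A = 0" if "A \<notin> sets borel \<or> A = {}" for A
  proof -
    have "(\<lambda>n. \<sigma> n A) = (\<lambda>n. 0)" using sm that by (auto simp: signed_measure_def)
    then show ?thesis using lim[of A] LIMSEQ_unique[of "\<lambda>n. 0"] by auto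
  qed
  have "(\<lambda>i. \<tau> (A i)) sums \<tau> (\<Union>i. A i)"
    if A: "range A \<subseteq> sets borel" "disjoint_family A" for A :: "nat \<Rightarrow> 'a set"
  proof -
    have fin: "(\<Sum>i<k. \<sigma> n (A i)) = \<sigma> n (\<Union>i<k. A i)" for n k
    proof (induction k)
      case 0
      show ?case using sm[of n] by (simp add: signed_measure_def)
    next
      case (Suc k)
      have "A k \<inter> A i = {}" if "i < k" for i
        using A(2) that unfolding disjoint_family_on_def by (metis UNIV_I less_irrefl)
      then have "A k \<inter> (\<Union>i<k. A i) = {}" by blast
      then have "\<sigma> n (A k \<union> (\<Union>i<k. A i)) = \<sigma> n (A k) + \<sigma> n (\<Union>i<k. A i)"
        using A(1) by (intro signed_measure_Un[OF sm]) auto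
      then show ?case using Suc by (simp add: lessThan_Suc)
    qed
    have fin\<tau>: "(\<Sum>i<k. \<tau> (A i)) = \<tau> (\<Union>i<k. A i)" for k
    proof (rule LIMSEQ_unique)
      show "(\<lambda>n. \<Sum>i<k. \<sigma> n (A i)) \<longlonglongrightarrow> (\<Sum>i<k. \<tau> (A i))" by (intro tendsto_intros lim)
      show "(\<lambda>n. \<Sum>i<k. \<sigma> n (A i)) \<longlonglongrightarrow> \<tau> (\<Union>i<k. A i)" unfolding fin by (rule lim)
    qed
    show ?thesis
      unfolding sums_def fin\<tau>
    proof (rule LIMSEQ_I)
      fix e :: real assume e: "0 < e"
      \<comment> \<open>Two thirds pay for replacing \<tau> by \<open>\<sigma> n\<close> on the
        finite and on the full union, one third for the additivity of
        \<open>\<sigma> n\<close>.\<close>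
      obtain n where n: "\<bar>b n\<bar> < e / 3"
        using LIMSEQ_D[OF b, of "e/3"] e by auto
      have conv: "(\<lambda>k. \<Sum>i<k. \<sigma> n (A i)) \<longlonglongrightarrow> \<sigma> n (\<Union>i. A i)"
        using sm[of n] A unfolding signed_measure_def sums_def by blast
      obtain k0 where k0: "\<forall>k\<ge>k0. norm (\<sigma> n (\<Union>i<k. A i) - \<sigma> n (\<Union>i. A i)) < e / 3"
        using LIMSEQ_D[OF conv[unfolded fin], of "e/3"] e by auto
      have "\<bar>\<tau> (\<Union>i<k. A i) - \<tau> (\<Union>i. A i)\<bar> < e" if "k \<ge> k0" for k
        using k0[rule_format, OF that, unfolded real_norm_def] n unif[of n "\<Union>i<k. A i"] unif[of n "\<Union>i. A i"] by linarith
      then show "\<exists>k0. \<forall>k\<ge>k0. norm (\<tau> (\<Union>i<k. A i) - \<tau> (\<Union>i. A i)) < e" by auto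
    qed
  qed
  then have \<tau>: "signed_measure \<tau>"
    using \<tau>0 by (auto simp: signed_measure_def)
  have "\<bar>\<tau> A\<bar> \<le> tv_norm (\<sigma> 0) + b 0" for A
    using unif[of 0 A] M_TV_abs_le_tv_norm[OF \<sigma>, of 0 A] by linarith
  then show \<tau>': "\<tau> \<in> M_TV" by (rule M_TV_I[OF \<tau>])
  show "tv_norm (\<sigma> n - \<tau>) \<le> 2 * b n" for n
  proof (rule M_TV_I)
    show "signed_measure (\<sigma> n - \<tau>)" using M_TV_diff[OF \<sigma> \<tau>'] by (simp add: M_TV_def)
  qed (use unif in auto)
qed

section \<open>Fluxes in terms of densities\<close>

lemma offdiag_borel [measurable]: "(offdiag :: ('a::euclidean_space \<times> 'a) set) \<in> sets borel"
proof -
  have "closed {z :: 'a \<times> 'a. fst z = snd z}"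
    by (intro closed_Collect_eq continuous_intros)
  moreover have "offdiag = - {z :: 'a \<times> 'a. fst z = snd z}"
    by (auto simp: offdiag_def)
  ultimately show ?thesis by (metis borel_open open_Compl)
qed

lemma borel_measurable_fst_snd [measurable]:
  "(fst :: 'a::euclidean_space \<times> 'b::euclidean_space \<Rightarrow> 'a) \<in> borel_measurable borel"
  "(snd :: 'a::euclidean_space \<times> 'b::euclidean_space \<Rightarrow> 'b) \<in> borel_measurable borel"
  by (intro borel_measurable_continuous_onI continuous_intros)+

lemma radon_sigma_finite:
  assumes "radon_measure \<mu>" shows "sigma_finite_measure \<mu>"
proof
  have s: "sets \<mu> = sets borel" "space \<mu> = UNIV"
    using assms by (auto simp: radon_measure_def dest: sets_eq_imp_space_eq)
  have "x \<in> (\<Union>n. cball 0 (real n))" for x :: 'a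
    using real_arch_simple[of "norm x"] by auto
  then show "\<exists>A. countable A \<and> A \<subseteq> sets \<mu> \<and> \<Union> A = space \<mu> \<and> (\<forall>a\<in>A. emeasure \<mu> a \<noteq> \<infinity>)"
    using assms s by (intro exI[of _ "range (\<lambda>n. cball 0 (real n))"])
      (auto simp: radon_measure_def less_top[symmetric])
qed

lemma flux_interpolation_measurable [measurable (raw)]:
  assumes "flux_interpolation \<Phi> L"
    and [measurable]: "f \<in> borel_measurable M" "g \<in> borel_measurable M" "h \<in> borel_measurable M"
  shows "(\<lambda>z. \<Phi> (f z) (g z) (h z)) \<in> borel_measurable M"
proof -
  have "(\<lambda>z. (f z, g z, h z)) \<in> borel_measurable M" by measurable
  moreover have "(\<lambda>(a, b, v). \<Phi> a b v) \<in> borel_measurable borel"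
    using assms by (simp add: flux_interpolation_def)
  ultimately show ?thesis
    using measurable_compose[of "\<lambda>z. (f z, g z, h z)" M borel "\<lambda>(a, b, v). \<Phi> a b v" borel] by simp
qed

text \<open>The arguments are changed in the order \<open>(a, b)\<close>, \<open>v\<close>,
  \<open>e\<close>. The last change needs the size of \<open>\<Phi> a' b' v'\<close>, which is the
  Lipschitz bound in \<open>v\<close> against \<open>\<Phi> a' b' 0 = 0\<close>.\<close>

lemma flux_interpolation_diff_le:
  assumes "flux_interpolation \<Phi> L"
  shows "\<bar>\<Phi> a b v * e - \<Phi> a' b' v' * e'\<bar> \<le>
    L * (\<bar>a - a'\<bar> + \<bar>b - b'\<bar>) * \<bar>v\<bar> * \<bar>e\<bar> + L * (\<bar>a'\<bar> + \<bar>b'\<bar>) * \<bar>v - v'\<bar> * \<bar>e\<bar> +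
    L * (\<bar>a'\<bar> + \<bar>b'\<bar>) * \<bar>v'\<bar> * \<bar>e - e'\<bar>"
proof -
  have 1: "\<bar>\<Phi> a b v - \<Phi> a' b' v\<bar> \<le> L * (\<bar>a - a'\<bar> + \<bar>b - b'\<bar>) * \<bar>v\<bar>"
    and 2: "\<bar>\<Phi> a' b' v - \<Phi> a' b' v'\<bar> \<le> L * (\<bar>a'\<bar> + \<bar>b'\<bar>) * \<bar>v - v'\<bar>"
    and 3: "\<bar>\<Phi> a' b' v' - \<Phi> a' b' 0\<bar> \<le> L * (\<bar>a'\<bar> + \<bar>b'\<bar>) * \<bar>v' - 0\<bar>"
    and 4: "\<Phi> a' b' 0 = 0"
    using assms unfolding flux_interpolation_def by blast+
  have "\<Phi> a b v * e - \<Phi> a' b' v' * e' =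
      (\<Phi> a b v - \<Phi> a' b' v) * e + (\<Phi> a' b' v - \<Phi> a' b' v') * e + \<Phi> a' b' v' * (e - e')"
    by (simp add: algebra_simps)
  also have "\<bar>\<dots>\<bar> \<le> \<bar>\<Phi> a b v - \<Phi> a' b' v\<bar> * \<bar>e\<bar> + \<bar>\<Phi> a' b' v - \<Phi> a' b' v'\<bar> * \<bar>e\<bar> + \<bar>\<Phi> a' b' v'\<bar> * \<bar>e - e'\<bar>"
    unfolding abs_mult[symmetric] by linarith
  also have "\<dots> \<le> L * (\<bar>a - a'\<bar> + \<bar>b - b'\<bar>) * \<bar>v\<bar> * \<bar>e\<bar> + L * (\<bar>a'\<bar> + \<bar>b'\<bar>) * \<bar>v - v'\<bar> * \<bar>e\<bar> +
    L * (\<bar>a'\<bar> + \<bar>b'\<bar>) * \<bar>v'\<bar> * \<bar>e - e'\<bar>"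
    using 1 2 3 4 by (intro add_mono mult_right_mono) auto
  finally show ?thesis .
qed

text \<open>Chain rule for densities. Where \<open>k z = 0\<close> the quotient is 0 by the
  convention for division, which is the right value because \<open>c z\<close> vanishes there
  too.\<close>

lemma RN_deriv_density_density:
  fixes k c :: "'a \<Rightarrow> real"
  assumes "sigma_finite_measure lam"
    and [measurable]: "k \<in> borel_measurable lam" "c \<in> borel_measurable lam"
    and nn: "\<And>z. 0 \<le> k z" "\<And>z. 0 \<le> c z" and k0: "\<And>z. k z = 0 \<Longrightarrow> c z = 0"
  shows "AE z in density lam k. RN_deriv (density lam k) (density lam c) z = ennreal (c z / k z)"
proof -
  interpret lam: sigma_finite_measure lam by fact
  have "sigma_finite_measure (density lam (\<lambda>z. ennreal (k z)))"
    by (subst lam.sigma_finite_iff_density_finite) auto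
  then interpret D: sigma_finite_measure "density lam (\<lambda>z. ennreal (k z))" .
  have "AE z in density lam k. ennreal (c z / k z) = RN_deriv (density lam k) (density lam c) z"
  proof (rule D.RN_deriv_unique)
    have "ennreal (k z) * ennreal (c z / k z) = ennreal (c z)" for z
      using nn k0[of z] by (cases "k z = 0") (auto simp: ennreal_mult[symmetric])
    then show "density (density lam (\<lambda>z. ennreal (k z))) (\<lambda>z. ennreal (c z / k z)) = density lam c"
      by (subst density_density_eq) auto
  qed auto
  then show ?thesis by eventually_elim simp
qed

text \<open>The data depend on \<mu> and \<nu> only, so one \<open>lam\<close> serves every signed
  measure with a density with respect to \<nu>; this is what makes two fluxes comparable.
  \<open>p\<close> and \<open>q\<close> are real and nonnegative everywhere so that they can be
  inserted into \<Phi>.\<close>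

locale flux_reference =
  fixes \<mu> \<nu> :: "'a::euclidean_space measure" and lam :: "('a \<times> 'a) measure"
    and p q :: "'a \<times> 'a \<Rightarrow> real"
  assumes sets_\<mu> [simp, measurable_cong]: "sets \<mu> = sets borel"
    and sigma_finite_\<mu>: "sigma_finite_measure \<mu>"
    and sets_\<nu> [simp, measurable_cong]: "sets \<nu> = sets borel"
    and finite_\<nu>: "finite_measure \<nu>"
    and sets_lam [simp, measurable_cong]: "sets lam = sets borel"
    and sigma_finite_lam: "sigma_finite_measure lam"
    and p_measurable [measurable]: "p \<in> borel_measurable borel"
    and q_measurable [measurable]: "q \<in> borel_measurable borel"
    and p_nonneg [simp]: "\<And>z. 0 \<le> p z" and q_nonneg [simp]: "\<And>z. 0 \<le> q z"
    and density_p: "density lam (\<lambda>z. ennreal (p z)) = \<nu> \<Otimes>\<^sub>M \<mu>"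
    and density_q: "density lam (\<lambda>z. ennreal (q z)) = \<mu> \<Otimes>\<^sub>M \<nu>"

lemma flux_reference_exists:
  fixes \<mu> \<nu> :: "'a::euclidean_space measure"
  assumes \<mu>: "radon_measure \<mu>" and \<nu>: "finite_measure \<nu>" "sets \<nu> = sets borel"
  obtains lam p q where "flux_reference \<mu> \<nu> lam p q"
proof -
  have [measurable_cong, simp]: "sets \<mu> = sets borel" "sets \<nu> = sets borel"
    using assms by (auto simp: radon_measure_def)
  have sp[simp]: "space \<mu> = UNIV" "space \<nu> = UNIV"
    using sets_eq_imp_space_eq[of \<mu> borel] sets_eq_imp_space_eq[of \<nu> borel] by auto
  have prod: "sets (\<mu> \<Otimes>\<^sub>M \<nu>) = sets borel" "sets (\<nu> \<Otimes>\<^sub>M \<mu>) = sets borel"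
  proof -
    have "sets (\<mu> \<Otimes>\<^sub>M \<nu>) = sets ((borel :: 'a measure) \<Otimes>\<^sub>M (borel :: 'a measure))"
      "sets (\<nu> \<Otimes>\<^sub>M \<mu>) = sets ((borel :: 'a measure) \<Otimes>\<^sub>M (borel :: 'a measure))"
      by (rule sets_pair_measure_cong; simp)+
    then show "sets (\<mu> \<Otimes>\<^sub>M \<nu>) = sets borel" "sets (\<nu> \<Otimes>\<^sub>M \<mu>) = sets borel"
      unfolding borel_prod by this+
  qed
  interpret \<mu>: sigma_finite_measure \<mu> by (rule radon_sigma_finite[OF \<mu>])
  interpret \<nu>: finite_measure \<nu> by (rule \<nu>)
  define lam where "lam = measure_add (\<nu> \<Otimes>\<^sub>M \<mu>) (\<mu> \<Otimes>\<^sub>M \<nu>)"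
  have lam[simp, measurable_cong]: "sets lam = sets borel" by (simp only: lam_def sets_measure_add prod)
  have lam_sp: "space lam = UNIV" using sets_eq_imp_space_eq[OF lam] by simp
  have em: "emeasure lam A = emeasure (\<nu> \<Otimes>\<^sub>M \<mu>) A + emeasure (\<mu> \<Otimes>\<^sub>M \<nu>) A" if "A \<in> sets borel" for A
    unfolding lam_def using that by (intro emeasure_measure_add) (simp_all only: prod)
  have sf: "sigma_finite_measure lam"
  proof
    \<comment> \<open>Products of balls have finite measure because \<nu> is finite and \<mu> is
      finite on compact sets.\<close>
    let ?B = "\<lambda>n. cball (0::'a) (real n) \<times> cball (0::'a) (real n)"
    have "z \<in> (\<Union>n. ?B n)" for z :: "'a \<times> 'a"
    proof -
      obtain n where "max (norm (fst z)) (norm (snd z)) \<le> real n" using real_arch_simple by blast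
      then show ?thesis by (cases z) auto
    qed
    moreover have "emeasure lam (?B n) \<noteq> \<infinity>" for n
    proof -
      have f: "emeasure \<mu> (cball 0 (real n)) < \<infinity>" using \<mu> by (auto simp: radon_measure_def)
      have "emeasure lam (?B n) = emeasure \<nu> (cball 0 (real n)) * emeasure \<mu> (cball 0 (real n)) +
          emeasure \<mu> (cball 0 (real n)) * emeasure \<nu> (cball 0 (real n))"
        by (subst em) (auto simp: \<mu>.emeasure_pair_measure_Times \<nu>.emeasure_pair_measure_Times
             intro!: borel_closed closed_Times)
      then show ?thesis
        using f \<nu>.emeasure_finite[of "cball 0 (real n)"]
        by (auto simp: ennreal_mult_eq_top_iff less_top)
    qed
    ultimately show "\<exists>A. countable A \<and> A \<subseteq> sets lam \<and> \<Union> A = space lam \<and> (\<forall>a\<in>A. emeasure lam a \<noteq> \<infinity>)"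
      by (intro exI[of _ "range ?B"]) (auto simp: lam_sp intro!: borel_closed closed_Times)
  qed
  interpret lam: sigma_finite_measure lam by (rule sf)
  have ex: "\<exists>p. p \<in> borel_measurable borel \<and> (\<forall>z. 0 \<le> p z) \<and> density lam (\<lambda>z. ennreal (p z)) = N"
    if N: "sigma_finite_measure N" "sets N = sets borel"
      and le: "\<And>A. A \<in> sets borel \<Longrightarrow> emeasure N A \<le> emeasure lam A" for N
  proof -
    have ac: "absolutely_continuous lam N"
      unfolding absolutely_continuous_def
    proof
      fix A assume "A \<in> null_sets lam"
      then have "A \<in> sets borel" "emeasure lam A = 0" by auto
      then show "A \<in> null_sets N" using le[of A] N(2) by auto
    qed
    have N': "density lam (RN_deriv lam N) = N"
      using ac N(2) by (intro lam.density_RN_deriv) auto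
    have fin: "AE z in lam. RN_deriv lam N z \<noteq> \<infinity>"
      using N ac by (intro lam.RN_deriv_finite) auto
    \<comment> \<open>The derivative may be infinite on a null set; \<open>enn2real\<close> replaces
      it by 0 there.\<close>
    have "density lam (\<lambda>z. ennreal (enn2real (RN_deriv lam N z))) = density lam (RN_deriv lam N)"
      using fin by (intro density_cong) (auto elim!: eventually_mono simp: less_top)
    then show ?thesis
      using N' by (intro exI[of _ "\<lambda>z. enn2real (RN_deriv lam N z)"]) auto
  qed
  obtain p where p: "p \<in> borel_measurable borel" "\<forall>z. 0 \<le> p z" "density lam (\<lambda>z. ennreal (p z)) = \<nu> \<Otimes>\<^sub>M \<mu>"
    using ex[of "\<nu> \<Otimes>\<^sub>M \<mu>"] prod em
    by (auto intro!: sigma_finite_pair_measure \<mu>.sigma_finite_measure_axioms \<nu>.sigma_finite_measure_axioms)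
  obtain q where q: "q \<in> borel_measurable borel" "\<forall>z. 0 \<le> q z" "density lam (\<lambda>z. ennreal (q z)) = \<mu> \<Otimes>\<^sub>M \<nu>"
    using ex[of "\<mu> \<Otimes>\<^sub>M \<nu>"] prod em
    by (auto intro!: sigma_finite_pair_measure \<mu>.sigma_finite_measure_axioms \<nu>.sigma_finite_measure_axioms)
  have "flux_reference \<mu> \<nu> lam p q"
    by standard (use p q sf \<nu>.finite_measure_axioms \<mu>.sigma_finite_measure_axioms in auto)
  then show ?thesis by (rule that)
qed

section \<open>Flux estimates over a fixed reference measure\<close>

context flux_reference
begin

lemma pair_density_left:
  assumes [measurable]: "g \<in> borel_measurable borel"
  shows "density \<nu> (\<lambda>x. ennreal (g x)) \<Otimes>\<^sub>M \<mu> = density lam (\<lambda>z. ennreal (p z * g (fst z)))"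
proof -
  \<comment> \<open>\<mu> is written as a density with constant 1 because
    \<open>pair_measure_density\<close> treats a product of two densities.\<close>
  have "density \<nu> (\<lambda>x. ennreal (g x)) \<Otimes>\<^sub>M density \<mu> (\<lambda>_. 1) = density (\<nu> \<Otimes>\<^sub>M \<mu>) (\<lambda>z. ennreal (g (fst z)))"
    by (subst pair_measure_density) (auto simp: density_1 sigma_finite_\<mu> case_prod_beta')
  also have "\<dots> = density lam (\<lambda>z. ennreal (p z) * ennreal (g (fst z)))"
    unfolding density_p[symmetric] by (rule density_density_eq) auto
  finally show ?thesis by (simp add: density_1 ennreal_mult')
qed

lemma pair_density_right:
  assumes [measurable]: "g \<in> borel_measurable borel"
  shows "\<mu> \<Otimes>\<^sub>M density \<nu> (\<lambda>x. ennreal (g x)) = density lam (\<lambda>z. ennreal (q z * g (snd z)))"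
proof -
  interpret \<nu>: finite_measure \<nu> by (rule finite_\<nu>)
  have "density \<mu> (\<lambda>_. 1) \<Otimes>\<^sub>M density \<nu> (\<lambda>x. ennreal (g x)) = density (\<mu> \<Otimes>\<^sub>M \<nu>) (\<lambda>z. ennreal (g (snd z)))"
    by (subst pair_measure_density)
       (auto simp: case_prod_beta' \<nu>.sigma_finite_iff_density_finite \<nu>.sigma_finite_measure_axioms)
  also have "\<dots> = density lam (\<lambda>z. ennreal (q z) * ennreal (g (snd z)))"
    unfolding density_q[symmetric] by (rule density_density_eq) auto
  finally show ?thesis by (simp add: density_1 ennreal_mult')
qed

text \<open>Relative to the measure in the definition of the flux, the two arguments of \<Phi> are
  \<open>p z * r (fst z) / k z\<close> and \<open>q z * r (snd z) / k z\<close>, where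
  \<open>k\<close> is the density of that measure with respect to \<open>lam\<close>.
  One-homogeneity cancels \<open>k\<close> against the change of measure.\<close>

lemma has_density_flux:
  assumes \<rho>: "has_density \<rho> \<nu> r" and \<Phi>: "flux_interpolation \<Phi> L"
    and [measurable]: "r \<in> borel_measurable borel" "w \<in> borel_measurable borel" "\<eta> \<in> borel_measurable borel"
    and int: "integrable lam (\<lambda>z. indicator offdiag z * (\<Phi> (p z * r (fst z)) (q z * r (snd z)) (w z) * \<eta> z))"
  shows "has_density (flux \<Phi> \<mu> \<eta> \<rho> w) lam
           (\<lambda>z. indicator offdiag z * (\<Phi> (p z * r (fst z)) (q z * r (snd z)) (w z) * \<eta> z))"
proof -
  note \<Phi>_meas[measurable] = flux_interpolation_measurable[OF \<Phi>]
  \<comment> \<open>Density of \<open>lam'\<close>, defined below, with respect to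
    \<open>lam\<close>; it controls both arguments of \<Phi>, so they vanish wherever
    \<open>k\<close> does.\<close>
  define k where "k z = p z * \<bar>r (fst z)\<bar> + q z * \<bar>r (snd z)\<bar>" for z
  have [measurable]: "k \<in> borel_measurable borel" unfolding k_def by measurable
  have k_nn[simp]: "0 \<le> k z" for z by (simp add: k_def)
  have k0: "p z * r (fst z) = 0" "q z * r (snd z) = 0" if "k z = 0" for z
    using that by (auto simp: k_def add_nonneg_eq_0_iff)
  define lam' where "lam' = measure_add (variation \<rho> \<Otimes>\<^sub>M \<mu>) (\<mu> \<Otimes>\<^sub>M variation \<rho>)"
  have lam': "lam' = density lam (\<lambda>z. ennreal (k z))"
    unfolding lam'_def variation_has_density[OF \<rho>]
    by (simp add: pair_density_left pair_density_right measure_add_density k_def flip: ennreal_plus)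
  have RN: "AE z in lam'. RN_deriv lam' (density lam (\<lambda>z. ennreal (c z))) z = ennreal (max 0 (c z) / k z)"
    if [measurable]: "c \<in> borel_measurable borel" and c0: "\<And>z. k z = 0 \<Longrightarrow> c z = 0" for c
  proof -
    have eq: "density lam (\<lambda>z. ennreal (c z)) = density lam (\<lambda>z. ennreal (max 0 (c z)))"
      by (intro arg_cong[where f = "density lam"] ext) (auto simp: max_def ennreal_neg)
    show ?thesis
      unfolding lam' eq by (rule RN_deriv_density_density) (use c0 sigma_finite_lam in auto)
  qed
  have pos_neg: "max 0 c / a - max 0 (- c) / a = c / a" for a c :: real
    by (simp add: max_def)
  have "AE z in lam'. RN_deriv lam' (jordan_pos \<rho> \<Otimes>\<^sub>M \<mu>) z = ennreal (max 0 (p z * r (fst z)) / k z)"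
    "AE z in lam'. RN_deriv lam' (jordan_neg \<rho> \<Otimes>\<^sub>M \<mu>) z = ennreal (max 0 (- (p z * r (fst z))) / k z)"
    using RN[of "\<lambda>z. p z * r (fst z)", OF _ k0(1)] RN[of "\<lambda>z. p z * - r (fst z)"] k0
    unfolding jordan_pos_has_density[OF \<rho>] jordan_neg_has_density[OF \<rho>]
    by (simp_all add: pair_density_left)
  then have "AE z in lam'. dens_left lam' \<rho> \<mu> z = p z * r (fst z) / k z"
    unfolding dens_left_def by eventually_elim (simp add: pos_neg)
  moreover have "AE z in lam'. RN_deriv lam' (\<mu> \<Otimes>\<^sub>M jordan_pos \<rho>) z = ennreal (max 0 (q z * r (snd z)) / k z)"
    "AE z in lam'. RN_deriv lam' (\<mu> \<Otimes>\<^sub>M jordan_neg \<rho>) z = ennreal (max 0 (- (q z * r (snd z))) / k z)"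
    using RN[of "\<lambda>z. q z * r (snd z)", OF _ k0(2)] RN[of "\<lambda>z. q z * - r (snd z)"] k0
    unfolding jordan_pos_has_density[OF \<rho>] jordan_neg_has_density[OF \<rho>]
    by (simp_all add: pair_density_right)
  then have "AE z in lam'. dens_right lam' \<mu> \<rho> z = q z * r (snd z) / k z"
    unfolding dens_right_def by eventually_elim (simp add: pos_neg)
  ultimately have dens: "AE z in lam'. dens_left lam' \<rho> \<mu> z = p z * r (fst z) / k z \<and>
      dens_right lam' \<mu> \<rho> z = q z * r (snd z) / k z"
    by eventually_elim simp
  have meas[measurable]: "dens_left lam' \<rho> \<mu> \<in> borel_measurable lam'" "dens_right lam' \<mu> \<rho> \<in> borel_measurable lam'"
    unfolding dens_left_def[abs_def] dens_right_def[abs_def] by measurable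
  have [measurable_cong]: "sets lam' = sets borel" by (simp add: lam')
  \<comment> \<open>Homogeneity is available for positive factors only; for \<open>k z = 0\<close>
    both sides vanish because \<open>\<Phi> 0 0 (w z) = 0\<close>.\<close>
  have hom: "k z * \<Phi> (p z * r (fst z) / k z) (q z * r (snd z) / k z) (w z) =
      \<Phi> (p z * r (fst z)) (q z * r (snd z)) (w z)" for z
  proof (cases "k z = 0")
    case True
    have "\<Phi> 0 0 (w z) = 0" using \<Phi> unfolding flux_interpolation_def by blast
    then show ?thesis by (simp only: k0[OF True] True mult_zero_left)
  next
    case False
    then have "k z > 0" using k_nn[of z] by linarith
    moreover have "\<forall>\<alpha>>0. \<forall>a b w. \<Phi> (\<alpha> * a) (\<alpha> * b) w = \<alpha> * \<Phi> a b w"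
      using \<Phi> unfolding flux_interpolation_def by blast
    ultimately show ?thesis by (metis False nonzero_mult_div_cancel_left times_divide_eq_right)
  qed
  have "flux \<Phi> \<mu> \<eta> \<rho> w B = (LINT z:B|lam. indicator offdiag z * (\<Phi> (p z * r (fst z)) (q z * r (snd z)) (w z) * \<eta> z))"
    if [measurable]: "B \<in> sets borel" for B
  proof -
    have "flux \<Phi> \<mu> \<eta> \<rho> w B =
        (LINT z|lam'. indicator (B \<inter> offdiag) z * (\<Phi> (dens_left lam' \<rho> \<mu> z) (dens_right lam' \<mu> \<rho> z) (w z) * \<eta> z))"
      using that by (simp add: flux_def flux_wrt_def lam'_def set_lebesgue_integral_def)
    also have "\<dots> = (LINT z|lam'. indicator (B \<inter> offdiag) z *
        (\<Phi> (p z * r (fst z) / k z) (q z * r (snd z) / k z) (w z) * \<eta> z))"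
    proof (rule Bochner_Integration.integral_cong_AE)
      show "AE z in lam'. indicator (B \<inter> offdiag) z * (\<Phi> (dens_left lam' \<rho> \<mu> z) (dens_right lam' \<mu> \<rho> z) (w z) * \<eta> z) =
        indicator (B \<inter> offdiag) z * (\<Phi> (p z * r (fst z) / k z) (q z * r (snd z) / k z) (w z) * \<eta> z)"
        using dens by eventually_elim simp
    qed measurable
    also have "\<dots> = (LINT z|lam. k z *\<^sub>R (indicator (B \<inter> offdiag) z *
        (\<Phi> (p z * r (fst z) / k z) (q z * r (snd z) / k z) (w z) * \<eta> z)))"
      unfolding lam' by (rule integral_density) auto
    also have "\<dots> = (LINT z:B|lam. indicator offdiag z * (\<Phi> (p z * r (fst z)) (q z * r (snd z)) (w z) * \<eta> z))"
      unfolding set_lebesgue_integral_def hom[symmetric]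
      by (intro Bochner_Integration.integral_cong) (auto simp: indicator_def)
    finally show ?thesis .
  qed
  moreover have "flux \<Phi> \<mu> \<eta> \<rho> w B = 0" if "B \<notin> sets borel" for B
    using that by (simp add: flux_def flux_wrt_def)
  ultimately show ?thesis
    using int by (simp add: has_density_def)
qed

text \<open>By Tonelli, each half integrates \<open>g\<close> over \<mu> with the variable of \<nu>
  held fixed, which costs \<open>C\<close>. This variable is the first one in the half with
  \<open>p\<close> and the second one in the half with \<open>q\<close>, hence the two hypotheses on
  \<open>g\<close> and the factor 2.\<close>

lemma weighted_bound:
  assumes [measurable]: "g \<in> borel_measurable borel" "t \<in> borel_measurable borel"
    and t: "integrable \<nu> t" and g0: "\<And>z. 0 \<le> g z" and C: "0 \<le> C"
    and g1: "\<And>x. (\<integral>\<^sup>+y. ennreal (g (x, y)) \<partial>\<mu>) \<le> ennreal C"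
    and g2: "\<And>y. (\<integral>\<^sup>+x. ennreal (g (x, y)) \<partial>\<mu>) \<le> ennreal C"
  shows "integrable lam (\<lambda>z. (p z * \<bar>t (fst z)\<bar> + q z * \<bar>t (snd z)\<bar>) * g z)"
    and "(LINT z|lam. (p z * \<bar>t (fst z)\<bar> + q z * \<bar>t (snd z)\<bar>) * g z) \<le> 2 * C * (LINT x|\<nu>. \<bar>t x\<bar>)"
proof -
  interpret \<mu>: sigma_finite_measure \<mu> by (rule sigma_finite_\<mu>)
  interpret \<nu>: finite_measure \<nu> by (rule finite_\<nu>)
  interpret \<mu>\<nu>: pair_sigma_finite \<mu> \<nu> by unfold_locales
  have meas: "f \<in> borel_measurable (\<nu> \<Otimes>\<^sub>M \<mu>)" "f \<in> borel_measurable (\<mu> \<Otimes>\<^sub>M \<nu>)"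
    if "f \<in> borel_measurable borel" for f :: "'a \<times> 'a \<Rightarrow> ennreal"
    unfolding density_p[symmetric] density_q[symmetric] using that by simp_all
  have T: "(\<integral>\<^sup>+x. ennreal \<bar>t x\<bar> \<partial>\<nu>) = ennreal (LINT x|\<nu>. \<bar>t x\<bar>)"
    using t by (intro nn_integral_eq_integral) auto
  have [measurable]: "(\<lambda>y. g (x, y)) \<in> borel_measurable borel" "(\<lambda>x. g (x, y)) \<in> borel_measurable borel" for x y
    by (rule measurable_compose[OF _ \<open>g \<in> _\<close>], simp add: borel_measurable_Pair)+
  have "(\<integral>\<^sup>+z. ennreal (p z) * ennreal (\<bar>t (fst z)\<bar> * g z) \<partial>lam) = (\<integral>\<^sup>+z. ennreal (\<bar>t (fst z)\<bar> * g z) \<partial>(\<nu> \<Otimes>\<^sub>M \<mu>))"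
    unfolding density_p[symmetric] by (rule nn_integral_density[symmetric]) auto
  also have "\<dots> = (\<integral>\<^sup>+x. \<integral>\<^sup>+y. ennreal (\<bar>t x\<bar> * g (x, y)) \<partial>\<mu> \<partial>\<nu>)"
    by (subst \<mu>.nn_integral_fst[symmetric]) (auto intro!: meas)
  also have "\<dots> \<le> (\<integral>\<^sup>+x. ennreal \<bar>t x\<bar> * ennreal C \<partial>\<nu>)"
    using g0 g1 by (intro nn_integral_mono) (auto simp: ennreal_mult nn_integral_cmult intro!: mult_left_mono)
  also have "\<dots> = ennreal (C * (LINT x|\<nu>. \<bar>t x\<bar>))"
    using C by (subst nn_integral_multc) (simp_all add: T ennreal_mult'' mult.commute[of C])
  finally have 1: "(\<integral>\<^sup>+z. ennreal (p z) * ennreal (\<bar>t (fst z)\<bar> * g z) \<partial>lam) \<le> ennreal (C * (LINT x|\<nu>. \<bar>t x\<bar>))" .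
  have "(\<integral>\<^sup>+z. ennreal (q z) * ennreal (\<bar>t (snd z)\<bar> * g z) \<partial>lam) = (\<integral>\<^sup>+z. ennreal (\<bar>t (snd z)\<bar> * g z) \<partial>(\<mu> \<Otimes>\<^sub>M \<nu>))"
    unfolding density_q[symmetric] by (rule nn_integral_density[symmetric]) auto
  \<comment> \<open>The order is exchanged so that the inner integral is again over \<mu>.\<close>
  also have "\<dots> = (\<integral>\<^sup>+y. \<integral>\<^sup>+x. ennreal (\<bar>t y\<bar> * g (x, y)) \<partial>\<mu> \<partial>\<nu>)"
    by (subst \<mu>\<nu>.nn_integral_snd[symmetric]) (auto intro!: meas)
  also have "\<dots> \<le> (\<integral>\<^sup>+x. ennreal \<bar>t x\<bar> * ennreal C \<partial>\<nu>)"
    using g0 g2 by (intro nn_integral_mono) (auto simp: ennreal_mult nn_integral_cmult intro!: mult_left_mono)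
  also have "\<dots> = ennreal (C * (LINT x|\<nu>. \<bar>t x\<bar>))"
    using C by (subst nn_integral_multc) (simp_all add: T ennreal_mult'' mult.commute[of C])
  finally have 2: "(\<integral>\<^sup>+z. ennreal (q z) * ennreal (\<bar>t (snd z)\<bar> * g z) \<partial>lam) \<le> ennreal (C * (LINT x|\<nu>. \<bar>t x\<bar>))" .
  have "ennreal ((p z * \<bar>t (fst z)\<bar> + q z * \<bar>t (snd z)\<bar>) * g z) =
      ennreal (p z) * ennreal (\<bar>t (fst z)\<bar> * g z) + ennreal (q z) * ennreal (\<bar>t (snd z)\<bar> * g z)" for z
    using g0[of z] by (simp add: ennreal_mult[symmetric] distrib_right mult.assoc flip: ennreal_plus)
  then have "(\<integral>\<^sup>+z. ennreal ((p z * \<bar>t (fst z)\<bar> + q z * \<bar>t (snd z)\<bar>) * g z) \<partial>lam) =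
      (\<integral>\<^sup>+z. ennreal (p z) * ennreal (\<bar>t (fst z)\<bar> * g z) \<partial>lam) + (\<integral>\<^sup>+z. ennreal (q z) * ennreal (\<bar>t (snd z)\<bar> * g z) \<partial>lam)"
    by (simp add: nn_integral_add)
  also have "\<dots> \<le> ennreal (C * (LINT x|\<nu>. \<bar>t x\<bar>)) + ennreal (C * (LINT x|\<nu>. \<bar>t x\<bar>))"
    by (intro add_mono 1 2)
  also have "\<dots> = ennreal (2 * C * (LINT x|\<nu>. \<bar>t x\<bar>))"
    using C by (simp flip: ennreal_plus)
  finally have nn: "(\<integral>\<^sup>+z. ennreal ((p z * \<bar>t (fst z)\<bar> + q z * \<bar>t (snd z)\<bar>) * g z) \<partial>lam) \<le> ennreal (2 * C * (LINT x|\<nu>. \<bar>t x\<bar>))" .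
  show int: "integrable lam (\<lambda>z. (p z * \<bar>t (fst z)\<bar> + q z * \<bar>t (snd z)\<bar>) * g z)"
    using g0 by (intro integrableI_nonneg le_less_trans[OF nn]) auto
  have "ennreal (LINT z|lam. (p z * \<bar>t (fst z)\<bar> + q z * \<bar>t (snd z)\<bar>) * g z) \<le> ennreal (2 * C * (LINT x|\<nu>. \<bar>t x\<bar>))"
    using nn g0 by (subst nn_integral_eq_integral[OF int, symmetric]) auto
  then show "(LINT z|lam. (p z * \<bar>t (fst z)\<bar> + q z * \<bar>t (snd z)\<bar>) * g z) \<le> 2 * C * (LINT x|\<nu>. \<bar>t x\<bar>)"
    using C by (subst (asm) ennreal_le_iff) auto
qed

text \<open>The three terms of \<open>flux_interpolation_diff_le\<close> are integrated by
  \<open>weighted_bound\<close> with the pairs \<open>(r - s, w)\<close>, \<open>(s, w - w')\<close>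
  and \<open>(s, w')\<close>. They account for the changes of the measure, of the velocity and of
  \<eta>, respectively.\<close>

lemma sintegral_flux_diff_le_aux:
  assumes \<rho>: "has_density \<rho> \<nu> r" and \<sigma>: "has_density \<sigma> \<nu> s" and \<Phi>: "flux_interpolation \<Phi> L"
    and meas[measurable]: "r \<in> borel_measurable borel" "s \<in> borel_measurable borel"
      "w \<in> borel_measurable borel" "w' \<in> borel_measurable borel"
      "\<eta> \<in> borel_measurable borel" "\<eta>' \<in> borel_measurable borel" "f \<in> borel_measurable borel"
    and nonneg: "0 \<le> C" "0 \<le> D"
    and w1: "\<And>x. (\<integral>\<^sup>+y. ennreal \<bar>w (x, y)\<bar> \<partial>\<mu>) \<le> ennreal C" "\<And>y. (\<integral>\<^sup>+x. ennreal \<bar>w (x, y)\<bar> \<partial>\<mu>) \<le> ennreal C"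
    and w2: "\<And>x. (\<integral>\<^sup>+y. ennreal \<bar>w' (x, y)\<bar> \<partial>\<mu>) \<le> ennreal C" "\<And>y. (\<integral>\<^sup>+x. ennreal \<bar>w' (x, y)\<bar> \<partial>\<mu>) \<le> ennreal C"
    and w3: "\<And>x. (\<integral>\<^sup>+y. ennreal \<bar>w (x, y) - w' (x, y)\<bar> \<partial>\<mu>) \<le> ennreal D"
      "\<And>y. (\<integral>\<^sup>+x. ennreal \<bar>w (x, y) - w' (x, y)\<bar> \<partial>\<mu>) \<le> ennreal D"
    and \<eta>: "\<And>z. \<bar>\<eta> z\<bar> \<le> K" "\<And>z. \<bar>\<eta>' z\<bar> \<le> K" "\<And>z. \<bar>\<eta> z - \<eta>' z\<bar> \<le> e"
    and f: "\<And>z. \<bar>f z\<bar> \<le> B"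
  shows "\<bar>sintegral (flux \<Phi> \<mu> \<eta> \<rho> w) f - sintegral (flux \<Phi> \<mu> \<eta>' \<sigma> w') f\<bar> \<le>
    2 * B * L * (K * C * tv_norm (\<rho> - \<sigma>) + K * D * tv_norm \<sigma> + C * e * tv_norm \<sigma>)"
proof -
  note \<Phi>_meas[measurable] = flux_interpolation_measurable[OF \<Phi>]
  have L: "L > 0" using \<Phi> unfolding flux_interpolation_def by blast
  have B: "B \<ge> 0" and K: "K \<ge> 0" and e: "e \<ge> 0"
    using f \<eta> abs_ge_zero order_trans by blast+
  note ir = has_density_integrable[OF \<rho>] and is' = has_density_integrable[OF \<sigma>]
  have ids: "integrable \<nu> (\<lambda>x. r x - s x)" using ir is' by simp
  define W where "W t g z = (p z * \<bar>t (fst z)\<bar> + q z * \<bar>t (snd z)\<bar>) * \<bar>g z\<bar>" for t :: "'a \<Rightarrow> real" and g z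
  have W: "integrable lam (W t g)" "(LINT z|lam. W t g z) \<le> 2 * c * (LINT x|\<nu>. \<bar>t x\<bar>)"
    if "integrable \<nu> t" "g \<in> borel_measurable borel" "t \<in> borel_measurable borel" "0 \<le> c"
      "\<And>x. (\<integral>\<^sup>+y. ennreal \<bar>g (x, y)\<bar> \<partial>\<mu>) \<le> ennreal c" "\<And>y. (\<integral>\<^sup>+x. ennreal \<bar>g (x, y)\<bar> \<partial>\<mu>) \<le> ennreal c" for t g c
    using weighted_bound[of "\<lambda>z. \<bar>g z\<bar>" t c] that unfolding W_def[abs_def] by auto
  define H where "H r w \<eta> z = indicator offdiag z * (\<Phi> (p z * r (fst z)) (q z * r (snd z)) (w z) * \<eta> z)"
    for r :: "'a \<Rightarrow> real" and w \<eta> z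
  have H_int: "integrable lam (H t g h)"
    if t: "integrable \<nu> t" and [measurable]: "g \<in> borel_measurable borel" "t \<in> borel_measurable borel" "h \<in> borel_measurable borel"
      and gC: "\<And>x. (\<integral>\<^sup>+y. ennreal \<bar>g (x, y)\<bar> \<partial>\<mu>) \<le> ennreal C" "\<And>y. (\<integral>\<^sup>+x. ennreal \<bar>g (x, y)\<bar> \<partial>\<mu>) \<le> ennreal C"
      and h: "\<And>z. \<bar>h z\<bar> \<le> K" for t g h
  proof (rule Bochner_Integration.integrable_bound)
    show "integrable lam (\<lambda>z. L * K * W t g z)"
      using W(1)[OF t _ _ nonneg(1) gC] by simp
    show "H t g h \<in> borel_measurable lam" unfolding H_def[abs_def] by measurable
    have "\<bar>H t g h z\<bar> \<le> L * K * W t g z" for z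
    proof -
      have "\<bar>H t g h z\<bar> \<le> \<bar>\<Phi> (p z * t (fst z)) (q z * t (snd z)) (g z) * h z\<bar>"
        by (auto simp: H_def indicator_def)
      also have "\<dots> \<le> (L * (\<bar>p z * t (fst z)\<bar> + \<bar>q z * t (snd z)\<bar>) * \<bar>g z\<bar>) * \<bar>h z\<bar>"
        using flux_interpolation_diff_le[OF \<Phi>, of "p z * t (fst z)" "q z * t (snd z)" "g z" "h z" 0 0 0 0] by simp
      also have "\<dots> \<le> (L * (\<bar>p z * t (fst z)\<bar> + \<bar>q z * t (snd z)\<bar>) * \<bar>g z\<bar>) * K"
        using L h by (intro mult_left_mono) auto
      finally show ?thesis by (simp add: W_def abs_mult algebra_simps)
    qed
    then show "AE z in lam. norm (H t g h z) \<le> norm (L * K * W t g z)"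
      unfolding real_norm_def by (intro AE_I2 order_trans[OF _ abs_ge_self])
  qed
  have Hr: "integrable lam (H r w \<eta>)" and Hs: "integrable lam (H s w' \<eta>')"
    by (intro H_int ir is' w1 w2 \<eta> meas)+
  have dens: "has_density (flux \<Phi> \<mu> \<eta> \<rho> w) lam (H r w \<eta>)" "has_density (flux \<Phi> \<mu> \<eta>' \<sigma> w') lam (H s w' \<eta>')"
    using has_density_flux[OF \<rho> \<Phi>, of w \<eta>] has_density_flux[OF \<sigma> \<Phi>, of w' \<eta>'] Hr Hs meas
    unfolding H_def[abs_def] by auto
  have Hf: "integrable lam (\<lambda>z. H r w \<eta> z * f z)" "integrable lam (\<lambda>z. H s w' \<eta>' z * f z)"
    by (rule integrable_mult_bounded[OF Hr _ f], simp) (rule integrable_mult_bounded[OF Hs _ f], simp)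
  \<comment> \<open>Pointwise majorant of the difference of the two flux densities, one summand for
    each changed argument.\<close>
  define R where "R z = L * K * W (\<lambda>x. r x - s x) w z + L * K * W s (\<lambda>z. w z - w' z) z + L * e * W s w' z" for z
  have R_int: "integrable lam R"
    unfolding R_def[abs_def]
    by (intro Bochner_Integration.integrable_add Bochner_Integration.integrable_mult_right
        W(1)[OF ids _ _ nonneg(1) w1] W(1)[OF is' _ _ nonneg(2) w3] W(1)[OF is' _ _ nonneg(1) w2]) auto
  have pt: "\<bar>H r w \<eta> z - H s w' \<eta>' z\<bar> \<le> R z" for z
  proof -
    let ?a = "p z * r (fst z)" and ?b = "q z * r (snd z)" and ?a' = "p z * s (fst z)" and ?b' = "q z * s (snd z)"
    have "\<bar>H r w \<eta> z - H s w' \<eta>' z\<bar> \<le> \<bar>\<Phi> ?a ?b (w z) * \<eta> z - \<Phi> ?a' ?b' (w' z) * \<eta>' z\<bar>"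
      by (auto simp: H_def indicator_def)
    also have "\<dots> \<le> L * (\<bar>?a - ?a'\<bar> + \<bar>?b - ?b'\<bar>) * \<bar>w z\<bar> * \<bar>\<eta> z\<bar> + L * (\<bar>?a'\<bar> + \<bar>?b'\<bar>) * \<bar>w z - w' z\<bar> * \<bar>\<eta> z\<bar> +
        L * (\<bar>?a'\<bar> + \<bar>?b'\<bar>) * \<bar>w' z\<bar> * \<bar>\<eta> z - \<eta>' z\<bar>"
      by (rule flux_interpolation_diff_le[OF \<Phi>])
    also have "\<dots> \<le> L * (\<bar>?a - ?a'\<bar> + \<bar>?b - ?b'\<bar>) * \<bar>w z\<bar> * K + L * (\<bar>?a'\<bar> + \<bar>?b'\<bar>) * \<bar>w z - w' z\<bar> * K +
        L * (\<bar>?a'\<bar> + \<bar>?b'\<bar>) * \<bar>w' z\<bar> * e"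
      using L \<eta> by (intro add_mono mult_left_mono) auto
    also have "\<bar>?a - ?a'\<bar> = p z * \<bar>r (fst z) - s (fst z)\<bar>"
      unfolding right_diff_distrib[symmetric] by (simp add: abs_mult)
    also have "\<bar>?b - ?b'\<bar> = q z * \<bar>r (snd z) - s (snd z)\<bar>"
      unfolding right_diff_distrib[symmetric] by (simp add: abs_mult)
    finally show ?thesis by (simp add: R_def W_def abs_mult mult_ac)
  qed
  have "sintegral (flux \<Phi> \<mu> \<eta> \<rho> w) f - sintegral (flux \<Phi> \<mu> \<eta>' \<sigma> w') f = (LINT z|lam. H r w \<eta> z * f z - H s w' \<eta>' z * f z)"
    using Hf by (simp add: sintegral_has_density[OF dens(1)] sintegral_has_density[OF dens(2)])
  also have "\<bar>\<dots>\<bar> \<le> (LINT z|lam. \<bar>H r w \<eta> z * f z - H s w' \<eta>' z * f z\<bar>)"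
    by (rule integral_abs_bound)
  also have "\<dots> \<le> (LINT z|lam. B * R z)"
  proof (rule integral_mono)
    show "\<bar>H r w \<eta> z * f z - H s w' \<eta>' z * f z\<bar> \<le> B * R z" for z
      unfolding left_diff_distrib[symmetric] abs_mult
      using mult_mono[OF pt[of z] f[of z]] order_trans[OF abs_ge_zero pt[of z]] by (simp add: mult.commute)
  qed (use Hf R_int in auto)
  also have "\<dots> = B * (LINT z|lam. R z)" by simp
  also have "(LINT z|lam. R z) = L * K * (LINT z|lam. W (\<lambda>x. r x - s x) w z) + L * K * (LINT z|lam. W s (\<lambda>z. w z - w' z) z) + L * e * (LINT z|lam. W s w' z)"
    unfolding R_def[abs_def]
    using W(1)[OF ids _ _ nonneg(1) w1] W(1)[OF is' _ _ nonneg(2) w3] W(1)[OF is' _ _ nonneg(1) w2]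
    by simp
  also have "B * \<dots> \<le> B * (L * K * (2 * C * tv_norm (\<rho> - \<sigma>)) + L * K * (2 * D * tv_norm \<sigma>) + L * e * (2 * C * tv_norm \<sigma>))"
    unfolding tv_norm_has_density[OF has_density_diff[OF \<rho> \<sigma>]] tv_norm_has_density[OF \<sigma>]
    using L K e B
    by (intro mult_left_mono add_mono
        W(2)[OF ids _ _ nonneg(1) w1] W(2)[OF is' _ _ nonneg(2) w3] W(2)[OF is' _ _ nonneg(1) w2]) auto
  finally show ?thesis by (simp add: algebra_simps)
qed

end

text \<open>Permits functions that are controlled only off the diagonal to be replaced by their
  extensions by 0, which are Borel on the whole product.\<close>

lemma flux_cong_offdiag:
  assumes "\<And>z. z \<in> offdiag \<Longrightarrow> w z = w' z" "\<And>z. z \<in> offdiag \<Longrightarrow> \<eta> z = \<eta>' z"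
  shows "flux \<Phi> \<mu> \<eta> \<rho> w = flux \<Phi> \<mu> \<eta>' \<rho> w'"
proof
  fix B :: "('a \<times> 'a) set"
  show "flux \<Phi> \<mu> \<eta> \<rho> w B = flux \<Phi> \<mu> \<eta>' \<rho> w' B"
    unfolding flux_def flux_wrt_def set_lebesgue_integral_def
    using assms by (auto intro!: Bochner_Integration.integral_cong simp: indicator_def)
qed

text \<open>Extension by 0 reduces the claim to everywhere defined functions. The bounds for
  integration in the first variable come from antisymmetry, which passes to the difference
  \<open>w - w'\<close>.\<close>

lemma sintegral_flux_diff_le:
  fixes \<mu> :: "'a::euclidean_space measure"
  assumes \<Phi>: "flux_interpolation \<Phi> L" and \<mu>: "radon_measure \<mu>" and \<rho>: "\<rho> \<in> M_TV" and \<sigma>: "\<sigma> \<in> M_TV"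
    and as: "w \<in> V_as" "w' \<in> V_as"
    and wm: "w \<in> borel_measurable (restrict_space borel offdiag)" "w' \<in> borel_measurable (restrict_space borel offdiag)"
    and \<eta>c: "continuous_on offdiag \<eta>" "continuous_on offdiag \<eta>'"
    and f: "f \<in> borel_measurable borel" "\<And>z. \<bar>f z\<bar> \<le> B"
    and nonneg: "0 \<le> C" "0 \<le> D"
    and w: "\<And>x. (\<integral>\<^sup>+y\<in>UNIV - {x}. ennreal \<bar>w (x, y)\<bar> \<partial>\<mu>) \<le> ennreal C"
      "\<And>x. (\<integral>\<^sup>+y\<in>UNIV - {x}. ennreal \<bar>w' (x, y)\<bar> \<partial>\<mu>) \<le> ennreal C"
      "\<And>x. (\<integral>\<^sup>+y\<in>UNIV - {x}. ennreal \<bar>w (x, y) - w' (x, y)\<bar> \<partial>\<mu>) \<le> ennreal D"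
    and \<eta>: "\<And>z. z \<in> offdiag \<Longrightarrow> \<bar>\<eta> z\<bar> \<le> K" "\<And>z. z \<in> offdiag \<Longrightarrow> \<bar>\<eta>' z\<bar> \<le> K"
      "\<And>z. z \<in> offdiag \<Longrightarrow> \<bar>\<eta> z - \<eta>' z\<bar> \<le> e" and Ke: "0 \<le> K" "0 \<le> e"
  shows "\<bar>sintegral (flux \<Phi> \<mu> \<eta> \<rho> w) f - sintegral (flux \<Phi> \<mu> \<eta>' \<sigma> w') f\<bar> \<le>
    2 * B * L * (K * C * tv_norm (\<rho> - \<sigma>) + K * D * tv_norm \<sigma> + C * e * tv_norm \<sigma>)"
proof -
  obtain \<nu> r s where \<nu>: "finite_measure \<nu>" "has_density \<rho> \<nu> r" "has_density \<sigma> \<nu> s"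
    using M_TV_common_density[OF \<rho> \<sigma>] by metis
  have s\<nu>: "sets \<nu> = sets borel" by (rule has_density_sets[OF \<nu>(2)])
  obtain lam p q where "flux_reference \<mu> \<nu> lam p q"
    using flux_reference_exists[OF \<mu> \<nu>(1) s\<nu>] by metis
  then interpret flux_reference \<mu> \<nu> lam p q .
  let ?I = "\<lambda>g z. indicator offdiag z * g z :: real"
  have rs: "r \<in> borel_measurable borel" "s \<in> borel_measurable borel"
    using borel_measurable_integrable[OF has_density_integrable[OF \<nu>(2)]]
      borel_measurable_integrable[OF has_density_integrable[OF \<nu>(3)]]
    by (simp_all cong: measurable_cong_sets)
  have ext: "?I g \<in> borel_measurable borel" if "g \<in> borel_measurable (restrict_space borel offdiag)" for g :: "'a \<times> 'a \<Rightarrow> real"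
    using that by (subst (asm) borel_measurable_restrict_space_iff) auto
  have \<eta>m: "\<eta> \<in> borel_measurable (restrict_space borel offdiag)" "\<eta>' \<in> borel_measurable (restrict_space borel offdiag)"
    by (intro borel_measurable_continuous_on_restrict \<eta>c)+
  have 1: "(\<integral>\<^sup>+y. ennreal \<bar>?I g (x, y)\<bar> \<partial>\<mu>) = (\<integral>\<^sup>+y\<in>UNIV - {x}. ennreal \<bar>g (x, y)\<bar> \<partial>\<mu>)"
    for g :: "'a \<times> 'a \<Rightarrow> real" and x
    by (intro nn_integral_cong) (auto simp: indicator_def offdiag_def)
  \<comment> \<open>Antisymmetry exchanges the two variables under the absolute value; on the
    diagonal, where it says nothing, the extension vanishes.\<close>
  have 2: "(\<integral>\<^sup>+x. ennreal \<bar>?I g (x, y)\<bar> \<partial>\<mu>) = (\<integral>\<^sup>+x\<in>UNIV - {y}. ennreal \<bar>g (y, x)\<bar> \<partial>\<mu>)"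
    if "g \<in> V_as" for g y
  proof -
    have "\<bar>g (x, y)\<bar> = \<bar>g (y, x)\<bar>" if "x \<noteq> y" for x
      using \<open>g \<in> V_as\<close> that unfolding V_as_def by (metis (mono_tags, lifting) abs_minus_cancel mem_Collect_eq)
    then show ?thesis
      by (intro nn_integral_cong) (simp add: indicator_def offdiag_def)
  qed
  have as': "(\<lambda>z. w z - w' z) \<in> V_as" 
    unfolding V_as_def
  proof (intro CollectI allI impI)
    fix x y :: 'a assume "x \<noteq> y"
    then have "w (x, y) = - w (y, x)" "w' (x, y) = - w' (y, x)"
      using as unfolding V_as_def by blast+
    then show "w (x, y) - w' (x, y) = - (w (y, x) - w' (y, x))" by linarith
  qed
  have d: "?I w z - ?I w' z = ?I (\<lambda>z. w z - w' z) z" for z by (simp add: right_diff_distrib)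
  have "\<bar>sintegral (flux \<Phi> \<mu> (?I \<eta>) \<rho> (?I w)) f - sintegral (flux \<Phi> \<mu> (?I \<eta>') \<sigma> (?I w')) f\<bar> \<le>
    2 * B * L * (K * C * tv_norm (\<rho> - \<sigma>) + K * D * tv_norm \<sigma> + C * e * tv_norm \<sigma>)"
  proof (rule sintegral_flux_diff_le_aux[OF \<nu>(2,3) \<Phi> rs])
    show "(\<integral>\<^sup>+y. ennreal \<bar>?I w (x, y)\<bar> \<partial>\<mu>) \<le> ennreal C" "(\<integral>\<^sup>+y. ennreal \<bar>?I w (y, x)\<bar> \<partial>\<mu>) \<le> ennreal C"
      "(\<integral>\<^sup>+y. ennreal \<bar>?I w' (x, y)\<bar> \<partial>\<mu>) \<le> ennreal C" "(\<integral>\<^sup>+y. ennreal \<bar>?I w' (y, x)\<bar> \<partial>\<mu>) \<le> ennreal C" for x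
      using w as by (simp_all only: 1 2)
    show "(\<integral>\<^sup>+y. ennreal \<bar>?I w (x, y) - ?I w' (x, y)\<bar> \<partial>\<mu>) \<le> ennreal D"
      "(\<integral>\<^sup>+y. ennreal \<bar>?I w (y, x) - ?I w' (y, x)\<bar> \<partial>\<mu>) \<le> ennreal D" for x
      unfolding d using w(3) by (simp_all only: 1[of _ "\<lambda>z. w z - w' z"] 2[OF as'])
    show "\<bar>?I \<eta> z - ?I \<eta>' z\<bar> \<le> e" for z using \<eta> Ke by (auto simp: indicator_def)
  qed (use ext wm \<eta>m f nonneg \<eta> Ke in \<open>auto simp: indicator_def\<close>)
  moreover have "flux \<Phi> \<mu> (?I \<eta>) \<rho> (?I w) = flux \<Phi> \<mu> \<eta> \<rho> w" "flux \<Phi> \<mu> (?I \<eta>') \<sigma> (?I w') = flux \<Phi> \<mu> \<eta>' \<sigma> w'"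
    by (intro flux_cong_offdiag; simp)+
  ultimately show ?thesis by simp
qed

text \<open>Lets the size of a flux be read off from the difference estimate, with the second \<eta>
  equal to 0.\<close>

lemma sintegral_flux_zero:
  "sintegral (flux \<Phi> \<mu> (\<lambda>z. 0) \<rho> w) f = 0"
proof -
  have "flux \<Phi> \<mu> (\<lambda>z. 0) \<rho> w = (\<lambda>B. 0)"
    by (auto simp: flux_def flux_wrt_def set_lebesgue_integral_def)
  moreover have "sintegral (\<lambda>B :: 'b set. 0) g = 0" for g :: "'b::topological_space \<Rightarrow> real"
    by (simp add: sintegral_def jordan_neg_def)
  ultimately show ?thesis by simp
qed

section \<open>Relaxation and weak derivatives on an interval\<close>

lemma LINT_eq_integral:
  fixes f :: "real \<Rightarrow> real"
  shows "f absolutely_integrable_on {a..b} \<Longrightarrow> (LINT x:{a..b}|lebesgue. f x) = integral {a..b} f"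
  by (rule set_lebesgue_integral_eq_integral(2))

text \<open>Two continuous functions that differ at one point differ on a whole interval, which is
  not negligible.\<close>

lemma continuous_AE_eq_imp_eq:
  fixes f g :: "real \<Rightarrow> real"
  assumes "0 < T" and f: "continuous_on {0..T} f" and g: "continuous_on {0..T} g"
    and ae: "AE t in lebesgue. t \<in> {0..T} \<longrightarrow> f t = g t" and t: "t \<in> {0..T}"
  shows "f t = g t"
proof (rule ccontr)
  assume "f t \<noteq> g t"
  have "continuous_on {0..T} (\<lambda>x. f x - g x)" by (intro continuous_intros f g)
  then obtain d where d: "d > 0" "\<And>x. x \<in> {0..T} \<Longrightarrow> dist x t < d \<Longrightarrow> dist (f x - g x) (f t - g t) < \<bar>f t - g t\<bar>"
    unfolding continuous_on_iff using t \<open>f t \<noteq> g t\<close> by (metis zero_less_abs_iff eq_iff_diff_eq_0)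
  \<comment> \<open>The cuts at 0 and \<open>T\<close> keep the interval in the domain when
    \<open>t\<close> is near an endpoint; it remains nondegenerate because
    \<open>0 < T\<close>.\<close>
  define a b where "a = max 0 (t - d / 2)" and "b = min T (t + d / 2)"
  have ab: "a < b" using \<open>0 < T\<close> t d(1) by (auto simp: a_def b_def)
  have ne: "x \<in> {0..T} \<and> f x \<noteq> g x" if "x \<in> {a..b}" for x
  proof -
    have "x \<in> {0..T}" "dist x t < d"
      using that d(1) t unfolding a_def b_def dist_real_def by auto
    with d(2)[of x] show ?thesis by (auto simp: dist_real_def)
  qed
  obtain N where N: "N \<in> null_sets lebesgue" "{t \<in> space lebesgue. \<not> (t \<in> {0..T} \<longrightarrow> f t = g t)} \<subseteq> N"
    using ae unfolding eventually_ae_filter by blast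
  have "{a..b} \<subseteq> N" using ne N(2) by auto
  then have "negligible {a..b}" using N(1) negligible_iff_null_sets negligible_subset by blast
  then show False using ab negligible_interval(1)[of a b] by (simp add: box_real)
qed

text \<open>The increments of \<open>g\<close> are dominated by those of the continuous function
  \<open>K * F t + K' * t\<close>, with \<open>F\<close> the indefinite integral of the modulus. The
  linear term is there for \<open>\<omega> t (\<rho> t) z\<close>, which depends on time both
  directly and through the curve.\<close>

lemma AC_curve_continuous_on:
  fixes g :: "real \<Rightarrow> real"
  assumes ac: "AC_curve nrm B T \<gamma>" and K: "0 \<le> K" "0 \<le> K'"
    and g: "\<And>s t. 0 \<le> s \<Longrightarrow> s < t \<Longrightarrow> t \<le> T \<Longrightarrow> \<bar>g t - g s\<bar> \<le> K * nrm (\<gamma> t - \<gamma> s) + K' * (t - s)"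
  shows "continuous_on {0..T} g"
proof -
  obtain m where m: "m absolutely_integrable_on {0..T}"
    "\<And>s t. 0 \<le> s \<Longrightarrow> s < t \<Longrightarrow> t \<le> T \<Longrightarrow> nrm (\<gamma> t - \<gamma> s) \<le> (LINT r:{s..t}|lebesgue. m r)"
    using ac by (auto simp: AC_curve_def)
  have mi: "m integrable_on {0..T}" using m(1) absolutely_integrable_on_def by blast
  define F where "F t = integral {0..t} m" for t
  define G where "G t = K * F t + K' * t" for t
  have "continuous_on {0..T} F" unfolding F_def by (rule indefinite_integral_continuous_1[OF mi])
  then have contG: "continuous_on {0..T} G" unfolding G_def by (intro continuous_intros)
  have le: "\<bar>g t - g s\<bar> \<le> \<bar>G t - G s\<bar>" if "0 \<le> s" "s < t" "t \<le> T" for s t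
  proof -
    have "m absolutely_integrable_on {s..t}"
      using that by (intro set_integrable_subset[OF m(1)]) auto
    then have "(LINT r:{s..t}|lebesgue. m r) = integral {s..t} m" by (rule LINT_eq_integral)
    also have "\<dots> = F t - F s"
      unfolding F_def using that
      by (subst Henstock_Kurzweil_Integration.integral_combine[of 0 s t m, symmetric])
         (auto intro: integrable_subinterval_real[OF mi])
    finally have "nrm (\<gamma> t - \<gamma> s) \<le> F t - F s" using m(2)[OF that] by simp
    then have "K * nrm (\<gamma> t - \<gamma> s) \<le> K * (F t - F s)" using K by (intro mult_left_mono)
    then have "\<bar>g t - g s\<bar> \<le> G t - G s"
      using g[OF that] by (simp add: G_def algebra_simps)
    then show ?thesis by linarith
  qed
  then have le: "\<bar>g t - g s\<bar> \<le> \<bar>G t - G s\<bar>" if "s \<in> {0..T}" "t \<in> {0..T}" for s t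
    using that le[of s t] le[of t s] by (cases s t rule: linorder_cases) (auto simp: abs_minus_commute)
  show ?thesis
    unfolding continuous_on_iff
  proof (intro ballI allI impI)
    fix x e :: real assume "x \<in> {0..T}" "0 < e"
    then obtain d where "d > 0" "\<forall>x'\<in>{0..T}. dist x' x < d \<longrightarrow> dist (G x') (G x) < e"
      using contG unfolding continuous_on_iff by blast
    moreover have "dist (g x') (g x) \<le> dist (G x') (G x)" if "x' \<in> {0..T}" for x'
      using le[OF \<open>x \<in> {0..T}\<close> that] by (simp add: dist_real_def)
    ultimately show "\<exists>d>0. \<forall>x'\<in>{0..T}. dist x' x < d \<longrightarrow> dist (g x') (g x) < e"
      by (meson le_less_trans)
  qed
qed

text \<open>\<open>U\<close>, the right-hand side of the hypothesis, is differentiable in the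
  interior although \<open>u\<close> is merely continuous, and the hypothesis makes
  \<open>exp (- C * t) * U t\<close> nonincreasing.\<close>

lemma gronwall:
  fixes u :: "real \<Rightarrow> real"
  assumes u: "continuous_on {0..T} u" and C: "0 \<le> C"
    and le: "\<And>t. t \<in> {0..T} \<Longrightarrow> u t \<le> A + C * integral {0..t} u" and t: "t \<in> {0..T}"
  shows "u t \<le> A * exp (C * t)"
proof -
  define U where "U t = A + C * integral {0..t} u" for t
  have contU: "continuous_on {0..T} U"
    unfolding U_def using u by (intro continuous_intros indefinite_integral_continuous_1 integrable_continuous_real)
  have dU: "(U has_real_derivative C * u x) (at x)" if "0 < x" "x < T" for x
  proof -
    have "((\<lambda>x. integral {0..x} u) has_real_derivative u x) (at x within {0..T})"
      using that by (intro integral_has_real_derivative u) auto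
    then have "((\<lambda>x. integral {0..x} u) has_real_derivative u x) (at x)"
      using that by (simp add: at_within_Icc_at)
    then show ?thesis unfolding U_def[abs_def] by (auto intro!: derivative_eq_intros)
  qed
  have "exp (- C * t) * U t \<le> exp (- C * 0) * U 0"
  proof (rule DERIV_nonpos_imp_decreasing_open[where f = "\<lambda>x. exp (- C * x) * U x"])
    show "0 \<le> t" using t by auto
    show "continuous_on {0..t} (\<lambda>x. exp (- C * x) * U x)"
      using t by (intro continuous_intros continuous_on_subset[OF contU]) auto
    fix x assume x: "0 < x" "x < t"
    have "((\<lambda>x. exp (- C * x) * U x) has_real_derivative exp (- C * x) * (C * u x) + (exp (- C * x) * (- C)) * U x) (at x)"
      by (rule DERIV_cong[OF DERIV_mult[OF _ dU]]) (use x t in \<open>auto intro!: derivative_eq_intros\<close>)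
    moreover have "exp (- C * x) * (C * u x) + (exp (- C * x) * (- C)) * U x = exp (- C * x) * C * (u x - U x)"
      by (simp add: algebra_simps)
    moreover have "exp (- C * x) * C * (u x - U x) \<le> 0"
      using le[of x] x t C by (intro mult_nonneg_nonpos) (auto simp: U_def)
    ultimately show "\<exists>y. ((\<lambda>x. exp (- C * x) * U x) has_real_derivative y) (at x) \<and> y \<le> 0"
      by metis
  qed
  then have "U t \<le> A * exp (C * t)"
    by (simp add: U_def exp_minus field_simps)
  then show ?thesis using le[OF t] by (simp add: U_def)
qed

text \<open>The comparison function \<open>exp (s / \<epsilon>) * (A + \<Lambda> * (t - s) + \<Lambda> * \<epsilon>)\<close> has
  derivative \<open>exp (s / \<epsilon>) * (A + \<Lambda> * (t - s)) / \<epsilon>\<close>, which dominates that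
  of \<open>exp (s / \<epsilon>) * (u s - c)\<close>.\<close>

lemma relaxation_estimate:
  fixes u a :: "real \<Rightarrow> real"
  assumes u: "continuous_on {0..t} u" and a: "continuous_on {0..t} a" and \<epsilon>: "0 < \<epsilon>" and t: "0 \<le> t"
    and eq: "\<And>s. s \<in> {0..t} \<Longrightarrow> u s = u 0 + (1/\<epsilon>) * integral {0..s} (\<lambda>r. a r - u r)"
    and ac: "\<And>s. s \<in> {0..t} \<Longrightarrow> \<bar>a s - c\<bar> \<le> A + \<Lambda> * (t - s)"
    and u0: "\<bar>u 0 - c\<bar> \<le> A + \<Lambda> * t + \<delta>" and pos: "0 \<le> \<Lambda>" "0 \<le> \<delta>"
  shows "\<bar>u t - c\<bar> \<le> \<delta> + A + \<Lambda> * \<epsilon>"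
proof -
  have du: "(u has_real_derivative (a s - u s) / \<epsilon>) (at s)" if s: "0 < s" "s < t" for s
  proof -
    have "((\<lambda>x. integral {0..x} (\<lambda>r. a r - u r)) has_real_derivative a s - u s) (at s within {0..t})"
      using s by (intro integral_has_real_derivative continuous_intros u a) auto
    then have "((\<lambda>x. u 0 + (1/\<epsilon>) * integral {0..x} (\<lambda>r. a r - u r)) has_real_derivative (a s - u s) / \<epsilon>) (at s)"
      using s \<epsilon> by (auto simp: at_within_Icc_at intro!: derivative_eq_intros)
    then show ?thesis
    proof (rule has_field_derivative_transform_within_open[of _ _ _ "{0<..<t}"])
      show "u 0 + (1/\<epsilon>) * integral {0..x} (\<lambda>r. a r - u r) = u x" if "x \<in> {0<..<t}" for x
        using eq[of x] that by simp
    qed (use s in auto)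
  qed
  define E where "E s = exp (s / \<epsilon>) * (A + \<Lambda> * (t - s) + \<Lambda> * \<epsilon>)" for s
  have dE: "(E has_real_derivative exp (s / \<epsilon>) * (A + \<Lambda> * (t - s)) / \<epsilon>) (at s)" for s
    unfolding E_def[abs_def] using \<epsilon> by (auto intro!: derivative_eq_intros simp: field_simps)
  \<comment> \<open>The sign \<theta> treats the upper and the lower bound together.\<close>
  have key: "exp (t / \<epsilon>) * (\<theta> * (u t - c)) - E t \<le> exp (0 / \<epsilon>) * (\<theta> * (u 0 - c)) - E 0"
    if \<theta>: "\<bar>\<theta>\<bar> = 1" for \<theta> :: real
  proof (rule DERIV_nonpos_imp_decreasing_open[OF t, where f = "\<lambda>s. exp (s / \<epsilon>) * (\<theta> * (u s - c)) - E s"])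
    show "continuous_on {0..t} (\<lambda>s. exp (s / \<epsilon>) * (\<theta> * (u s - c)) - E s)"
      unfolding E_def using \<epsilon> by (intro continuous_intros u) auto
    fix s assume s: "0 < s" "s < t"
    have d1: "((\<lambda>s. \<theta> * (u s - c)) has_real_derivative \<theta> * ((a s - u s) / \<epsilon>)) (at s)"
      using du[OF s] by (auto intro!: derivative_eq_intros)
    have d2: "((\<lambda>s. exp (s / \<epsilon>)) has_real_derivative exp (s / \<epsilon>) / \<epsilon>) (at s)"
      using \<epsilon> by (auto intro!: derivative_eq_intros)
    have "((\<lambda>s. exp (s / \<epsilon>) * (\<theta> * (u s - c)) - E s) has_real_derivative
        exp (s / \<epsilon>) / \<epsilon> * (\<theta> * (u s - c)) + \<theta> * ((a s - u s) / \<epsilon>) * exp (s / \<epsilon>) -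
          exp (s / \<epsilon>) * (A + \<Lambda> * (t - s)) / \<epsilon>) (at s)"
      by (intro DERIV_diff DERIV_mult d1 d2 dE)
    moreover have "exp (s / \<epsilon>) / \<epsilon> * (\<theta> * (u s - c)) + \<theta> * ((a s - u s) / \<epsilon>) * exp (s / \<epsilon>) -
          exp (s / \<epsilon>) * (A + \<Lambda> * (t - s)) / \<epsilon> = exp (s / \<epsilon>) / \<epsilon> * (\<theta> * (a s - c) - (A + \<Lambda> * (t - s)))"
      using \<epsilon> by (simp add: field_simps)
    moreover have "\<theta> * (a s - c) \<le> A + \<Lambda> * (t - s)"
      using ac[of s] s \<theta> abs_ge_self[of "\<theta> * (a s - c)"] by (simp add: abs_mult)
    then have "exp (s / \<epsilon>) / \<epsilon> * (\<theta> * (a s - c) - (A + \<Lambda> * (t - s))) \<le> 0"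
      using \<epsilon> by (intro mult_nonneg_nonpos) auto
    ultimately show "\<exists>y. ((\<lambda>s. exp (s / \<epsilon>) * (\<theta> * (u s - c)) - E s) has_real_derivative y) (at s) \<and> y \<le> 0"
      by metis
  qed
  have bound: "\<theta> * (u t - c) \<le> \<delta> + A + \<Lambda> * \<epsilon>" if \<theta>: "\<bar>\<theta>\<bar> = 1" for \<theta> :: real
  proof -
    have "\<theta> * (u 0 - c) \<le> A + \<Lambda> * t + \<delta>"
      using u0 \<theta> abs_ge_self[of "\<theta> * (u 0 - c)"] by (simp add: abs_mult)
    \<comment> \<open>\<open>E 0\<close> equals
      \<open>A + \<Lambda> * t + \<Lambda> * \<epsilon>\<close>, so the right-hand side of
      \<open>key\<close> is at most \<open>\<delta>\<close>.\<close>
    moreover have "0 \<le> \<Lambda> * \<epsilon>" using pos \<epsilon> by simp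
    ultimately have "exp (t / \<epsilon>) * (\<theta> * (u t - c)) - exp (t / \<epsilon>) * (A + \<Lambda> * \<epsilon>) \<le> \<delta>"
      using key[OF \<theta>] by (simp add: E_def)
    also have "\<delta> \<le> exp (t / \<epsilon>) * \<delta>" using pos(2) t \<epsilon> mult_right_mono[of 1 "exp (t / \<epsilon>)" \<delta>] by simp
    finally have "exp (t / \<epsilon>) * (\<theta> * (u t - c)) \<le> exp (t / \<epsilon>) * (\<delta> + A + \<Lambda> * \<epsilon>)"
      by (simp add: algebra_simps)
    then show ?thesis by simp
  qed
  show ?thesis using bound[of 1] bound[of "-1"] by (simp add: abs_le_iff)
qed

text \<open>Second differences of ramps: \<open>step d\<close> is a continuously differentiable approximation of the
  Heaviside function and its derivative \<open>bump d\<close> a hat function of mass 1, so that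
  \<open>step d (t - s) - step d (t - r)\<close> is an admissible test function for weak derivatives.\<close>

definition ramp :: "real \<Rightarrow> real" where "ramp x = max 0 x"
definition ramp2 :: "real \<Rightarrow> real" where "ramp2 x = (max 0 x)\<^sup>2 / 2"
definition bump :: "real \<Rightarrow> real \<Rightarrow> real" where
  "bump d x = (ramp (x + d) - 2 * ramp x + ramp (x - d)) / d\<^sup>2"
definition step :: "real \<Rightarrow> real \<Rightarrow> real" where
  "step d x = (ramp2 (x + d) - 2 * ramp2 x + ramp2 (x - d)) / d\<^sup>2"

lemma ramp2_deriv: "(ramp2 has_real_derivative ramp x) (at x)"
proof (cases x "0 :: real" rule: linorder_cases)
  case less
  have "((\<lambda>x. 0) has_real_derivative ramp x) (at x)" using less by (simp add: ramp_def)
  then show ?thesis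
    by (rule has_field_derivative_transform_within_open[of _ _ _ "{..<0}"]) (use less in \<open>auto simp: ramp2_def\<close>)
next
  case greater
  have "((\<lambda>x. x\<^sup>2 / 2) has_real_derivative ramp x) (at x)"
    using greater by (auto simp: ramp_def intro!: derivative_eq_intros)
  then show ?thesis
    by (rule has_field_derivative_transform_within_open[of _ _ _ "{0<..}"]) (use greater in \<open>auto simp: ramp2_def\<close>)
next
  case equal
  have "((\<lambda>h. (ramp2 (0 + h) - ramp2 0) / h) \<longlongrightarrow> 0) (at 0)"
  proof (rule Lim_null_comparison)
    show "\<forall>\<^sub>F h in at 0. norm ((ramp2 (0 + h) - ramp2 0) / h) \<le> \<bar>h\<bar>"
      by (intro always_eventually) (auto simp: ramp2_def max_def power2_eq_square)
    show "((\<lambda>h::real. \<bar>h\<bar>) \<longlongrightarrow> 0) (at 0)" by (intro tendsto_eq_intros) auto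
  qed
  then show ?thesis using equal by (simp add: DERIV_def ramp_def)
qed

lemma step_deriv: "((\<lambda>x. step d (x - s)) has_real_derivative bump d (x - s)) (at x)"
proof -
  have "((\<lambda>x. ramp2 (x + c)) has_real_derivative ramp (x + c)) (at x)" for x c
    using DERIV_shift[of ramp2 "ramp (x + c)" x c] ramp2_deriv[of "x + c"] by simp
  then have "(step d has_real_derivative bump d y) (at y)" for y
    using ramp2_deriv unfolding step_def[abs_def] bump_def diff_conv_add_uminus
    by (intro DERIV_cdivide DERIV_add DERIV_minus DERIV_cmult)
  then show ?thesis
    using DERIV_shift[of "step d" "bump d (x - s)" x "-s"] by simp
qed

lemma bump_nonneg: "0 < d \<Longrightarrow> 0 \<le> bump d x"
  and bump_eq_0: "0 < d \<Longrightarrow> d \<le> \<bar>x\<bar> \<Longrightarrow> bump d x = 0"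
  and step_eq_0: "0 < d \<Longrightarrow> x \<le> - d \<Longrightarrow> step d x = 0"
  by (auto simp: bump_def step_def ramp_def ramp2_def max_def)

lemma step_eq_1: "0 < d \<Longrightarrow> d \<le> x \<Longrightarrow> step d x = 1"
  by (auto simp: step_def ramp2_def max_def field_simps power2_eq_square)

lemma continuous_bump: "continuous_on S (\<lambda>x. bump d (x - s))"
  unfolding bump_def ramp_def by (cases "d = 0") (auto intro!: continuous_intros)

text \<open>\<open>step d\<close> is nondecreasing because its derivative is nonnegative, and it
  takes the value 0 to the left of \<open>- d\<close> and 1 to the right of
  \<open>d\<close>.\<close>

lemma step_bounds:
  assumes "0 < d" shows "0 \<le> step d x" "step d x \<le> 1"
proof -
  have mono: "step d x \<le> step d y" if "x \<le> y" for x y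
    by (rule DERIV_nonneg_imp_nondecreasing[OF that])
       (use step_deriv[of d 0] bump_nonneg[OF assms] in auto)
  show "0 \<le> step d x" "step d x \<le> 1"
    using mono[of "min x (-d)" x] mono[of x "max x d"] step_eq_0[OF assms, of "min x (-d)"] step_eq_1[OF assms, of "max x d"]
    by auto
qed

text \<open>The conditions on \<open>d\<close> place the whole hat inside the interval, so its mass
  there is exactly 1, and the average of \<open>f\<close> is off by at most the oscillation of
  \<open>f\<close> on the support.\<close>

lemma bump_average:
  assumes f: "continuous_on {0..T} f" and d: "0 < d" "d < s" "s + d < T"
    and e: "\<And>x. \<bar>x - s\<bar> \<le> d \<Longrightarrow> \<bar>f x - f s\<bar> \<le> e"
  shows "\<bar>integral {0..T} (\<lambda>t. f t * bump d (t - s)) - f s\<bar> \<le> e"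
proof -
  have "((\<lambda>t. bump d (t - s)) has_integral (step d (T - s) - step d (0 - s))) {0..T}"
    using d by (intro fundamental_theorem_of_calculus)
      (auto simp: has_real_derivative_iff_has_vector_derivative[symmetric] intro: DERIV_subset[OF step_deriv])
  then have b: "((\<lambda>t. bump d (t - s)) has_integral 1) {0..T}"
    using d by (simp add: step_eq_0 step_eq_1)
  have i: "(\<lambda>t. f t * bump d (t - s)) integrable_on {0..T}"
    by (intro integrable_continuous_real continuous_intros f continuous_bump)
  have I1: "((\<lambda>t. f t * bump d (t - s) - f s * bump d (t - s)) has_integral
      (integral {0..T} (\<lambda>t. f t * bump d (t - s)) - f s * 1)) {0..T}"
    by (intro has_integral_diff has_integral_mult_right b integrable_integral i)
  have I2: "((\<lambda>t. e * bump d (t - s)) has_integral e * 1) {0..T}"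
    by (intro has_integral_mult_right b)
  have pw: "norm (f t * bump d (t - s) - f s * bump d (t - s)) \<le> e * bump d (t - s)" for t
  proof (cases "\<bar>t - s\<bar> \<le> d")
    case True
    then show ?thesis
      using e[OF True] bump_nonneg[OF d(1), of "t - s"]
      unfolding left_diff_distrib[symmetric] by (auto simp: abs_mult intro!: mult_right_mono)
  next
    case False
    then show ?thesis using bump_eq_0[OF d(1), of "t - s"] by simp
  qed
  have "norm (integral {0..T} (\<lambda>t. f t * bump d (t - s)) - f s * 1) \<le> e * 1"
    using integral_norm_bound_integral[OF has_integral_integrable[OF I1] has_integral_integrable[OF I2] pw]
    unfolding integral_unique[OF I1] integral_unique[OF I2] .
  then show ?thesis by simp
qed

text \<open>Tested with a smoothed indicator of \<open>{s..r}\<close>, the weak derivative yields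
  the difference of two local averages of \<open>f\<close> on one side and at most \<open>C\<close>
  times the length of the support on the other. The test function must vanish near 0 and
  \<open>T\<close>, so endpoints are reached by continuity.\<close>

lemma weak_deriv_lipschitz:
  assumes f: "continuous_on {0..T} f" and wd: "weak_deriv T f g"
    and g: "AE t in lebesgue. t \<in> {0..T} \<longrightarrow> \<bar>g t\<bar> \<le> C" and C: "0 \<le> C"
    and st: "0 \<le> s" "s \<le> t" "t \<le> T"
  shows "\<bar>f t - f s\<bar> \<le> C * (t - s)"
proof -
  have inner: "\<bar>f r - f s\<bar> \<le> C * (r - s)" if sr: "0 < s" "s < r" "r < T" for s r
  proof (rule field_le_epsilon)
    fix e' :: real assume "0 < e'"
    \<comment> \<open>Two parts pay for the averages at \<open>s\<close> and \<open>r\<close>, the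
      third for the enlarged support.\<close>
    define e where "e = e' / 3"
    have e: "e > 0" using \<open>0 < e'\<close> by (simp add: e_def)
    obtain d1 where d1: "d1 > 0" "\<And>x. x \<in> {0..T} \<Longrightarrow> \<bar>x - s\<bar> < d1 \<Longrightarrow> \<bar>f x - f s\<bar> < e"
      using f[unfolded continuous_on_iff, rule_format, of s e] sr e by (auto simp: dist_real_def)
    obtain d2 where d2: "d2 > 0" "\<And>x. x \<in> {0..T} \<Longrightarrow> \<bar>x - r\<bar> < d2 \<Longrightarrow> \<bar>f x - f r\<bar> < e"
      using f[unfolded continuous_on_iff, rule_format, of r e] sr e by (auto simp: dist_real_def)
    \<comment> \<open>The first two bounds control the oscillation of \<open>f\<close> near
      \<open>s\<close> and \<open>r\<close>, the next two keep the support inside the open interval,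
      and the last gives \<open>2 * C * d \<le> e\<close>, with \<open>C + 1\<close> to allow for
      \<open>C = 0\<close>.\<close>
    define d where "d = Min {d1/2, d2/2, s/2, (T - r)/2, e / (2 * (C + 1))}"
    have d: "d > 0" "d \<le> d1/2" "d \<le> d2/2" "d \<le> s/2" "d \<le> (T - r)/2" "d \<le> e / (2 * (C + 1))"
    proof -
      have dle: "d \<le> y" if "y \<in> {d1/2, d2/2, s/2, (T - r)/2, e / (2 * (C + 1))}" for y
        unfolding d_def using that by (intro Min_le) auto
      show "d \<le> d1/2" "d \<le> d2/2" "d \<le> s/2" "d \<le> (T - r)/2" "d \<le> e / (2 * (C + 1))"
        by (rule dle, simp)+
      have "0 < d1/2" "0 < d2/2" "0 < s/2" "0 < (T - r)/2" "0 < e / (2 * (C + 1))"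
        using d1(1) d2(1) sr e C by simp_all
      then show "d > 0" unfolding d_def by (simp del: zero_less_divide_iff)
    qed
    have "d * (2 * (C + 1)) \<le> e"
    proof -
      have "0 < 2 * (C + 1)" using C by simp
      then show ?thesis using d(6) by (metis pos_le_divide_eq)
    qed
    then have Cd: "2 * C * d \<le> e" using d(1) by (simp add: algebra_simps)
    have s_avg: "\<bar>integral {0..T} (\<lambda>t. f t * bump d (t - s)) - f s\<bar> \<le> e"
      using d d1 sr by (intro bump_average f less_imp_le[OF d1(2)]) (auto simp: abs_le_iff)
    have r_avg: "\<bar>integral {0..T} (\<lambda>t. f t * bump d (t - r)) - f r\<bar> \<le> e"
      using d d2 sr by (intro bump_average f less_imp_le[OF d2(2)]) (auto simp: abs_le_iff)
    define \<psi> where "\<psi> t = step d (t - s) - step d (t - r)" for t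
    define \<psi>' where "\<psi>' t = bump d (t - s) - bump d (t - r)" for t
    have \<psi>: "(\<psi> has_real_derivative \<psi>' t) (at t)" for t
      unfolding \<psi>_def[abs_def] \<psi>'_def by (intro DERIV_diff step_deriv)
    have \<psi>c: "continuous_on S \<psi>'" for S
      unfolding \<psi>'_def by (intro continuous_intros continuous_bump)
    have supp: "\<psi> t = 0" if "t \<notin> {s - d..r + d}" for t
      using that d(1) sr by (auto simp: \<psi>_def step_eq_0 step_eq_1)
    have \<psi>1: "\<bar>\<psi> t\<bar> \<le> 1" for t
      using step_bounds[OF d(1), of "t - s"] step_bounds[OF d(1), of "t - r"] by (auto simp: \<psi>_def)
    have "(LINT t:{0..T}|lebesgue. f t * \<psi>' t) = - (LINT t:{0..T}|lebesgue. g t * \<psi> t)"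
    proof (rule wd[unfolded weak_deriv_def, THEN conjunct2, THEN conjunct2, THEN spec, THEN spec, THEN mp],
        intro conjI)
      show "\<exists>a b. 0 < a \<and> b < T \<and> (\<forall>t. t \<notin> {a..b} \<longrightarrow> \<psi> t = 0)"
        using supp d sr by (intro exI[of _ "s - d"] exI[of _ "r + d"]) auto
    qed (use \<psi> \<psi>c in auto)
    moreover have "(LINT t:{0..T}|lebesgue. f t * \<psi>' t) = integral {0..T} (\<lambda>t. f t * \<psi>' t)"
    proof -
      have "continuous_on {0..T} (\<lambda>t. f t * \<psi>' t)" by (rule continuous_on_mult[OF f \<psi>c])
      then show ?thesis by (intro LINT_eq_integral absolutely_integrable_continuous_real)
    qed
    moreover have "integral {0..T} (\<lambda>t. f t * \<psi>' t) =
        integral {0..T} (\<lambda>t. f t * bump d (t - s)) - integral {0..T} (\<lambda>t. f t * bump d (t - r))"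
      unfolding \<psi>'_def right_diff_distrib
      by (intro Henstock_Kurzweil_Integration.integral_diff integrable_continuous_real continuous_intros f continuous_bump)
    moreover have "\<bar>LINT t:{0..T}|lebesgue. g t * \<psi> t\<bar> \<le> C * (r - s + 2 * d)"
    proof -
      have "\<bar>LINT t:{0..T}|lebesgue. g t * \<psi> t\<bar> \<le> (LINT t|lebesgue. \<bar>indicator {0..T} t *\<^sub>R (g t * \<psi> t)\<bar>)"
        unfolding set_lebesgue_integral_def by (rule integral_abs_bound)
      also have "\<dots> \<le> (LINT t|lebesgue. C * indicator {s - d..r + d} t)"
      proof (rule integral_mono_AE')
        show "AE t in lebesgue. \<bar>indicator {0..T} t *\<^sub>R (g t * \<psi> t)\<bar> \<le> C * indicator {s - d..r + d} t"
          using g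
        proof eventually_elim
          case (elim t)
          show ?case
          proof (cases "t \<in> {s - d..r + d}")
            case True
            then have "\<bar>g t\<bar> \<le> C" using elim d sr by auto
            then have "\<bar>g t\<bar> * \<bar>\<psi> t\<bar> \<le> C * 1" using \<psi>1 C by (intro mult_mono) auto
            then show ?thesis using True C by (auto simp: indicator_def abs_mult)
          qed (simp add: supp)
        qed
        show "integrable lebesgue (\<lambda>t. C * indicator {s - d..r + d} t)"
          by (intro integrable_mult_right integrable_real_indicator) (simp_all add: emeasure_lborel_Icc_eq)
      qed (use C in simp)
      also have "\<dots> = C * measure lebesgue {s - d..r + d}"
        by (subst integral_mult_right_zero) simp
      also have "measure lebesgue {s - d..r + d} = measure lborel {s - d..r + d}"
        by (rule measure_completion) simp
      also have "measure lborel {s - d..r + d} = r - s + 2 * d"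
        using d(1) sr by (subst measure_lborel_Icc) linarith+
      finally show ?thesis .
    qed
    ultimately have "\<bar>f r - f s\<bar> \<le> C * (r - s + 2 * d) + 2 * e"
      using s_avg r_avg by linarith
    then show "\<bar>f r - f s\<bar> \<le> C * (r - s) + e'"
      using Cd by (simp add: e_def algebra_simps)
  qed
  show ?thesis
  proof (cases "s = t")
    case False
    have st': "s < t" using st False by simp
    \<comment> \<open>A denominator of at least 3 keeps \<open>s + h k\<close> to the left of
      \<open>t - h k\<close> for every \<open>k\<close>, including 0.\<close>
    define h where "h k = (t - s) / real (k + 3)" for k
    have h: "0 < h k" "3 * h k \<le> t - s" for k
    proof -
      show "0 < h k" using st' by (simp add: h_def)
      then have "3 * h k \<le> real (k + 3) * h k" by (intro mult_right_mono) auto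
      also have "\<dots> = t - s" by (simp add: h_def)
      finally show "3 * h k \<le> t - s" .
    qed
    have h0: "h \<longlonglongrightarrow> 0" unfolding h_def by (rule LIMSEQ_ignore_initial_segment[OF lim_const_over_n])
    have in_range: "s + h k \<in> {0..T}" "t - h k \<in> {0..T}" for k
      using st h[of k] by auto
    have "(\<lambda>k. f (s + h k)) \<longlonglongrightarrow> f s"
      using st in_range tendsto_add[OF tendsto_const h0, of s]
      by (intro continuous_on_tendsto_compose[OF f]) auto
    moreover have "(\<lambda>k. f (t - h k)) \<longlonglongrightarrow> f t"
      using st in_range tendsto_diff[OF tendsto_const h0, of t]
      by (intro continuous_on_tendsto_compose[OF f]) auto
    ultimately have "(\<lambda>k. \<bar>f (t - h k) - f (s + h k)\<bar>) \<longlonglongrightarrow> \<bar>f t - f s\<bar>"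
      by (intro tendsto_intros)
    then show ?thesis
    proof (rule LIMSEQ_le_const2, intro exI allI impI)
      fix k
      have "\<bar>f (t - h k) - f (s + h k)\<bar> \<le> C * ((t - h k) - (s + h k))"
      proof (rule inner)
        show "0 < s + h k" using h(1)[of k] st(1) by simp
        show "t - h k < T" using h(1)[of k] st(3) by simp
        show "s + h k < t - h k" using h[of k] by simp
      qed
      also have "\<dots> \<le> C * (t - s)"
        by (rule mult_left_mono[OF _ C]) (use h(1)[of k] in simp)
      finally show "\<bar>f (t - h k) - f (s + h k)\<bar> \<le> C * (t - s)" .
    qed
  qed simp
qed

section \<open>The singular limit\<close>

text \<open>Excludes a supremum over the empty set in \<open>sup_norm\<close>, and shows that
  pointwise bounds off the diagonal are nonnegative.\<close>

lemma offdiag_nonempty: "(offdiag :: ('a::euclidean_space \<times> 'a) set) \<noteq> {}"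
proof -
  obtain b :: 'a where "b \<in> Basis" using nonempty_Basis by blast
  then have "(b, 0) \<in> offdiag" by (auto simp: offdiag_def)
  then show ?thesis by blast
qed

lemma abs_le_sup_norm:
  assumes "\<And>z. z \<in> offdiag \<Longrightarrow> \<bar>f z\<bar> \<le> c" "z \<in> offdiag"
  shows "\<bar>f z\<bar> \<le> sup_norm f"
  unfolding sup_norm_def using assms by (intro cSUP_upper bdd_aboveI2[of _ _ c]) auto

lemma sup_norm_le:
  fixes f :: "'a::euclidean_space \<times> 'a \<Rightarrow> real"
  assumes "\<And>z. z \<in> offdiag \<Longrightarrow> \<bar>f z\<bar> \<le> c"
  shows "sup_norm f \<le> c"
  unfolding sup_norm_def using assms offdiag_nonempty by (intro cSUP_least) auto

lemma C_b_bounded: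
  assumes "f \<in> C_b" obtains c where "\<And>z. z \<in> offdiag \<Longrightarrow> \<bar>f z\<bar> \<le> c"
  using assms unfolding C_b_def bounded_iff by auto

lemma C_0_bounded:
  fixes \<phi> :: "'a::euclidean_space \<Rightarrow> real"
  assumes "\<phi> \<in> C_0" obtains c where "\<And>x. \<bar>\<phi> x\<bar> \<le> c"
proof -
  have c: "continuous_on UNIV \<phi>" and l: "(\<phi> \<longlongrightarrow> 0) at_infinity" using assms by (auto simp: C_0_def)
  from tendstoD[OF l, of 1] obtain R where R: "\<And>x. R \<le> norm x \<Longrightarrow> \<bar>\<phi> x\<bar> < 1"
    by (auto simp: eventually_at_infinity)
  have "compact (\<phi> ` cball 0 R)"
    by (intro compact_continuous_image continuous_on_subset[OF c]) auto
  then have "bounded (\<phi> ` cball 0 R)" by (rule compact_imp_bounded)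
  then obtain c where "\<forall>y\<in>\<phi> ` cball 0 R. norm y \<le> c"
    unfolding bounded_iff by blast
  then have c: "\<And>x. x \<in> cball 0 R \<Longrightarrow> \<bar>\<phi> x\<bar> \<le> c" by simp
  have "\<bar>\<phi> x\<bar> \<le> max c 1" for x
    using R[of x] c[of x] by (cases "norm x \<le> R") (auto simp: le_max_iff_disj less_imp_le)
  then show ?thesis by (rule that)
qed

lemma C_0_measurable: "\<phi> \<in> C_0 \<Longrightarrow> \<phi> \<in> borel_measurable borel"
  by (auto simp: C_0_def intro: borel_measurable_continuous_onI)

lemma nl_grad_measurable:
  fixes \<phi> :: "'a::euclidean_space \<Rightarrow> real"
  assumes "\<phi> \<in> C_0" shows "nl_grad \<phi> \<in> borel_measurable borel"
proof -
  have [measurable]: "\<phi> \<in> borel_measurable borel" by (rule C_0_measurable[OF assms])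
  show ?thesis unfolding nl_grad_def case_prod_beta' by measurable
qed

lemma nl_grad_bound:
  assumes "\<And>x. \<bar>\<phi> x\<bar> \<le> b" shows "\<bar>nl_grad \<phi> z\<bar> \<le> 2 * b"
  using assms[of "fst z"] assms[of "snd z"] by (auto simp: nl_grad_def case_prod_beta)

lemma integral_abs_le_integral:
  fixes f g :: "real \<Rightarrow> real"
  assumes "f integrable_on S" "g integrable_on S" "\<And>x. x \<in> S \<Longrightarrow> \<bar>f x\<bar> \<le> g x"
  shows "\<bar>integral S f\<bar> \<le> integral S g"
  using integral_norm_bound_integral[OF assms(1,2)] assms(3) by simp

lemma lipschitz_continuous_on_Icc:
  fixes u :: "real \<Rightarrow> real"
  assumes "\<And>s t. 0 \<le> s \<Longrightarrow> s \<le> t \<Longrightarrow> t \<le> T \<Longrightarrow> \<bar>u t - u s\<bar> \<le> C * (t - s)"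
  shows "continuous_on {0..T} u"
proof (rule AC_curve_continuous_on)
  \<comment> \<open>A constant curve with zero norm leaves only the linear term of the continuity
    criterion.\<close>
  show "AC_curve (\<lambda>x. 0) UNIV T (\<lambda>t. 0::real)"
    unfolding AC_curve_def by (intro conjI ballI exI[of _ "\<lambda>t. 0"]) (auto simp: set_lebesgue_integral_def)
  fix s t :: real assume "0 \<le> s" "s < t" "t \<le> T"
  then have "\<bar>u t - u s\<bar> \<le> C * (t - s)" using assms by simp
  also have "\<dots> \<le> \<bar>C\<bar> * (t - s)" using \<open>s < t\<close> by (intro mult_right_mono) auto
  finally show "\<bar>u t - u s\<bar> \<le> 0 * 0 + \<bar>C\<bar> * (t - s)" by simp
qed auto

text \<open>Weak differentiability of \<omega> in time is represented here by its consequence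
  \<open>\<omega>_time\<close>; the final theorem derives it from the bound on the weak
  derivative.\<close>

locale nonlocal_flow =
  fixes T M L C\<^sub>V L\<^sub>V L\<^sub>\<omega> C\<^sub>\<omega> C'\<^sub>\<omega> :: real
    and \<Phi> :: "real \<Rightarrow> real \<Rightarrow> real \<Rightarrow> real"
    and \<mu> :: "'a::euclidean_space measure"
    and V \<omega> :: "real \<Rightarrow> 'a smeasure \<Rightarrow> 'a \<times> 'a \<Rightarrow> real"
  assumes T: "0 < T" and M: "0 < M" and \<Phi>: "flux_interpolation \<Phi> L" and \<mu>: "radon_measure \<mu>"
    and V_field: "\<And>t \<rho>. t \<in> {0..T} \<Longrightarrow> \<rho> \<in> M_TV_ball M \<Longrightarrow> V t \<rho> \<in> V_as"
    and V_measurable: "\<And>t \<rho>. t \<in> {0..T} \<Longrightarrow> \<rho> \<in> M_TV_ball M \<Longrightarrow>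
          V t \<rho> \<in> borel_measurable (restrict_space borel offdiag)"
    and C\<^sub>V: "0 < C\<^sub>V"
    and V_bound: "\<And>t \<rho> x. t \<in> {0..T} \<Longrightarrow> \<rho> \<in> M_TV_ball M \<Longrightarrow>
          (\<integral>\<^sup>+y\<in>UNIV - {x}. ennreal \<bar>V t \<rho> (x, y)\<bar> \<partial>\<mu>) \<le> ennreal C\<^sub>V"
    and L\<^sub>V: "0 \<le> L\<^sub>V"
    and V_lipschitz: "\<And>t \<rho> \<sigma> x. t \<in> {0..T} \<Longrightarrow> \<rho> \<in> M_TV_ball M \<Longrightarrow> \<sigma> \<in> M_TV_ball M \<Longrightarrow>
          (\<integral>\<^sup>+y\<in>UNIV - {x}. ennreal \<bar>V t \<rho> (x, y) - V t \<sigma> (x, y)\<bar> \<partial>\<mu>) \<le> ennreal (L\<^sub>V * tv_norm (\<rho> - \<sigma>))"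
    and \<omega>_continuous: "\<And>t \<sigma>. t \<in> {0..T} \<Longrightarrow> \<sigma> \<in> M_TV_ball M \<Longrightarrow> continuous_on offdiag (\<omega> t \<sigma>)"
    and L\<^sub>\<omega>: "0 \<le> L\<^sub>\<omega>"
    and \<omega>_lipschitz: "\<And>t \<rho> \<sigma> z. t \<in> {0..T} \<Longrightarrow> \<rho> \<in> M_TV_ball M \<Longrightarrow> \<sigma> \<in> M_TV_ball M \<Longrightarrow> z \<in> offdiag \<Longrightarrow>
          \<bar>\<omega> t \<sigma> z - \<omega> t \<rho> z\<bar> \<le> L\<^sub>\<omega> * tv_norm (\<sigma> - \<rho>)"
    and C\<^sub>\<omega>: "0 < C\<^sub>\<omega>"
    and \<omega>_bound: "\<And>t \<rho> z. t \<in> {0..T} \<Longrightarrow> \<rho> \<in> M_TV_ball M \<Longrightarrow> z \<in> offdiag \<Longrightarrow> \<bar>\<omega> t \<rho> z\<bar> \<le> C\<^sub>\<omega>"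
    and C'\<^sub>\<omega>: "0 \<le> C'\<^sub>\<omega>"
    and \<omega>_time: "\<And>s t \<sigma> z. 0 \<le> s \<Longrightarrow> s \<le> t \<Longrightarrow> t \<le> T \<Longrightarrow> \<sigma> \<in> M_TV_ball M \<Longrightarrow> z \<in> offdiag \<Longrightarrow>
          \<bar>\<omega> t \<sigma> z - \<omega> s \<sigma> z\<bar> \<le> C'\<^sub>\<omega> * (t - s)"
begin

abbreviation flow :: "real \<Rightarrow> ('a \<times> 'a \<Rightarrow> real) \<Rightarrow> 'a smeasure \<Rightarrow> ('a \<Rightarrow> real) \<Rightarrow> real" where
  "flow t \<eta> \<rho> \<phi> \<equiv> sintegral (flux \<Phi> \<mu> \<eta> \<rho> (V t \<rho>)) (nl_grad \<phi>)"

abbreviation solution :: "real \<Rightarrow> (real \<Rightarrow> 'a smeasure) \<Rightarrow> (real \<Rightarrow> 'a \<times> 'a \<Rightarrow> real) \<Rightarrow> bool" where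
  "solution \<equiv> is_solution T M \<Phi> \<mu> V \<omega>"

lemma L: "0 < L" using \<Phi> unfolding flux_interpolation_def by blast

text \<open>The nonlocal gradient of a test function bounded by \<open>b\<close> is bounded by
  \<open>2 * b\<close>, which together with the 2 of the flux estimate gives the factor 4. The
  velocity difference is estimated by \<open>V_lipschitz\<close>, and the norm of \<sigma> by
  \<open>M\<close>.\<close>

lemma flow_diff_le:
  assumes t: "t \<in> {0..T}" and \<rho>: "\<rho> \<in> M_TV_ball M" and \<sigma>: "\<sigma> \<in> M_TV_ball M"
    and \<eta>c: "continuous_on offdiag \<eta>" "continuous_on offdiag \<eta>'"
    and \<eta>: "\<And>z. z \<in> offdiag \<Longrightarrow> \<bar>\<eta> z\<bar> \<le> K" "\<And>z. z \<in> offdiag \<Longrightarrow> \<bar>\<eta>' z\<bar> \<le> K"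
      "\<And>z. z \<in> offdiag \<Longrightarrow> \<bar>\<eta> z - \<eta>' z\<bar> \<le> e" and Ke: "0 \<le> K" "0 \<le> e"
    and \<phi>: "\<phi> \<in> C_0" "\<And>x. \<bar>\<phi> x\<bar> \<le> b"
  shows "\<bar>flow t \<eta> \<rho> \<phi> - flow t \<eta>' \<sigma> \<phi>\<bar> \<le>
    4 * b * L * (K * (C\<^sub>V + L\<^sub>V * M) * tv_norm (\<rho> - \<sigma>) + C\<^sub>V * M * e)"
proof -
  have b: "0 \<le> b" using \<phi>(2) abs_ge_zero order_trans by blast
  have tv: "\<rho> \<in> M_TV" "\<sigma> \<in> M_TV" "tv_norm \<sigma> \<le> M" using \<rho> \<sigma> by (auto simp: M_TV_ball_def)
  have "\<bar>flow t \<eta> \<rho> \<phi> - flow t \<eta>' \<sigma> \<phi>\<bar> \<le> 2 * (2 * b) * L * (K * C\<^sub>V * tv_norm (\<rho> - \<sigma>) +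
      K * (L\<^sub>V * tv_norm (\<rho> - \<sigma>)) * tv_norm \<sigma> + C\<^sub>V * e * tv_norm \<sigma>)"
    using C\<^sub>V L\<^sub>V
    by (intro sintegral_flux_diff_le \<Phi> \<mu> tv V_field V_measurable t \<rho> \<sigma> \<eta>c nl_grad_measurable \<phi>
        nl_grad_bound V_bound V_lipschitz \<eta> Ke) auto
  also have "\<dots> \<le> 2 * (2 * b) * L * (K * C\<^sub>V * tv_norm (\<rho> - \<sigma>) +
      K * (L\<^sub>V * tv_norm (\<rho> - \<sigma>)) * M + C\<^sub>V * e * M)"
    using b L Ke C\<^sub>V L\<^sub>V tv(3) by (intro mult_left_mono add_mono order_refl) auto
  also have "\<dots> = 4 * b * L * (K * (C\<^sub>V + L\<^sub>V * M) * tv_norm (\<rho> - \<sigma>) + C\<^sub>V * M * e)"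
    by (simp add: algebra_simps)
  finally show ?thesis .
qed

text \<open>Comparison with the zero function in the slot of \<eta>, at the same measure, leaves
  only the last term of \<open>flow_diff_le\<close>.\<close>

lemma flow_le:
  assumes t: "t \<in> {0..T}" and \<rho>: "\<rho> \<in> M_TV_ball M" and \<eta>c: "continuous_on offdiag \<eta>"
    and \<eta>: "\<And>z. z \<in> offdiag \<Longrightarrow> \<bar>\<eta> z\<bar> \<le> K" and K: "0 \<le> K"
    and \<phi>: "\<phi> \<in> C_0" "\<And>x. \<bar>\<phi> x\<bar> \<le> b"
  shows "\<bar>flow t \<eta> \<rho> \<phi>\<bar> \<le> 4 * b * L * C\<^sub>V * M * K"
proof -
  have "tv_norm (\<rho> - \<rho>) \<le> 0"
    using M_TV_I(2)[of "\<rho> - \<rho>" 0] M_TV_diff[of \<rho> \<rho>] \<rho> by (simp add: M_TV_ball_def M_TV_def)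
  then have z: "tv_norm (\<rho> - \<rho>) = 0" by (simp add: order_antisym)
  have "\<bar>flow t \<eta> \<rho> \<phi> - flow t (\<lambda>z. 0) \<rho> \<phi>\<bar> \<le>
      4 * b * L * (K * (C\<^sub>V + L\<^sub>V * M) * tv_norm (\<rho> - \<rho>) + C\<^sub>V * M * K)"
    by (rule flow_diff_le[OF t \<rho> \<rho> \<eta>c _ \<eta>]) (use \<eta> K \<phi> in auto)
  then show ?thesis by (simp add: sintegral_flux_zero z)
qed

section \<open>A priori bounds for a single solution\<close>

context
  fixes \<epsilon> \<rho> \<eta>
  assumes sol: "solution \<epsilon> \<rho> \<eta>" and \<epsilon>: "0 < \<epsilon>"
begin

lemma sol_\<rho>: "t \<in> {0..T} \<Longrightarrow> \<rho> t \<in> M_TV_ball M" "t \<in> {0..T} \<Longrightarrow> \<rho> t \<in> M_TV"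
  and sol_\<eta>: "t \<in> {0..T} \<Longrightarrow> \<eta> t \<in> C_b" "t \<in> {0..T} \<Longrightarrow> continuous_on offdiag (\<eta> t)"
  using sol unfolding is_solution_def AC_curve_def M_TV_ball_def C_b_def by blast+

lemma sol_sintegral_continuous:
  assumes \<phi>: "\<phi> \<in> C_0" shows "continuous_on {0..T} (\<lambda>t. sintegral (\<rho> t) \<phi>)"
proof -
  obtain b where b: "\<And>x. \<bar>\<phi> x\<bar> \<le> b" using C_0_bounded[OF \<phi>] by metis
  have ac: "AC_curve tv_norm (M_TV_ball M) T \<rho>" using sol unfolding is_solution_def by blast
  show ?thesis
  proof (rule AC_curve_continuous_on[OF ac, of b 0])
    fix s t assume st: "0 \<le> s" "s < t" "t \<le> T"
    have "sintegral (\<rho> t) \<phi> - sintegral (\<rho> s) \<phi> = sintegral (\<rho> t - \<rho> s) \<phi>"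
      using st by (intro sintegral_diff[where B = b, symmetric] sol_\<rho> C_0_measurable \<phi> b) auto
    then show "\<bar>sintegral (\<rho> t) \<phi> - sintegral (\<rho> s) \<phi>\<bar> \<le> b * tv_norm (\<rho> t - \<rho> s) + 0 * (t - s)"
      using st by (simp add: abs_sintegral_le M_TV_diff sol_\<rho> C_0_measurable \<phi> b)
  qed (use b[of 0] in auto)
qed

lemma sol_\<omega>_step:
  assumes st: "0 \<le> s" "s \<le> t" "t \<le> T" and z: "z \<in> offdiag"
  shows "\<bar>\<omega> t (\<rho> t) z - \<omega> s (\<rho> s) z\<bar> \<le> L\<^sub>\<omega> * tv_norm (\<rho> t - \<rho> s) + C'\<^sub>\<omega> * (t - s)"
proof -
  have "\<bar>\<omega> t (\<rho> t) z - \<omega> t (\<rho> s) z\<bar> \<le> L\<^sub>\<omega> * tv_norm (\<rho> t - \<rho> s)"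
    using st by (intro \<omega>_lipschitz sol_\<rho> z) auto
  moreover have "\<bar>\<omega> t (\<rho> s) z - \<omega> s (\<rho> s) z\<bar> \<le> C'\<^sub>\<omega> * (t - s)"
    using st by (intro \<omega>_time sol_\<rho> z) auto
  ultimately show ?thesis by linarith
qed

lemma sol_\<omega>_continuous:
  assumes z: "z \<in> offdiag" shows "continuous_on {0..T} (\<lambda>t. \<omega> t (\<rho> t) z)"
proof -
  have ac: "AC_curve tv_norm (M_TV_ball M) T \<rho>" using sol unfolding is_solution_def by blast
  show ?thesis
    by (rule AC_curve_continuous_on[OF ac L\<^sub>\<omega> C'\<^sub>\<omega>]) (use sol_\<omega>_step z in auto)
qed

lemma sol_\<eta>_continuous:
  assumes z: "z \<in> offdiag" shows "continuous_on {0..T} (\<lambda>t. \<eta> t z)"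
proof -
  have ac: "AC_curve sup_norm C_b T \<eta>" using sol unfolding is_solution_def by blast
  show ?thesis
  proof (rule AC_curve_continuous_on[OF ac, of 1 0])
    fix s t assume st: "0 \<le> s" "s < t" "t \<le> T"
    obtain c d where cd: "\<And>z. z \<in> offdiag \<Longrightarrow> \<bar>\<eta> s z\<bar> \<le> c" "\<And>z. z \<in> offdiag \<Longrightarrow> \<bar>\<eta> t z\<bar> \<le> d"
      using C_b_bounded[OF sol_\<eta>(1)[of s]] C_b_bounded[OF sol_\<eta>(1)[of t]] st by (metis atLeastAtMost_iff less_imp_le order_trans)
    have "\<bar>(\<eta> t - \<eta> s) z\<bar> \<le> sup_norm (\<eta> t - \<eta> s)"
    proof (rule abs_le_sup_norm[OF _ z])
      fix z :: "'a \<times> 'a" assume "z \<in> offdiag"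
      then show "\<bar>(\<eta> t - \<eta> s) z\<bar> \<le> d + c" using cd[of z] by simp
    qed
    then show "\<bar>\<eta> t z - \<eta> s z\<bar> \<le> 1 * sup_norm (\<eta> t - \<eta> s) + 0 * (t - s)" by simp
  qed auto
qed

text \<open>Both sides are continuous in time, so the identity extends from almost every time to
  every time; \<open>relaxation_estimate\<close> differentiates it.\<close>

lemma sol_\<eta>_eq:
  assumes t: "t \<in> {0..T}" and z: "z \<in> offdiag"
  shows "\<eta> t z = \<eta> 0 z + (1/\<epsilon>) * integral {0..t} (\<lambda>s. \<omega> s (\<rho> s) z - \<eta> s z)"
proof (rule continuous_AE_eq_imp_eq[OF T sol_\<eta>_continuous[OF z] _ _ t])
  have cont: "continuous_on {0..T} (\<lambda>s. \<omega> s (\<rho> s) z - \<eta> s z)"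
    by (intro continuous_intros sol_\<eta>_continuous sol_\<omega>_continuous z)
  show "continuous_on {0..T} (\<lambda>t. \<eta> 0 z + (1/\<epsilon>) * integral {0..t} (\<lambda>s. \<omega> s (\<rho> s) z - \<eta> s z))"
    by (intro continuous_intros indefinite_integral_continuous_1 integrable_continuous_real cont)
  have "AE t in lebesgue. t \<in> {0..T} \<longrightarrow>
       (\<forall>z\<in>offdiag. \<eta> t z = \<eta> 0 z + (1/\<epsilon>) * (LINT s:{0..t}|lebesgue. \<omega> s (\<rho> s) z - \<eta> s z))"
    using sol unfolding is_solution_def by blast
  then show "AE t in lebesgue. t \<in> {0..T} \<longrightarrow> \<eta> t z = \<eta> 0 z + (1/\<epsilon>) * integral {0..t} (\<lambda>s. \<omega> s (\<rho> s) z - \<eta> s z)"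
  proof eventually_elim
    case (elim t)
    show ?case
    proof
      assume t: "t \<in> {0..T}"
      have "(LINT s:{0..t}|lebesgue. \<omega> s (\<rho> s) z - \<eta> s z) = integral {0..t} (\<lambda>s. \<omega> s (\<rho> s) z - \<eta> s z)"
        using t by (intro LINT_eq_integral absolutely_integrable_continuous_real continuous_on_subset[OF cont]) auto
      then show "\<eta> t z = \<eta> 0 z + (1/\<epsilon>) * integral {0..t} (\<lambda>s. \<omega> s (\<rho> s) z - \<eta> s z)"
        using elim t z by auto
    qed
  qed
qed

text \<open>Relaxation with centre 0, \<open>A\<close> equal to the bound of \<omega>, and
  \<open>\<Lambda> = 0\<close>. The result is independent of \<epsilon> and uses no regularity
  constant of the curve, which permits the Lipschitz bound below to rely on it.\<close>

lemma sol_\<eta>_bound: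
  assumes t: "t \<in> {0..T}" and z: "z \<in> offdiag"
  shows "\<bar>\<eta> t z\<bar> \<le> \<bar>\<eta> 0 z\<bar> + C\<^sub>\<omega>"
proof -
  have "\<bar>\<eta> t z - 0\<bar> \<le> \<bar>\<eta> 0 z\<bar> + C\<^sub>\<omega> + 0 * \<epsilon>"
  proof (rule relaxation_estimate[where a = "\<lambda>t. \<omega> t (\<rho> t) z" and u = "\<lambda>t. \<eta> t z" and t = t and \<epsilon> = \<epsilon>])
    show "continuous_on {0..t} (\<lambda>t. \<eta> t z)" "continuous_on {0..t} (\<lambda>t. \<omega> t (\<rho> t) z)"
      using t by (auto intro: continuous_on_subset[OF sol_\<eta>_continuous[OF z]] continuous_on_subset[OF sol_\<omega>_continuous[OF z]])
    show "\<eta> s z = \<eta> 0 z + (1/\<epsilon>) * integral {0..s} (\<lambda>r. \<omega> r (\<rho> r) z - \<eta> r z)" if "s \<in> {0..t}" for s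
      using that t by (intro sol_\<eta>_eq z) auto
    show "\<bar>\<omega> s (\<rho> s) z - 0\<bar> \<le> C\<^sub>\<omega> + 0 * (t - s)" if "s \<in> {0..t}" for s
      using that t \<omega>_bound[OF _ sol_\<rho>(1) z, of s s] by auto
  qed (use t \<epsilon> C\<^sub>\<omega> in auto)
  then show ?thesis by simp
qed

lemma sol_flow_integrable:
  assumes \<phi>: "\<phi> \<in> C_0" shows "(\<lambda>t. flow t (\<eta> t) (\<rho> t) \<phi>) absolutely_integrable_on {0..T}"
proof -
  have "(\<lambda>t. nl_div (flux \<Phi> \<mu> (\<eta> t) (\<rho> t) (V t (\<rho> t))) \<phi>) absolutely_integrable_on {0..T}"
    using sol \<phi> unfolding is_solution_def continuity_eq_def by blast
  \<comment> \<open>The factor undoes the \<open>- (1/2)\<close> in the divergence.\<close>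
  then have "(\<lambda>t. (-2) *\<^sub>R nl_div (flux \<Phi> \<mu> (\<eta> t) (\<rho> t) (V t (\<rho> t))) \<phi>) absolutely_integrable_on {0..T}"
    by (rule absolutely_integrable_scaleR_left)
  then show ?thesis by (simp add: nl_div_def)
qed

lemma sol_flow_integrable_sub:
  assumes \<phi>: "\<phi> \<in> C_0" and st: "0 \<le> s" "t \<le> T"
  shows "(\<lambda>t. flow t (\<eta> t) (\<rho> t) \<phi>) absolutely_integrable_on {s..t}"
    "(\<lambda>t. flow t (\<eta> t) (\<rho> t) \<phi>) integrable_on {s..t}"
proof -
  show "(\<lambda>t. flow t (\<eta> t) (\<rho> t) \<phi>) absolutely_integrable_on {s..t}"
    using st by (intro set_integrable_subset[OF sol_flow_integrable[OF \<phi>]]) auto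
  then show "(\<lambda>t. flow t (\<eta> t) (\<rho> t) \<phi>) integrable_on {s..t}"
    using absolutely_integrable_on_def by blast
qed

lemma sol_\<rho>_eq:
  assumes t: "t \<in> {0..T}" and \<phi>: "\<phi> \<in> C_0"
  shows "sintegral (\<rho> t) \<phi> = sintegral (\<rho> 0) \<phi> + (1/2) * integral {0..t} (\<lambda>s. flow s (\<eta> s) (\<rho> s) \<phi>)"
proof (rule continuous_AE_eq_imp_eq[OF T sol_sintegral_continuous[OF \<phi>] _ _ t])
  show "continuous_on {0..T} (\<lambda>t. sintegral (\<rho> 0) \<phi> + (1/2) * integral {0..t} (\<lambda>s. flow s (\<eta> s) (\<rho> s) \<phi>))"
    by (intro continuous_intros indefinite_integral_continuous_1 sol_flow_integrable_sub \<phi>) auto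
  have "AE t in lebesgue. t \<in> {0..T} \<longrightarrow> sintegral (\<rho> t) \<phi> = sintegral (\<rho> 0) \<phi> +
             (1/2) * (LINT s:{0..t}|lebesgue. flow s (\<eta> s) (\<rho> s) \<phi>)"
    using sol \<phi> unfolding is_solution_def continuity_eq_def by blast
  then show "AE t in lebesgue. t \<in> {0..T} \<longrightarrow> sintegral (\<rho> t) \<phi> =
      sintegral (\<rho> 0) \<phi> + (1/2) * integral {0..t} (\<lambda>s. flow s (\<eta> s) (\<rho> s) \<phi>)"
    by eventually_elim (auto simp: LINT_eq_integral sol_flow_integrable_sub \<phi>)
qed

text \<open>Half of the bound \<open>flow_le\<close> for test functions bounded by 1, made a norm
  bound by duality. The constant depends on the solution through \<open>K\<close> only.\<close>

lemma sol_\<rho>_lipschitz: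
  assumes K: "\<And>t z. t \<in> {0..T} \<Longrightarrow> z \<in> offdiag \<Longrightarrow> \<bar>\<eta> t z\<bar> \<le> K" "0 \<le> K"
    and st: "0 \<le> s" "s \<le> t" "t \<le> T"
  shows "tv_norm (\<rho> t - \<rho> s) \<le> 2 * L * C\<^sub>V * M * K * (t - s)"
proof (rule tv_norm_le_duality)
  show "\<rho> t - \<rho> s \<in> M_TV" using st by (intro M_TV_diff sol_\<rho>) auto
  fix \<phi> :: "'a \<Rightarrow> real" assume \<phi>: "\<phi> \<in> C_0" "\<And>x. \<bar>\<phi> x\<bar> \<le> 1"
  let ?G = "\<lambda>s. flow s (\<eta> s) (\<rho> s) \<phi>"
  have "sintegral (\<rho> t - \<rho> s) \<phi> = sintegral (\<rho> t) \<phi> - sintegral (\<rho> s) \<phi>"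
    using st by (intro sintegral_diff[where B = 1] sol_\<rho> C_0_measurable \<phi>) auto
  also have "\<dots> = (1/2) * (integral {0..t} ?G - integral {0..s} ?G)"
    using st sol_\<rho>_eq[of t \<phi>] sol_\<rho>_eq[of s \<phi>] \<phi> by (simp add: right_diff_distrib)
  also have "integral {0..t} ?G - integral {0..s} ?G = integral {s..t} ?G"
    using st Henstock_Kurzweil_Integration.integral_combine[of 0 s t ?G] sol_flow_integrable_sub(2)[OF \<phi>(1), of 0 t] by simp
  also have "(1/2) * integral {s..t} ?G \<le> (1/2) * integral {s..t} (\<lambda>r. 4 * 1 * L * C\<^sub>V * M * K)"
  proof -
    have "\<bar>integral {s..t} ?G\<bar> \<le> integral {s..t} (\<lambda>r. 4 * 1 * L * C\<^sub>V * M * K)"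
      using st K by (intro integral_abs_le_integral flow_le sol_flow_integrable_sub sol_\<rho> sol_\<eta> \<phi>) auto
    then show ?thesis by linarith
  qed
  also have "\<dots> = 2 * L * C\<^sub>V * M * K * (t - s)"
    using st by simp
  finally show "sintegral (\<rho> t - \<rho> s) \<phi> \<le> 2 * L * C\<^sub>V * M * K * (t - s)" .
qed

text \<open>The centre is the value of the moving target at the final time \<open>t\<close>, with
  \<open>A = 0\<close>; at time \<open>s\<close> the target is within
  \<open>?\<Lambda> * (t - s)\<close> of it. The exponential weight of the past reduces this drift
  to a multiple of \<epsilon>.\<close>

lemma sol_relaxation:
  assumes K: "\<And>t z. t \<in> {0..T} \<Longrightarrow> z \<in> offdiag \<Longrightarrow> \<bar>\<eta> t z\<bar> \<le> K" "0 \<le> K"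
    and \<delta>: "\<bar>\<eta> 0 z - \<omega> 0 (\<rho> 0) z\<bar> \<le> \<delta>"
    and t: "t \<in> {0..T}" and z: "z \<in> offdiag"
  shows "\<bar>\<eta> t z - \<omega> t (\<rho> t) z\<bar> \<le> \<delta> + (L\<^sub>\<omega> * (2 * L * C\<^sub>V * M * K) + C'\<^sub>\<omega>) * \<epsilon>"
proof -
  let ?\<Lambda> = "L\<^sub>\<omega> * (2 * L * C\<^sub>V * M * K) + C'\<^sub>\<omega>"
  have lip: "\<bar>\<omega> t (\<rho> t) z - \<omega> s (\<rho> s) z\<bar> \<le> ?\<Lambda> * (t - s)" if s: "s \<in> {0..t}" for s
  proof -
    have "\<bar>\<omega> t (\<rho> t) z - \<omega> s (\<rho> s) z\<bar> \<le> L\<^sub>\<omega> * tv_norm (\<rho> t - \<rho> s) + C'\<^sub>\<omega> * (t - s)"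
      using s t by (intro sol_\<omega>_step z) auto
    also have "\<dots> \<le> L\<^sub>\<omega> * (2 * L * C\<^sub>V * M * K * (t - s)) + C'\<^sub>\<omega> * (t - s)"
      using s t by (intro add_mono mult_left_mono sol_\<rho>_lipschitz K L\<^sub>\<omega>) (auto simp: C'\<^sub>\<omega>)
    finally show ?thesis by (simp add: algebra_simps)
  qed
  have "\<bar>\<eta> t z - \<omega> t (\<rho> t) z\<bar> \<le> \<delta> + 0 + ?\<Lambda> * \<epsilon>"
  proof (rule relaxation_estimate[where a = "\<lambda>t. \<omega> t (\<rho> t) z" and u = "\<lambda>t. \<eta> t z" and t = t and \<epsilon> = \<epsilon>])
    show "continuous_on {0..t} (\<lambda>t. \<eta> t z)" "continuous_on {0..t} (\<lambda>t. \<omega> t (\<rho> t) z)"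
      using t by (auto intro: continuous_on_subset[OF sol_\<eta>_continuous[OF z]] continuous_on_subset[OF sol_\<omega>_continuous[OF z]])
    show "\<eta> s z = \<eta> 0 z + (1/\<epsilon>) * integral {0..s} (\<lambda>r. \<omega> r (\<rho> r) z - \<eta> r z)" if "s \<in> {0..t}" for s
      using that t by (intro sol_\<eta>_eq z) auto
    show "\<bar>\<omega> s (\<rho> s) z - \<omega> t (\<rho> t) z\<bar> \<le> 0 + ?\<Lambda> * (t - s)" if "s \<in> {0..t}" for s
      using lip[OF that] by (simp add: abs_minus_commute)
    show "\<bar>\<eta> 0 z - \<omega> t (\<rho> t) z\<bar> \<le> 0 + ?\<Lambda> * t + \<delta>"
      using lip[of 0] t \<delta> by auto
    show "0 \<le> ?\<Lambda>" using L\<^sub>\<omega> L C\<^sub>V M K(2) C'\<^sub>\<omega> by simp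
    show "0 \<le> \<delta>" using \<delta> by linarith
  qed (use t \<epsilon> in auto)
  then show ?thesis by simp
qed

end

section \<open>Stability and passage to the limit\<close>

lemma solutions_compare:
  assumes sol: "solution \<epsilon> \<rho> \<eta>" "0 < \<epsilon>" and sol': "solution \<epsilon>' \<rho>' \<eta>'" "0 < \<epsilon>'"
    and K: "\<And>t z. t \<in> {0..T} \<Longrightarrow> z \<in> offdiag \<Longrightarrow> \<bar>\<eta> t z\<bar> \<le> K"
      "\<And>t z. t \<in> {0..T} \<Longrightarrow> z \<in> offdiag \<Longrightarrow> \<bar>\<eta>' t z\<bar> \<le> K" "0 \<le> K"
    and e: "\<And>t z. t \<in> {0..T} \<Longrightarrow> z \<in> offdiag \<Longrightarrow> \<bar>\<eta> t z - \<omega> t (\<rho> t) z\<bar> \<le> e"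
      "\<And>t z. t \<in> {0..T} \<Longrightarrow> z \<in> offdiag \<Longrightarrow> \<bar>\<eta>' t z - \<omega> t (\<rho>' t) z\<bar> \<le> e'" "0 \<le> e" "0 \<le> e'"
    and t: "t \<in> {0..T}"
  shows "tv_norm (\<rho> t - \<rho>' t) \<le> (tv_norm (\<rho> 0 - \<rho>' 0) + 2 * L * C\<^sub>V * M * T * (e + e')) *
    exp (2 * L * (K * (C\<^sub>V + L\<^sub>V * M) + C\<^sub>V * M * L\<^sub>\<omega>) * T)"
proof -
  \<comment> \<open>\<open>A\<close> and \<open>D\<close> carry the factor 2 instead of the 4 of
    \<open>flow_diff_le\<close>, because of the one half in the equation.\<close>
  define A where "A = 2 * L * (K * (C\<^sub>V + L\<^sub>V * M) + C\<^sub>V * M * L\<^sub>\<omega>)"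
  define D where "D = 2 * L * C\<^sub>V * M * (e + e')"
  define u where "u t = tv_norm (\<rho> t - \<rho>' t)" for t
  have A: "0 \<le> A" and D: "0 \<le> D"
    using L K C\<^sub>V L\<^sub>V M L\<^sub>\<omega> e by (simp_all add: A_def D_def)
  note \<rho> = sol_\<rho>[OF sol] and \<rho>' = sol_\<rho>[OF sol'] and \<eta> = sol_\<eta>[OF sol] and \<eta>' = sol_\<eta>[OF sol']
  have u_cont: "continuous_on {0..T} u"
  proof (rule lipschitz_continuous_on_Icc)
    fix s t assume st: "0 \<le> s" "s \<le> t" "t \<le> T"
    have TV: "\<rho> s \<in> M_TV" "\<rho> t \<in> M_TV" "\<rho>' s \<in> M_TV" "\<rho>' t \<in> M_TV"
      using st \<rho>(2) \<rho>'(2) by auto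
    have "tv_norm (\<rho> t - \<rho> s) \<le> 2 * L * C\<^sub>V * M * K * (t - s)" "tv_norm (\<rho>' t - \<rho>' s) \<le> 2 * L * C\<^sub>V * M * K * (t - s)"
      using sol_\<rho>_lipschitz[OF sol K(1,3) st] sol_\<rho>_lipschitz[OF sol' K(2,3) st] by auto
    moreover have "u t \<le> tv_norm (\<rho> t - \<rho> s) + (u s + tv_norm (\<rho>' s - \<rho>' t))"
      unfolding u_def using tv_norm_triangle2[OF TV(2,1,4)] tv_norm_triangle2[OF TV(1,3,4)] by linarith
    moreover have "u s \<le> tv_norm (\<rho> s - \<rho> t) + (u t + tv_norm (\<rho>' t - \<rho>' s))"
      unfolding u_def using tv_norm_triangle2[OF TV(1,2,3)] tv_norm_triangle2[OF TV(2,4,3)] by linarith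
    ultimately show "\<bar>u t - u s\<bar> \<le> (4 * L * C\<^sub>V * M * K) * (t - s)"
      using tv_norm_minus_commute[OF TV(1,2)] tv_norm_minus_commute[OF TV(3,4)] by (simp add: abs_le_iff)
  qed
  have u_int: "u integrable_on {0..t}" if "t \<in> {0..T}" for t
    using that by (intro integrable_continuous_real continuous_on_subset[OF u_cont]) auto
  have ineq: "u t \<le> (u 0 + D * T) + A * integral {0..t} u" if t: "t \<in> {0..T}" for t
    unfolding u_def[of t]
  proof (rule tv_norm_le_duality)
    show "\<rho> t - \<rho>' t \<in> M_TV" by (intro M_TV_diff \<rho> \<rho>' t)
    fix \<phi> :: "'a \<Rightarrow> real" assume \<phi>: "\<phi> \<in> C_0" "\<And>x. \<bar>\<phi> x\<bar> \<le> 1"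
    let ?G = "\<lambda>s. flow s (\<eta> s) (\<rho> s) \<phi>" and ?G' = "\<lambda>s. flow s (\<eta>' s) (\<rho>' s) \<phi>"
    have G: "?G integrable_on {0..t}" "?G' integrable_on {0..t}"
      using t sol_flow_integrable_sub(2)[OF sol \<phi>(1)] sol_flow_integrable_sub(2)[OF sol' \<phi>(1)] by auto
    have diff: "sintegral (\<rho> s - \<rho>' s) \<phi> = sintegral (\<rho> s) \<phi> - sintegral (\<rho>' s) \<phi>" if "s \<in> {0..T}" for s
      using that by (intro sintegral_diff[where B = 1] \<rho> \<rho>' C_0_measurable \<phi>)
    have "sintegral (\<rho> t - \<rho>' t) \<phi> = sintegral (\<rho> 0 - \<rho>' 0) \<phi> + (1/2) * integral {0..t} (\<lambda>s. ?G s - ?G' s)"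
      using t T diff[of t] diff[of 0] sol_\<rho>_eq[OF sol t \<phi>(1)] sol_\<rho>_eq[OF sol' t \<phi>(1)]
      by (simp add: Henstock_Kurzweil_Integration.integral_diff[OF G] right_diff_distrib)
    moreover have "sintegral (\<rho> 0 - \<rho>' 0) \<phi> \<le> u 0"
      using abs_sintegral_le[of "\<rho> 0 - \<rho>' 0" \<phi> 1] \<phi> T \<rho>(2)[of 0] \<rho>'(2)[of 0]
      by (simp add: u_def M_TV_diff C_0_measurable abs_le_iff)
    moreover    have "\<bar>integral {0..t} (\<lambda>s. ?G s - ?G' s)\<bar> \<le> integral {0..t} (\<lambda>s. 2 * D + 2 * A * u s)"
      proof (rule integral_abs_le_integral)
        show "(\<lambda>s. ?G s - ?G' s) integrable_on {0..t}" by (intro integrable_diff G)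
        show "(\<lambda>s. 2 * D + 2 * A * u s) integrable_on {0..t}"
          by (intro integrable_continuous_real continuous_intros continuous_on_subset[OF u_cont]) (use t in auto)
        fix s assume "s \<in> {0..t}"
        then have s: "s \<in> {0..T}" using t by auto
        have "\<bar>?G s - ?G' s\<bar> \<le> 4 * 1 * L * (K * (C\<^sub>V + L\<^sub>V * M) * tv_norm (\<rho> s - \<rho>' s) + C\<^sub>V * M * (e + e' + L\<^sub>\<omega> * u s))"
        proof (rule flow_diff_le)
          fix z :: "'a \<times> 'a" assume z: "z \<in> offdiag"
          \<comment> \<open>Each \<eta> is replaced by \<omega> along its own curve at the cost of
            its defect; what remains is controlled by the distance \<open>u s\<close> itself, as
            Gronwall requires.\<close>
          have "\<bar>\<omega> s (\<rho> s) z - \<omega> s (\<rho>' s) z\<bar> \<le> L\<^sub>\<omega> * u s"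
            unfolding u_def by (intro \<omega>_lipschitz \<rho> \<rho>' s z)
          then show "\<bar>\<eta> s z - \<eta>' s z\<bar> \<le> e + e' + L\<^sub>\<omega> * u s"
            using e(1)[OF s z] e(2)[OF s z] by linarith
        qed (use s K e L\<^sub>\<omega> \<phi> \<rho> \<rho>' \<eta> \<eta>' in \<open>auto simp: u_def\<close>)
        also have "\<dots> = 2 * D + 2 * A * u s"
          by (simp add: u_def A_def D_def algebra_simps)
        finally show "\<bar>?G s - ?G' s\<bar> \<le> 2 * D + 2 * A * u s" .
      qed
    moreover have "integral {0..t} (\<lambda>s. 2 * D + 2 * A * u s) = 2 * D * t + 2 * A * integral {0..t} u"
      using t u_int[OF t] by (subst Henstock_Kurzweil_Integration.integral_add) (auto intro: integrable_on_mult_right)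
    moreover have "D * t \<le> D * T"
      using t D by (simp add: mult_left_mono)
    ultimately show "sintegral (\<rho> t - \<rho>' t) \<phi> \<le> (u 0 + D * T) + A * integral {0..t} u"
      by linarith
  qed
  have "u t \<le> (u 0 + D * T) * exp (A * t)"
    by (rule gronwall[OF u_cont A ineq t])
  also have "\<dots> \<le> (u 0 + D * T) * exp (A * T)"
    using t A D T by (intro mult_left_mono) (auto simp: u_def mult_left_mono)
  finally show ?thesis by (simp add: u_def A_def D_def mult_ac)
qed

text \<open>The comparison bound splits into a term for \<open>n\<close> and a term for
  \<open>m\<close>, both uniform in time, so the whole sequence converges without extracting a
  subsequence.\<close>

lemma solutions_converge:
  fixes \<epsilon> :: "nat \<Rightarrow> real" and \<rho>n :: "nat \<Rightarrow> real \<Rightarrow> 'a smeasure" and \<eta>n :: "nat \<Rightarrow> real \<Rightarrow> 'a \<times> 'a \<Rightarrow> real"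
  assumes \<rho>\<^sub>0: "\<rho>\<^sub>0 \<in> M_TV_ball M" and \<epsilon>_pos: "\<And>n. 0 < \<epsilon> n" and \<epsilon>_lim: "\<epsilon> \<longlonglongrightarrow> 0"
    and sol: "\<And>n. solution (\<epsilon> n) (\<rho>n n) (\<eta>n n)"
    and \<rho>_init: "(\<lambda>n. tv_norm (\<rho>n n 0 - \<rho>\<^sub>0)) \<longlonglongrightarrow> 0"
    and \<eta>_init: "(\<lambda>n. sup_norm (\<eta>n n 0 - \<omega> 0 (\<rho>n n 0))) \<longlonglongrightarrow> 0"
  shows "\<exists>\<rho>. AC_curve tv_norm (M_TV_ball M) T \<rho> \<and> \<rho> 0 = \<rho>\<^sub>0 \<and>
           continuity_eq T \<Phi> \<mu> V (\<lambda>t. \<omega> t (\<rho> t)) \<rho> \<rho>\<^sub>0 \<and>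
           (\<lambda>n. d_inf T (\<rho>n n, \<eta>n n) (\<rho>, \<lambda>t. \<omega> t (\<rho> t))) \<longlonglongrightarrow> 0"
proof -
  have T0: "0 \<in> {0..T}" using T by simp
  note sol_ball = sol_\<rho>(1)[OF sol \<epsilon>_pos] and sol_TV = sol_\<rho>(2)[OF sol \<epsilon>_pos]
  define a where "a n = sup_norm (\<eta>n n 0 - \<omega> 0 (\<rho>n n 0))" for n
  have a: "\<bar>\<eta>n n 0 z - \<omega> 0 (\<rho>n n 0) z\<bar> \<le> a n" if z: "z \<in> offdiag" for n z
  proof -
    obtain c where c: "\<And>z. z \<in> offdiag \<Longrightarrow> \<bar>\<eta>n n 0 z\<bar> \<le> c"
      using C_b_bounded[OF sol_\<eta>(1)[OF sol \<epsilon>_pos T0]] by metis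
    have "\<bar>(\<eta>n n 0 - \<omega> 0 (\<rho>n n 0)) z\<bar> \<le> a n"
      unfolding a_def
    proof (rule abs_le_sup_norm[OF _ z])
      fix z :: "'a \<times> 'a" assume "z \<in> offdiag"
      then show "\<bar>(\<eta>n n 0 - \<omega> 0 (\<rho>n n 0)) z\<bar> \<le> c + C\<^sub>\<omega>"
        using c[of z] \<omega>_bound[OF T0 sol_ball[OF T0], of z n] by simp
    qed
    then show ?thesis by simp
  qed
  have a0: "0 \<le> a n" for n
    using a offdiag_nonempty abs_ge_zero order_trans by (metis all_not_in_conv)
  have "Bseq a" using \<eta>_init unfolding a_def[abs_def] by (intro convergent_imp_Bseq convergentI)
  then obtain b where b: "\<And>n. a n \<le> b"
    unfolding Bseq_def by (metis abs_ge_self order_trans real_norm_def)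
  \<comment> \<open>The initial value is within \<open>a n\<close> of a quantity bounded by
    \<open>C\<^sub>\<omega>\<close>, and \<open>sol_\<eta>_bound\<close> adds
    \<open>C\<^sub>\<omega>\<close> once more.\<close>
  define K where "K = b + 2 * C\<^sub>\<omega>"
  have K0: "0 \<le> K" using b[of 0] a0[of 0] C\<^sub>\<omega> by (simp add: K_def)
  have K: "\<bar>\<eta>n n t z\<bar> \<le> K" if t: "t \<in> {0..T}" and z: "z \<in> offdiag" for n t z
    using sol_\<eta>_bound[OF sol \<epsilon>_pos t z, of n] a[OF z, of n] b[of n] \<omega>_bound[OF T0 sol_ball[OF T0] z, of n]
    unfolding K_def by linarith
  define \<Lambda> where "\<Lambda> = 2 * L * C\<^sub>V * M * K"
  have \<Lambda>0: "0 \<le> \<Lambda>" using L C\<^sub>V M K0 by (simp add: \<Lambda>_def)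
  define e where "e n = a n + (L\<^sub>\<omega> * \<Lambda> + C'\<^sub>\<omega>) * \<epsilon> n" for n
  have e0: "0 \<le> e n" for n
    using a0[of n] \<epsilon>_pos[of n] \<Lambda>0 L\<^sub>\<omega> C'\<^sub>\<omega> by (simp add: e_def)
  have e: "\<bar>\<eta>n n t z - \<omega> t (\<rho>n n t) z\<bar> \<le> e n" if t: "t \<in> {0..T}" and z: "z \<in> offdiag" for n t z
    unfolding e_def \<Lambda>_def by (rule sol_relaxation[OF sol \<epsilon>_pos K K0 a[OF z] t z])
  have "a \<longlonglongrightarrow> 0" using \<eta>_init unfolding a_def[abs_def] .
  then have e_lim: "e \<longlonglongrightarrow> 0"
    using tendsto_add[OF _ tendsto_mult_left[OF \<epsilon>_lim], of a 0 "L\<^sub>\<omega> * \<Lambda> + C'\<^sub>\<omega>"]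
    by (simp add: e_def[abs_def])
  define E where "E = exp (2 * L * (K * (C\<^sub>V + L\<^sub>V * M) + C\<^sub>V * M * L\<^sub>\<omega>) * T)"
  \<comment> \<open>The share of solution \<open>n\<close> in the comparison bound: the initial
    distance is split through \<open>\<rho>\<^sub>0\<close>, and the defects already enter
    additively.\<close>
  define B where "B n = (tv_norm (\<rho>n n 0 - \<rho>\<^sub>0) + 2 * L * C\<^sub>V * M * T * e n) * E" for n
  have B_lim: "B \<longlonglongrightarrow> 0"
    using tendsto_mult_right[OF tendsto_add[OF \<rho>_init tendsto_mult_left[OF e_lim, of "2 * L * C\<^sub>V * M * T"]], of E]
    by (simp add: B_def[abs_def])
  have \<rho>\<^sub>0_TV: "\<rho>\<^sub>0 \<in> M_TV" using \<rho>\<^sub>0 by (simp add: M_TV_ball_def)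
  have Cauchy: "tv_norm (\<rho>n n t - \<rho>n m t) \<le> B n + B m" if t: "t \<in> {0..T}" for n m t
  proof -
    have "tv_norm (\<rho>n n t - \<rho>n m t) \<le> (tv_norm (\<rho>n n 0 - \<rho>n m 0) + 2 * L * C\<^sub>V * M * T * (e n + e m)) * E"
      unfolding E_def by (rule solutions_compare[OF sol \<epsilon>_pos sol \<epsilon>_pos K K K0 e e e0 e0 t])
    also have "\<dots> \<le> (tv_norm (\<rho>n n 0 - \<rho>\<^sub>0) + tv_norm (\<rho>n m 0 - \<rho>\<^sub>0) + 2 * L * C\<^sub>V * M * T * (e n + e m)) * E"
      using tv_norm_triangle2[OF sol_TV[OF T0] \<rho>\<^sub>0_TV sol_TV[OF T0], of n m]
        tv_norm_minus_commute[OF sol_TV[OF T0] \<rho>\<^sub>0_TV, of m]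
      by (intro mult_right_mono) (auto simp: E_def)
    also have "\<dots> = B n + B m" by (simp add: B_def algebra_simps)
    finally show ?thesis .
  qed
  \<comment> \<open>The limit is taken set by set, where completeness of the reals suffices;
    \<open>M_TV_limit\<close> then gives convergence in norm.\<close>
  define \<rho> where "\<rho> t A = lim (\<lambda>n. \<rho>n n t A)" for t A
  have \<rho>_lim: "(\<lambda>n. \<rho>n n t A) \<longlonglongrightarrow> \<rho> t A" if t: "t \<in> {0..T}" for t A
  proof -
    have "Cauchy (\<lambda>n. \<rho>n n t A)"
    proof (rule metric_CauchyI)
      fix r :: real assume "0 < r"
      then obtain N where N: "\<forall>n\<ge>N. norm (B n - 0) < r / 2" using LIMSEQ_D[OF B_lim, of "r / 2"] by auto
      have "dist (\<rho>n m t A) (\<rho>n n t A) < r" if "m \<ge> N" "n \<ge> N" for m n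
      proof -
        have "\<bar>(\<rho>n m t - \<rho>n n t) A\<bar> \<le> B m + B n"
          using M_TV_abs_le_tv_norm[OF M_TV_diff[OF sol_TV[OF t] sol_TV[OF t]]] Cauchy[OF t] order_trans by blast
        moreover have "\<bar>B m\<bar> < r / 2" "\<bar>B n\<bar> < r / 2" using N that by auto
        ultimately show ?thesis by (simp add: dist_real_def)
      qed
      then show "\<exists>N. \<forall>m\<ge>N. \<forall>n\<ge>N. dist (\<rho>n m t A) (\<rho>n n t A) < r" by blast
    qed
    then show ?thesis
      unfolding \<rho>_def by (simp add: Cauchy_convergent_iff convergent_LIMSEQ_iff)
  qed
  have \<rho>_TV: "\<rho> t \<in> M_TV" and \<rho>_conv: "tv_norm (\<rho>n n t - \<rho> t) \<le> 2 * B n" if t: "t \<in> {0..T}" for t n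
    using M_TV_limit[of "\<lambda>n. \<rho>n n t" B "\<rho> t"] sol_TV[OF t] Cauchy[OF t] B_lim \<rho>_lim[OF t] by auto
  have B2_lim: "(\<lambda>n. 2 * B n) \<longlonglongrightarrow> 0" using tendsto_mult_left[OF B_lim, of 2] by simp
  have \<rho>_ball: "\<rho> t \<in> M_TV_ball M" if t: "t \<in> {0..T}" for t
  proof -
    have "tv_norm (\<rho> t) \<le> M"
    proof (rule LIMSEQ_le_const)
      show "(\<lambda>n. 2 * B n + M) \<longlonglongrightarrow> M" using tendsto_add[OF B2_lim tendsto_const, of M] by simp
      have "tv_norm (\<rho> t) \<le> 2 * B n + M" for n
        using tv_norm_triangle[OF \<rho>_TV[OF t] sol_TV[OF t], of n] \<rho>_conv[OF t, of n]
          tv_norm_minus_commute[OF \<rho>_TV[OF t] sol_TV[OF t], of n] sol_ball[OF t, of n]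
        by (simp add: M_TV_ball_def)
      then show "\<exists>N. \<forall>n\<ge>N. tv_norm (\<rho> t) \<le> 2 * B n + M" by blast
    qed
    then show ?thesis using \<rho>_TV[OF t] by (simp add: M_TV_ball_def)
  qed
  have \<rho>_0: "\<rho> 0 = \<rho>\<^sub>0"
  proof
    fix A
    have "\<bar>\<rho>n n 0 A - \<rho>\<^sub>0 A\<bar> \<le> tv_norm (\<rho>n n 0 - \<rho>\<^sub>0)" for n
      using M_TV_abs_le_tv_norm[OF M_TV_diff[OF sol_TV[OF T0] \<rho>\<^sub>0_TV], of n A] by simp
    then have "(\<lambda>n. \<rho>n n 0 A - \<rho>\<^sub>0 A) \<longlonglongrightarrow> 0"
      by (intro Lim_null_comparison[OF _ \<rho>_init]) simp
    then have "(\<lambda>n. \<rho>n n 0 A) \<longlonglongrightarrow> \<rho>\<^sub>0 A" by (simp add: LIM_zero_iff)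
    then show "\<rho> 0 A = \<rho>\<^sub>0 A" using \<rho>_lim[OF T0] LIMSEQ_unique by blast
  qed
  \<comment> \<open>The common constant \<open>\<Lambda>\<close> survives the limit and serves as a
    constant modulus of absolute continuity.\<close>
  have \<rho>_lip: "tv_norm (\<rho> t - \<rho> s) \<le> \<Lambda> * (t - s)" if st: "0 \<le> s" "s \<le> t" "t \<le> T" for s t
  proof (rule LIMSEQ_le_const)
    have s: "s \<in> {0..T}" and t: "t \<in> {0..T}" using st by auto
    show "(\<lambda>n. 2 * B n + (\<Lambda> * (t - s) + 2 * B n)) \<longlonglongrightarrow> \<Lambda> * (t - s)"
      using tendsto_add[OF B2_lim tendsto_add[OF tendsto_const B2_lim], of "\<Lambda> * (t - s)"] by simp
    have "tv_norm (\<rho> t - \<rho> s) \<le> 2 * B n + (\<Lambda> * (t - s) + 2 * B n)" for n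
      using tv_norm_triangle2[OF \<rho>_TV[OF t] sol_TV[OF t, of n] \<rho>_TV[OF s]]
        tv_norm_triangle2[OF sol_TV[OF t, of n] sol_TV[OF s, of n] \<rho>_TV[OF s]]
        \<rho>_conv[OF t, of n] \<rho>_conv[OF s, of n] tv_norm_minus_commute[OF \<rho>_TV[OF t] sol_TV[OF t], of n]
        sol_\<rho>_lipschitz[OF sol \<epsilon>_pos K K0 st, of n]
      unfolding \<Lambda>_def by linarith
    then show "\<exists>N. \<forall>n\<ge>N. tv_norm (\<rho> t - \<rho> s) \<le> 2 * B n + (\<Lambda> * (t - s) + 2 * B n)" by blast
  qed
  have AC: "AC_curve tv_norm (M_TV_ball M) T \<rho>"
    unfolding AC_curve_def
  proof (intro conjI ballI exI[of _ "\<lambda>_. \<Lambda>"] allI impI)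
    show "(\<lambda>_. \<Lambda>) absolutely_integrable_on {0..T}" by (intro absolutely_integrable_continuous_real continuous_intros)
    fix s t assume st: "0 \<le> s \<and> s < t \<and> t \<le> T"
    have "(LINT r:{s..t}|lebesgue. \<Lambda>) = integral {s..t} (\<lambda>_. \<Lambda>)"
      by (intro LINT_eq_integral absolutely_integrable_continuous_real continuous_intros)
    also have "\<dots> = \<Lambda> * (t - s)" using st by simp
    finally show "tv_norm (\<rho> t - \<rho> s) \<le> (LINT r:{s..t}|lebesgue. \<Lambda>)" using \<rho>_lip[of s t] st by simp
  qed (rule \<rho>_ball)
  have \<eta>_conv: "\<bar>\<eta>n n t z - \<omega> t (\<rho> t) z\<bar> \<le> e n + L\<^sub>\<omega> * (2 * B n)" if t: "t \<in> {0..T}" and z: "z \<in> offdiag" for n t z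
  proof -
    have "\<bar>\<omega> t (\<rho>n n t) z - \<omega> t (\<rho> t) z\<bar> \<le> L\<^sub>\<omega> * tv_norm (\<rho>n n t - \<rho> t)"
      by (intro \<omega>_lipschitz t z \<rho>_ball sol_ball)
    also have "\<dots> \<le> L\<^sub>\<omega> * (2 * B n)" by (intro mult_left_mono \<rho>_conv t L\<^sub>\<omega>)
    finally show ?thesis using e[OF t z, of n] by linarith
  qed
  have eB_lim: "(\<lambda>n. e n + L\<^sub>\<omega> * (2 * B n)) \<longlonglongrightarrow> 0"
    using tendsto_add[OF e_lim tendsto_mult_left[OF B2_lim, of L\<^sub>\<omega>]] by simp
  have d_lim: "(\<lambda>n. d_inf T (\<rho>n n, \<eta>n n) (\<rho>, \<lambda>t. \<omega> t (\<rho> t))) \<longlonglongrightarrow> 0"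
  proof (rule tendsto_sandwich[where f = "\<lambda>_. 0"])
    \<comment> \<open>The bounds on the right depend neither on the time nor on the point, so they
      pass to both suprema.\<close>
    have "d_inf T (\<rho>n n, \<eta>n n) (\<rho>, \<lambda>t. \<omega> t (\<rho> t)) \<le> ennreal (2 * B n) + ennreal (e n + L\<^sub>\<omega> * (2 * B n))" for n
      unfolding d_inf_def case_prod_conv
      by (intro add_mono SUP_least ennreal_leI \<rho>_conv sup_norm_le) (auto simp: \<eta>_conv)
    then show "\<forall>\<^sub>F n in sequentially. d_inf T (\<rho>n n, \<eta>n n) (\<rho>, \<lambda>t. \<omega> t (\<rho> t)) \<le> ennreal (2 * B n) + ennreal (e n + L\<^sub>\<omega> * (2 * B n))"
      by simp
    show "(\<lambda>n. ennreal (2 * B n) + ennreal (e n + L\<^sub>\<omega> * (2 * B n))) \<longlonglongrightarrow> 0"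
      using tendsto_add[OF tendsto_ennrealI[OF B2_lim] tendsto_ennrealI[OF eB_lim]] by simp
  qed auto
  have cont: "continuity_eq T \<Phi> \<mu> V (\<lambda>t. \<omega> t (\<rho> t)) \<rho> \<rho>\<^sub>0"
    unfolding continuity_eq_def
  proof (intro ballI conjI)
    fix \<phi> :: "'a \<Rightarrow> real" assume \<phi>: "\<phi> \<in> C_0"
    obtain c where c: "\<And>x. \<bar>\<phi> x\<bar> \<le> c" using C_0_bounded[OF \<phi>] by metis
    let ?G = "\<lambda>s. flow s (\<omega> s (\<rho> s)) (\<rho> s) \<phi>"
    let ?Gn = "\<lambda>n s. flow s (\<eta>n n s) (\<rho>n n s) \<phi>"
    have KC: "C\<^sub>\<omega> \<le> K" using b[of 0] a0[of 0] C\<^sub>\<omega> by (simp add: K_def)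
    \<comment> \<open>At a fixed time, \<open>flow_diff_le\<close> applies with the limit pair as
      the second argument; both of its error terms tend to 0.\<close>
    have G_lim: "(\<lambda>n. ?Gn n s) \<longlonglongrightarrow> ?G s" if s: "s \<in> {0..T}" for s
    proof (rule LIM_zero_cancel)
      have fd: "\<bar>?Gn n s - ?G s\<bar> \<le> 4 * c * L * (K * (C\<^sub>V + L\<^sub>V * M) * tv_norm (\<rho>n n s - \<rho> s) + C\<^sub>V * M * (e n + L\<^sub>\<omega> * (2 * B n)))" for n
      proof (rule flow_diff_le[OF s sol_ball[OF s] \<rho>_ball[OF s] _ _ K[OF s] _ \<eta>_conv[OF s]])
        show "continuous_on offdiag (\<eta>n n s)" by (rule sol_\<eta>(2)[OF sol \<epsilon>_pos s])
        show "continuous_on offdiag (\<omega> s (\<rho> s))" by (rule \<omega>_continuous[OF s \<rho>_ball[OF s]])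
        show "\<bar>\<omega> s (\<rho> s) z\<bar> \<le> K" if "z \<in> offdiag" for z
          using \<omega>_bound[OF s \<rho>_ball[OF s] that] KC by linarith
        show "0 \<le> e n + L\<^sub>\<omega> * (2 * B n)"
          using order_trans[OF abs_ge_zero \<eta>_conv[OF s]] offdiag_nonempty by blast
      qed (use \<phi> c K0 in auto)
      have "c \<ge> 0" using c abs_ge_zero order_trans by blast
      then have le: "norm (?Gn n s - ?G s) \<le> 4 * c * L * (K * (C\<^sub>V + L\<^sub>V * M) * (2 * B n) + C\<^sub>V * M * (e n + L\<^sub>\<omega> * (2 * B n)))" for n
        unfolding real_norm_def using L K0 C\<^sub>V L\<^sub>V M
        by (intro order_trans[OF fd] mult_left_mono add_mono order_refl \<rho>_conv[OF s]) auto
      show "(\<lambda>n. ?Gn n s - ?G s) \<longlonglongrightarrow> 0"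
      proof (rule Lim_null_comparison)
        show "\<forall>\<^sub>F n in sequentially. norm (?Gn n s - ?G s) \<le> 4 * c * L * (K * (C\<^sub>V + L\<^sub>V * M) * (2 * B n) + C\<^sub>V * M * (e n + L\<^sub>\<omega> * (2 * B n)))"
          using le by simp
        show "(\<lambda>n. 4 * c * L * (K * (C\<^sub>V + L\<^sub>V * M) * (2 * B n) + C\<^sub>V * M * (e n + L\<^sub>\<omega> * (2 * B n)))) \<longlonglongrightarrow> 0"
          using tendsto_mult_left[OF tendsto_add[OF tendsto_mult_left[OF B2_lim, of "K * (C\<^sub>V + L\<^sub>V * M)"]
              tendsto_mult_left[OF eB_lim, of "C\<^sub>V * M"]], of "4 * c * L"] by simp
      qed
    qed
    have Gn_le: "\<bar>?Gn n s\<bar> \<le> 4 * c * L * C\<^sub>V * M * K" if s: "s \<in> {0..T}" for n s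
      by (rule flow_le[OF s sol_ball[OF s] sol_\<eta>(2)[OF sol \<epsilon>_pos s] K[OF s] K0 \<phi> c])
    have G_le: "\<bar>?G s\<bar> \<le> 4 * c * L * C\<^sub>V * M * K" if s: "s \<in> {0..T}" for s
      by (rule LIMSEQ_le_const2[OF tendsto_rabs[OF G_lim[OF s]]]) (use Gn_le[OF s] in auto)
    \<comment> \<open>Measurability of \<open>?G\<close> in time comes from the functions
      \<open>?Gn n\<close>, whose integrability belongs to the notion of solution; the common bound
      dominates.\<close>
    have G_int: "?G absolutely_integrable_on {0..T}"
    proof (rule dominated_convergence_absolutely_integrable[where f = ?Gn])
      show "?Gn n absolutely_integrable_on {0..T}" for n by (rule sol_flow_integrable[OF sol \<epsilon>_pos \<phi>])
    qed (use G_le G_lim in auto)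
    then have "(\<lambda>t. (-1/2) *\<^sub>R ?G t) absolutely_integrable_on {0..T}"
      by (rule absolutely_integrable_scaleR_left)
    then show "(\<lambda>t. nl_div (flux \<Phi> \<mu> (\<omega> t (\<rho> t)) (\<rho> t) (V t (\<rho> t))) \<phi>) absolutely_integrable_on {0..T}"
      by (simp add: nl_div_def)
    have "sintegral (\<rho> t) \<phi> = sintegral \<rho>\<^sub>0 \<phi> + (1/2) * (LINT s:{0..t}|lebesgue. ?G s)" if t: "t \<in> {0..T}" for t
    proof (rule LIMSEQ_unique)
      have "?G absolutely_integrable_on {0..t}"
        using t by (intro set_integrable_subset[OF G_int]) auto
      then have LI: "(LINT s:{0..t}|lebesgue. ?G s) = integral {0..t} ?G" by (rule LINT_eq_integral)
      have lim\<phi>: "(\<lambda>n. sintegral (\<rho>n n s) \<phi>) \<longlonglongrightarrow> sintegral (\<rho> s) \<phi>" if s: "s \<in> {0..T}" for s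
      proof -
        have le: "\<bar>sintegral (\<rho>n n s) \<phi> - sintegral (\<rho> s) \<phi>\<bar> \<le> c * (2 * B n)" for n
        proof -
          have "c \<ge> 0" using c abs_ge_zero order_trans by blast
          have "\<bar>sintegral (\<rho>n n s - \<rho> s) \<phi>\<bar> \<le> c * tv_norm (\<rho>n n s - \<rho> s)"
            by (intro abs_sintegral_le M_TV_diff sol_TV \<rho>_TV s C_0_measurable \<phi> c)
          also have "\<dots> \<le> c * (2 * B n)" by (intro mult_left_mono \<rho>_conv s \<open>c \<ge> 0\<close>)
          finally show ?thesis
            using sintegral_diff[OF sol_TV[OF s] \<rho>_TV[OF s] C_0_measurable[OF \<phi>] c, of n] by simp
        qed
        show ?thesis
        proof (rule LIM_zero_cancel, rule Lim_null_comparison)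
          show "\<forall>\<^sub>F n in sequentially. norm (sintegral (\<rho>n n s) \<phi> - sintegral (\<rho> s) \<phi>) \<le> c * (2 * B n)"
            unfolding real_norm_def by (intro always_eventually allI le)
          show "(\<lambda>n. c * (2 * B n)) \<longlonglongrightarrow> 0" using tendsto_mult_left[OF B2_lim, of c] by simp
        qed
      qed
      show "(\<lambda>n. sintegral (\<rho>n n t) \<phi>) \<longlonglongrightarrow> sintegral (\<rho> t) \<phi>" by (rule lim\<phi>[OF t])
      have "(\<lambda>n. integral {0..t} (?Gn n)) \<longlonglongrightarrow> integral {0..t} ?G"
      proof (rule dominated_convergence(2)[where f = ?Gn])
        show "?Gn n integrable_on {0..t}" for n
          using t by (intro sol_flow_integrable_sub(2)[OF sol \<epsilon>_pos \<phi>]) auto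
        show "(\<lambda>_. 4 * c * L * C\<^sub>V * M * K) integrable_on {0..t}" by (intro integrable_const_ivl)
      qed (use Gn_le G_lim t in auto)
      then have "(\<lambda>n. sintegral (\<rho>n n 0) \<phi> + (1/2) * integral {0..t} (?Gn n)) \<longlonglongrightarrow>
          sintegral (\<rho> 0) \<phi> + (1/2) * integral {0..t} ?G"
        by (intro tendsto_intros lim\<phi> T0)
      then show "(\<lambda>n. sintegral (\<rho>n n t) \<phi>) \<longlonglongrightarrow> sintegral \<rho>\<^sub>0 \<phi> + (1/2) * (LINT s:{0..t}|lebesgue. ?G s)"
        using sol_\<rho>_eq[OF sol \<epsilon>_pos t \<phi>] unfolding LI \<rho>_0 by simp
    qed
    then show "AE t in lebesgue. t \<in> {0..T} \<longrightarrow> sintegral (\<rho> t) \<phi> = sintegral \<rho>\<^sub>0 \<phi> + (1/2) * (LINT s:{0..t}|lebesgue. ?G s)"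
      by simp
  qed
  show ?thesis using AC \<rho>_0 cont d_lim by blast
qed

end

theorem theorem4p2:
  fixes T M L\<^sub>\<Phi> C\<^sub>V L\<^sub>V L\<^sub>\<omega> C\<^sub>\<omega> C'\<^sub>\<omega> :: real
    and \<Phi> :: "real \<Rightarrow> real \<Rightarrow> real \<Rightarrow> real"
    and \<mu> :: "(real ^ 'd) measure"
    and \<rho>\<^sub>0 :: "(real ^ 'd) smeasure"
    and V \<omega> D\<omega> :: "real \<Rightarrow> (real ^ 'd) smeasure \<Rightarrow> (real ^ 'd) \<times> (real ^ 'd) \<Rightarrow> real"
    and \<epsilon> :: "nat \<Rightarrow> real"
    and \<rho>n :: "nat \<Rightarrow> real \<Rightarrow> (real ^ 'd) smeasure"
    and \<eta>n :: "nat \<Rightarrow> real \<Rightarrow> (real ^ 'd) \<times> (real ^ 'd) \<Rightarrow> real"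
  assumes "T > 0" and "M > 0"
    and "flux_interpolation \<Phi> L\<^sub>\<Phi>"
    and "radon_measure \<mu>"
    and "\<rho>\<^sub>0 \<in> M_TV_ball M"
    and V_field: "\<forall>t\<in>{0..T}. \<forall>\<rho>\<in>M_TV_ball M. V t \<rho> \<in> V_as"
    and V_measurable: "\<forall>t\<in>{0..T}. \<forall>\<rho>\<in>M_TV_ball M.
          V t \<rho> \<in> borel_measurable (restrict_space borel offdiag)"
    and "C\<^sub>V > 0"
    and V_bound: "\<forall>t\<in>{0..T}. \<forall>\<rho>\<in>M_TV_ball M. \<forall>x.
          (\<integral>\<^sup>+y\<in>UNIV - {x}. ennreal \<bar>V t \<rho> (x, y)\<bar> \<partial>\<mu>) \<le> ennreal C\<^sub>V"
    and "L\<^sub>V \<ge> 0"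
    and V_lipschitz: "\<forall>t\<in>{0..T}. \<forall>\<rho>\<in>M_TV_ball M. \<forall>\<sigma>\<in>M_TV_ball M. \<forall>x.
          (\<integral>\<^sup>+y\<in>UNIV - {x}. ennreal \<bar>V t \<rho> (x, y) - V t \<sigma> (x, y)\<bar> \<partial>\<mu>)
            \<le> ennreal (L\<^sub>V * tv_norm (\<rho> - \<sigma>))"
    and \<omega>_continuous: "\<forall>t\<in>{0..T}. \<forall>\<sigma>\<in>M_TV_ball M. continuous_on offdiag (\<omega> t \<sigma>)"
    and \<omega>_L1: "\<forall>\<sigma>\<in>M_TV_ball M. \<forall>z\<in>offdiag. (\<lambda>t. \<omega> t \<sigma> z) absolutely_integrable_on {0..T}"
    and "L\<^sub>\<omega> \<ge> 0"
    and \<omega>_lipschitz: "\<forall>\<rho>\<in>M_TV_ball M. \<forall>\<sigma>\<in>M_TV_ball M. \<forall>t\<in>{0..T}. \<forall>z\<in>offdiag.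
          \<bar>\<omega> t \<sigma> z - \<omega> t \<rho> z\<bar> \<le> L\<^sub>\<omega> * tv_norm (\<sigma> - \<rho>)"
    and "C\<^sub>\<omega> > 0"
    and \<omega>_bound: "\<forall>t\<in>{0..T}. \<forall>\<rho>\<in>M_TV_ball M. \<forall>z\<in>offdiag. \<bar>\<omega> t \<rho> z\<bar> \<le> C\<^sub>\<omega>"
    and \<omega>_W11: "\<forall>\<sigma>\<in>M_TV_ball M. \<forall>z\<in>offdiag. (\<lambda>t. \<omega> t \<sigma> z) \<in> W11 T"
    and D\<omega>: "\<forall>\<sigma>\<in>M_TV_ball M. \<forall>z\<in>offdiag. weak_deriv T (\<lambda>t. \<omega> t \<sigma> z) (\<lambda>t. D\<omega> t \<sigma> z)"
    and "C'\<^sub>\<omega> > 0"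
    and D\<omega>_bound: "AE t in lebesgue. t \<in> {0..T} \<longrightarrow>
          (\<forall>\<sigma>\<in>M_TV_ball M. \<forall>z\<in>offdiag. \<bar>D\<omega> t \<sigma> z\<bar> \<le> C'\<^sub>\<omega>)"
    and \<epsilon>_pos: "\<forall>n. \<epsilon> n > 0"
    and \<epsilon>_lim: "\<epsilon> \<longlonglongrightarrow> 0"
    and solutions: "\<forall>n. is_solution T M \<Phi> \<mu> V \<omega> (\<epsilon> n) (\<rho>n n) (\<eta>n n)"
    and \<rho>_init: "(\<lambda>n. tv_norm (\<rho>n n 0 - \<rho>\<^sub>0)) \<longlonglongrightarrow> 0"
    and \<eta>_init: "(\<lambda>n. sup_norm (\<eta>n n 0 - \<omega> 0 (\<rho>n n 0))) \<longlonglongrightarrow> 0"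
  shows "\<exists>\<rho>. AC_curve tv_norm (M_TV_ball M) T \<rho> \<and> \<rho> 0 = \<rho>\<^sub>0 \<and>
           continuity_eq T \<Phi> \<mu> V (\<lambda>t. \<omega> t (\<rho> t)) \<rho> \<rho>\<^sub>0 \<and>
           (\<lambda>n. d_inf T (\<rho>n n, \<eta>n n) (\<rho>, \<lambda>t. \<omega> t (\<rho> t))) \<longlonglongrightarrow> 0"
proof -
  \<comment> \<open>The exceptional null set in \<open>D\<omega>_bound\<close> is common to all
    \<sigma> and \<open>z\<close>, so each function of time has the same bound on its weak
    derivative. Its continuity, contained in \<open>W11\<close>, makes the estimate hold at every
    time.\<close>
  have W: "\<bar>\<omega> t \<sigma> z - \<omega> s \<sigma> z\<bar> \<le> C'\<^sub>\<omega> * (t - s)"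
    if st: "0 \<le> s" "s \<le> t" "t \<le> T" and \<sigma>: "\<sigma> \<in> M_TV_ball M" and z: "z \<in> offdiag" for s t \<sigma> z
  proof (rule weak_deriv_lipschitz[OF _ _ _ _ st])
    show "continuous_on {0..T} (\<lambda>t. \<omega> t \<sigma> z)" using \<omega>_W11 \<sigma> z by (auto simp: W11_def)
    show "weak_deriv T (\<lambda>t. \<omega> t \<sigma> z) (\<lambda>t. D\<omega> t \<sigma> z)" using D\<omega> \<sigma> z by blast
    show "AE t in lebesgue. t \<in> {0..T} \<longrightarrow> \<bar>D\<omega> t \<sigma> z\<bar> \<le> C'\<^sub>\<omega>"
      using D\<omega>_bound by eventually_elim (use \<sigma> z in blast)
  qed (use \<open>C'\<^sub>\<omega> > 0\<close> in simp)
  interpret nonlocal_flow T M L\<^sub>\<Phi> C\<^sub>V L\<^sub>V L\<^sub>\<omega> C\<^sub>\<omega> C'\<^sub>\<omega> \<Phi> \<mu> V \<omega>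
  proof
    show "\<bar>\<omega> t \<sigma> z - \<omega> s \<sigma> z\<bar> \<le> C'\<^sub>\<omega> * (t - s)"
      if "0 \<le> s" "s \<le> t" "t \<le> T" "\<sigma> \<in> M_TV_ball M" "z \<in> offdiag" for s t \<sigma> z
      using that by (rule W)
    show "0 \<le> C'\<^sub>\<omega>" using \<open>C'\<^sub>\<omega> > 0\<close> by simp
  qed (rule assms(1-4,8,10,14,16) V_field[rule_format] V_measurable[rule_format] V_bound[rule_format]
      V_lipschitz[rule_format] \<omega>_continuous[rule_format] \<omega>_lipschitz[rule_format] \<omega>_bound[rule_format]; assumption)+
  show ?thesis
    by (rule solutions_converge[OF assms(5) \<epsilon>_pos[rule_format] \<epsilon>_lim solutions[rule_format] \<rho>_init \<eta>_init])
qed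

end
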